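(* Let $G$ be a finitely generated group and let $\{H_i\}$ be a finite family of finitely generated subgroups of $G$. If $\{H_i\}\hookrightarrow_h G$, then for each $\mu,c$ there exists $C$ with the property that, for each $i$, all $(\mu,c)$-quasi-geodesics in $G$ whose endpoints are in $H_i$ are contained in $N_C(H_i)$.
   Context: $G$ is endowed with the word metric $d_G$ of a fixed finite generating set. $N_C(A)$ denotes the closed $C$-neighbourhood of a subset $A$ with respect to $d_G$. Quasi-geodesics: a $(\mu,c)$-quasi-geodesic is a $(\mu,c)$-quasi-isometric embedding of an interval, i.e. a map $\gamma$ from an interval with $|s-t|/\mu-c\le d(\gamma(s),\gamma(t))\le \mu|s-t|+c$ for all $s,t$. Hyperbolically embedded subgroups: for $G$ a finitely generated group and $H_1,\dots,H_n<G$ finitely generated subgroups, one says that $\{H_i\}$ is hyperbolically embedded in $(G,Y)$, where $Y\subseteq G$ is a (possibly infinite) generating set, written $\{H_i\}\hookrightarrow_h (G,Y)$, if the Cayley graph $\Gamma=Cay(G,Y)$ is hyperbolic relative to the collection $\{gH_i\}$ of left cosets of the $H_i$'s, and the restriction of $d_\Gamma$ to each $H_i$ is proper (each ball of finite radius contains only finitely many elements of $H_i$). One writes $\{H_i\}\hookrightarrow_h G$ if $\{H_i\}\hookrightarrow_h (G,Y)$ for some such $Y$. Relatively hyperbolic metric spaces: a geodesic metric space $X$ is hyperbolic relative to a family $\mathcal P$ of subsets (also: asymptotically tree-graded with respect to $\mathcal P$) if every asymptotic cone of $X$ is tree-graded with respect to the collection of non-empty ultralimits of sequences of elements of $\mathcal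 P$, where ultralimits of two sequences that differ almost surely (with respect to the ultrafilter) are regarded as different pieces. A complete geodesic metric space $F$ is tree-graded with respect to a collection of closed geodesic subsets (pieces) if any two different pieces intersect in at most one point and every simple geodesic triangle in $F$ is contained in one piece. *)

theory Defs
  imports
    "HOL-Analysis.Abstract_Metric_Spaces"
    "HOL-Algebra.Left_Coset"
    "HOL-Algebra.Generated_Groups"
begin

section \<open>Geodesics and tree-graded spaces\<close>

text \<open>All metric spaces are carrier sets \<open>M\<close> with a distance \<open>d\<close>, as in the locale
  \<^locale>\<open>Metric_space\<close>. That locale demands non-negativity and symmetry of \<open>d\<close> also off the
  carrier, which is why the distances defined below are set to \<open>0\<close> there.\<close>

definition geodesic_path :: "'b set \<Rightarrow> ('b \<Rightarrow> 'b \<Rightarrow> real) \<Rightarrow> real \<Rightarrow> real \<Rightarrow> (real \<Rightarrow> 'b) \<Rightarrow> bool" where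
  "geodesic_path M d a b f \<longleftrightarrow>
     a \<le> b \<and> f ` {a..b} \<subseteq> M \<and> (\<forall>s\<in>{a..b}. \<forall>t\<in>{a..b}. d (f s) (f t) = \<bar>s - t\<bar>)"

definition geodesic_set :: "'b set \<Rightarrow> ('b \<Rightarrow> 'b \<Rightarrow> real) \<Rightarrow> bool" where
  "geodesic_set A d \<longleftrightarrow>
     (\<forall>x\<in>A. \<forall>y\<in>A. \<exists>a b f. geodesic_path A d a b f \<and> f a = x \<and> f b = y)"

definition geodesic_metric_space :: "'b set \<Rightarrow> ('b \<Rightarrow> 'b \<Rightarrow> real) \<Rightarrow> bool" where
  "geodesic_metric_space M d \<longleftrightarrow> Metric_space M d \<and> geodesic_set M d"

text \<open>A simple geodesic triangle is a simple loop composed of three geodesics. The loop is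
  non-constant (\<open>0 < l\<close>); single points are not triangles.\<close>

definition simple_geodesic_triangle :: "'b set \<Rightarrow> ('b \<Rightarrow> 'b \<Rightarrow> real) \<Rightarrow> 'b set \<Rightarrow> bool" where
  "simple_geodesic_triangle M d T \<longleftrightarrow>
     (\<exists>f s t l. 0 < l \<and> geodesic_path M d 0 s f \<and> geodesic_path M d s t f \<and> geodesic_path M d t l f \<and>
        f l = f 0 \<and> inj_on f {0..<l} \<and> T = f ` {0..l})"

text \<open>Pieces form an indexed family: pieces with different indices count as different, even if
  they happen to be equal as sets.\<close>

definition tree_graded ::
  "'b set \<Rightarrow> ('b \<Rightarrow> 'b \<Rightarrow> real) \<Rightarrow> 'k set \<Rightarrow> ('k \<Rightarrow> 'b set) \<Rightarrow> bool" where
  "tree_graded M d K P \<longleftrightarrow>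
     geodesic_metric_space M d \<and> Metric_space.mcomplete M d \<and>
     (\<forall>k\<in>K. closedin (Metric_space.mtopology M d) (P k) \<and> geodesic_set (P k) d) \<and>
     (\<forall>j\<in>K. \<forall>k\<in>K. j \<noteq> k \<longrightarrow> (\<forall>x\<in>P j \<inter> P k. \<forall>y\<in>P j \<inter> P k. x = y)) \<and>
     (\<forall>T. simple_geodesic_triangle M d T \<longrightarrow> (\<exists>k\<in>K. T \<subseteq> P k))"


section \<open>Asymptotic cones and relative hyperbolicity\<close>

definition nonprincipal_ultrafilter :: "nat filter \<Rightarrow> bool" where
  "nonprincipal_ultrafilter \<omega> \<longleftrightarrow> \<omega> \<noteq> bot \<and>
     (\<forall>P. eventually P \<omega> \<or> eventually (\<lambda>n. \<not> P n) \<omega>) \<and> (\<forall>m. eventually (\<lambda>n. n \<noteq> m) \<omega>)"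

definition cone_seqs ::
  "nat filter \<Rightarrow> 'b set \<Rightarrow> ('b \<Rightarrow> 'b \<Rightarrow> real) \<Rightarrow> (nat \<Rightarrow> 'b) \<Rightarrow> (nat \<Rightarrow> real) \<Rightarrow> (nat \<Rightarrow> 'b) set" where
  "cone_seqs \<omega> M d e r =
     {x. (\<forall>n. x n \<in> M) \<and> (\<exists>B. eventually (\<lambda>n. d (x n) (e n) / r n \<le> B) \<omega>)}"

definition cone_class ::
  "nat filter \<Rightarrow> 'b set \<Rightarrow> ('b \<Rightarrow> 'b \<Rightarrow> real) \<Rightarrow> (nat \<Rightarrow> 'b) \<Rightarrow> (nat \<Rightarrow> real) \<Rightarrow> (nat \<Rightarrow> 'b) \<Rightarrow>
     (nat \<Rightarrow> 'b) set" where
  "cone_class \<omega> M d e r x =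
     {y \<in> cone_seqs \<omega> M d e r. ((\<lambda>n. d (x n) (y n) / r n) \<longlongrightarrow> 0) \<omega>}"

definition asymptotic_cone ::
  "nat filter \<Rightarrow> 'b set \<Rightarrow> ('b \<Rightarrow> 'b \<Rightarrow> real) \<Rightarrow> (nat \<Rightarrow> 'b) \<Rightarrow> (nat \<Rightarrow> real) \<Rightarrow> (nat \<Rightarrow> 'b) set set" where
  "asymptotic_cone \<omega> M d e r = cone_class \<omega> M d e r ` cone_seqs \<omega> M d e r"

definition cone_dist ::
  "nat filter \<Rightarrow> 'b set \<Rightarrow> ('b \<Rightarrow> 'b \<Rightarrow> real) \<Rightarrow> (nat \<Rightarrow> 'b) \<Rightarrow> (nat \<Rightarrow> real) \<Rightarrow>
     (nat \<Rightarrow> 'b) set \<Rightarrow> (nat \<Rightarrow> 'b) set \<Rightarrow> real" where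
  "cone_dist \<omega> M d e r \<xi> \<eta> =
     (if \<xi> \<in> asymptotic_cone \<omega> M d e r \<and> \<eta> \<in> asymptotic_cone \<omega> M d e r
      then THE l. \<forall>x\<in>\<xi>. \<forall>y\<in>\<eta>. ((\<lambda>n. d (x n) (y n) / r n) \<longlongrightarrow> l) \<omega>
      else 0)"

text \<open>Sequences of members of \<open>\<P>\<close>, up to almost sure equality, index the ultralimits.\<close>

definition seq_class :: "nat filter \<Rightarrow> 'b set set \<Rightarrow> (nat \<Rightarrow> 'b set) \<Rightarrow> (nat \<Rightarrow> 'b set) set" where
  "seq_class \<omega> \<P> A = {A'. (\<forall>n. A' n \<in> \<P>) \<and> eventually (\<lambda>n. A' n = A n) \<omega>}"

definition seq_classes :: "nat filter \<Rightarrow> 'b set set \<Rightarrow> (nat \<Rightarrow> 'b set) set set" where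
  "seq_classes \<omega> \<P> = seq_class \<omega> \<P> ` {A. \<forall>n. A n \<in> \<P>}"

definition ultralimit ::
  "nat filter \<Rightarrow> 'b set \<Rightarrow> ('b \<Rightarrow> 'b \<Rightarrow> real) \<Rightarrow> (nat \<Rightarrow> 'b) \<Rightarrow> (nat \<Rightarrow> real) \<Rightarrow>
     (nat \<Rightarrow> 'b set) set \<Rightarrow> (nat \<Rightarrow> 'b) set set" where
  "ultralimit \<omega> M d e r \<alpha> =
     {cone_class \<omega> M d e r x | x A. x \<in> cone_seqs \<omega> M d e r \<and> A \<in> \<alpha> \<and>
        eventually (\<lambda>n. x n \<in> A n) \<omega>}"

definition relatively_hyperbolic_space ::
  "'b set \<Rightarrow> ('b \<Rightarrow> 'b \<Rightarrow> real) \<Rightarrow> 'b set set \<Rightarrow> bool" where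
  "relatively_hyperbolic_space M d \<P> \<longleftrightarrow>
     geodesic_metric_space M d \<and> (\<forall>A\<in>\<P>. A \<subseteq> M) \<and>
     (\<forall>\<omega> e r. nonprincipal_ultrafilter \<omega> \<and> (\<forall>n. e n \<in> M) \<and> filterlim r at_top \<omega> \<longrightarrow>
        tree_graded (asymptotic_cone \<omega> M d e r) (cone_dist \<omega> M d e r)
          {\<alpha> \<in> seq_classes \<omega> \<P>. ultralimit \<omega> M d e r \<alpha> \<noteq> {}} (ultralimit \<omega> M d e r))"


section \<open>Word metrics and Cayley graphs\<close>

definition sym_gens :: "('a, 'm) monoid_scheme \<Rightarrow> 'a set \<Rightarrow> 'a set" where
  "sym_gens G Y = Y \<union> (\<lambda>y. inv\<^bsub>G\<^esub> y) ` Y"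

definition word_length :: "('a, 'm) monoid_scheme \<Rightarrow> 'a set \<Rightarrow> 'a \<Rightarrow> nat" where
  "word_length G Y g =
     (LEAST n. \<exists>w. length w = n \<and> set w \<subseteq> sym_gens G Y \<and> foldr (\<otimes>\<^bsub>G\<^esub>) w \<one>\<^bsub>G\<^esub> = g)"

definition word_dist :: "('a, 'm) monoid_scheme \<Rightarrow> 'a set \<Rightarrow> 'a \<Rightarrow> 'a \<Rightarrow> real" where
  "word_dist G Y g h = real (word_length G Y (inv\<^bsub>G\<^esub> g \<otimes>\<^bsub>G\<^esub> h))"

text \<open>The Cayley graph is the geometric realisation, with edges of length one, of the simple graph
  on \<open>carrier G\<close> in which \<open>g\<close> and \<open>g y\<close> are joined for \<open>y\<close> a generator or the inverse of one. A
  point is given by its barycentric coordinates: \<open>p\<close> on the edge \<open>{g, h}\<close> lies at distance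
  \<open>1 - p g\<close> from \<open>g\<close>.\<close>

definition cayley_cells :: "('a, 'm) monoid_scheme \<Rightarrow> 'a set \<Rightarrow> 'a set set" where
  "cayley_cells G Y = {{g} | g. g \<in> carrier G} \<union>
     {{g, h} | g h. g \<in> carrier G \<and> h \<in> carrier G \<and> g \<noteq> h \<and> inv\<^bsub>G\<^esub> g \<otimes>\<^bsub>G\<^esub> h \<in> sym_gens G Y}"

definition supp :: "('a \<Rightarrow> real) \<Rightarrow> 'a set" where
  "supp p = {x. p x \<noteq> 0}"

definition cayley_graph :: "('a, 'm) monoid_scheme \<Rightarrow> 'a set \<Rightarrow> ('a \<Rightarrow> real) set" where
  "cayley_graph G Y = {p. (\<forall>x. 0 \<le> p x) \<and> supp p \<in> cayley_cells G Y \<and> sum p (supp p) = 1}"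

text \<open>The path metric: inside a common edge the distance is the length of the segment (half the
  \<open>\<ell>\<^sup>1\<close>-distance of the coordinates); otherwise a shortest path leaves the edge of \<open>p\<close> through an
  endpoint \<open>u\<close>, follows edges, and enters the edge of \<open>q\<close> through an endpoint \<open>v\<close>.\<close>

definition cayley_dist ::
  "('a, 'm) monoid_scheme \<Rightarrow> 'a set \<Rightarrow> ('a \<Rightarrow> real) \<Rightarrow> ('a \<Rightarrow> real) \<Rightarrow> real" where
  "cayley_dist G Y p q =
     (if p \<in> cayley_graph G Y \<and> q \<in> cayley_graph G Y
      then if \<exists>\<sigma>\<in>cayley_cells G Y. supp p \<union> supp q \<subseteq> \<sigma>
           then (\<Sum>x\<in>supp p \<union> supp q. \<bar>p x - q x\<bar>) / 2
           else Min {(1 - p u) + word_dist G Y u v + (1 - q v) | u v. u \<in> supp p \<and> v \<in> supp q}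
      else 0)"

definition vertex :: "'a \<Rightarrow> 'a \<Rightarrow> real" where
  "vertex g = (\<lambda>x. if x = g then 1 else 0)"


section \<open>Hyperbolically embedded subgroups and quasi-geodesics\<close>

definition hyperbolically_embedded_wrt ::
  "('a, 'm) monoid_scheme \<Rightarrow> 'a set \<Rightarrow> 'i set \<Rightarrow> ('i \<Rightarrow> 'a set) \<Rightarrow> bool" where
  "hyperbolically_embedded_wrt G Y I H \<longleftrightarrow>
     Y \<subseteq> carrier G \<and> generate G Y = carrier G \<and>
     relatively_hyperbolic_space (cayley_graph G Y) (cayley_dist G Y)
       (\<Union>i\<in>I. (\<lambda>A. vertex ` A) ` (lcosets\<^bsub>G\<^esub> (H i))) \<and>
     (\<forall>i\<in>I. \<forall>g\<in>H i. \<forall>R. finite {h \<in> H i. cayley_dist G Y (vertex g) (vertex h) \<le> R})"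

definition hyperbolically_embedded ::
  "('a, 'm) monoid_scheme \<Rightarrow> 'i set \<Rightarrow> ('i \<Rightarrow> 'a set) \<Rightarrow> bool" where
  "hyperbolically_embedded G I H \<longleftrightarrow> (\<exists>Y. hyperbolically_embedded_wrt G Y I H)"

definition quasi_geodesic ::
  "'b set \<Rightarrow> ('b \<Rightarrow> 'b \<Rightarrow> real) \<Rightarrow> real \<Rightarrow> real \<Rightarrow> real \<Rightarrow> real \<Rightarrow> (real \<Rightarrow> 'b) \<Rightarrow> bool" where
  "quasi_geodesic M d \<mu> c a b \<gamma> \<longleftrightarrow>
     a \<le> b \<and> \<gamma> ` {a..b} \<subseteq> M \<and>
     (\<forall>s\<in>{a..b}. \<forall>t\<in>{a..b}. \<bar>s - t\<bar> / \<mu> - c \<le> d (\<gamma> s) (\<gamma> t) \<and> d (\<gamma> s) (\<gamma> t) \<le> \<mu> * \<bar>s - t\<bar> + c)"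

text \<open>The infimum defining the distance to \<open>A\<close> is attained for integer-valued metrics such as
  word metrics.\<close>

definition closed_nbhd :: "'b set \<Rightarrow> ('b \<Rightarrow> 'b \<Rightarrow> real) \<Rightarrow> real \<Rightarrow> 'b set \<Rightarrow> 'b set" where
  "closed_nbhd M d C A = {x \<in> M. \<exists>y\<in>A. d x y \<le> C}"

end

theory Submission
  imports Defs
begin

text \<open>Let \<open>\<Gamma>\<close> be the Cayley graph of the (possibly infinite) generating set \<open>Y\<close>. Two facts about the
  cosets are extracted from the asymptotic cones of \<open>\<Gamma>\<close>, each time by rescaling a sequence of
  counterexamples. Distinct cosets have bounded coarse intersections. Nearest-point projections are
  contracting: points \<open>x\<close>, \<open>y\<close> with \<open>d x y\<close> at most half of the distance from \<open>x\<close> to the coset have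
  projections at bounded distance.

  Since \<open>d\<^sub>\<Gamma>\<close> is proper on each \<open>H i\<close>, bounds for projections in \<open>\<Gamma>\<close> become bounds for the word metric of
  the finite generating set \<open>S\<close>. Combining both facts, far from \<open>H i\<close> the projection to \<open>H i\<close>
  contracts the word metric of \<open>S\<close> by an arbitrarily small factor, up to an additive constant and at a
  sufficiently large scale. A quasi-geodesic therefore cannot afford a long excursion away from
  \<open>H i\<close>: its length is linear in the distance of its endpoints, which is close to that of their
  projections.\<close>

section \<open>Geodesics\<close>

text \<open>Since \<open>Y\<close> may be infinite, balls of \<Gamma> may be infinite too: a bound
  on a \<open>Y\<close>-distance yields one on the \<open>S\<close>-distance only between points of
  one \<open>H i\<close>. This is why estimates pass through projections.

  The small factor comes from the order of the constants. Contraction bounds one jump of the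
  projection by \<open>B\<close>, however long the jump; properness turns \<open>B\<close> into an
  \<open>S\<close>-bound \<open>\<beta>\<close>; only then is the jump length \<open>J\<close>
  fixed, large compared with \<open>\<beta>\<close>. The price is that a jump of length
  \<open>J\<close> has to start at \<open>Y\<close>-distance \<open>2 * J\<close> from the subgroup.
  Being \<open>S\<close>-far does not ensure this, because \<open>S\<close>-far points can be
  \<open>Y\<close>-close. Bounded intersections help here: up to translation, only finitely many
  cosets are followed for long by the \<open>Y\<close>-geodesics in question, and being
  \<open>S\<close>-far excludes these.

  For contraction the obstacle is that a cone shows a strip at one scale only, and a scale adapted
  to its length may collapse its width. Hence one sequence of strips is viewed in two cones.\<close>

lemma geodesic_pathD:
  assumes "geodesic_path M d a b f"
  shows "a \<le> b"
    and "\<And>s. a \<le> s \<Longrightarrow> s \<le> b \<Longrightarrow> f s \<in> M"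
    and "\<And>s t. \<lbrakk>a \<le> s; s \<le> b; a \<le> t; t \<le> b\<rbrakk> \<Longrightarrow> d (f s) (f t) = \<bar>s - t\<bar>"
  using assms by (auto simp: geodesic_path_def)

lemma geodesic_pathI:
  assumes "a \<le> b" "\<And>s. a \<le> s \<Longrightarrow> s \<le> b \<Longrightarrow> f s \<in> M"
    and "\<And>s t. \<lbrakk>a \<le> s; s \<le> b; a \<le> t; t \<le> b\<rbrakk> \<Longrightarrow> d (f s) (f t) = \<bar>s - t\<bar>"
  shows "geodesic_path M d a b f"
  using assms by (auto simp: geodesic_path_def)

lemma geodesic_path_subinterval:
  assumes "geodesic_path M d a b f" "a \<le> a'" "a' \<le> b'" "b' \<le> b"
  shows "geodesic_path M d a' b' f"
  using assms by (intro geodesic_pathI) (auto simp: geodesic_pathD[OF assms(1)])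

lemma geodesic_path_segment:
  assumes f: "geodesic_path M d a b f" and u: "u \<in> {a..b}" and v: "v \<in> {a..b}"
  obtains g where "geodesic_path M d 0 \<bar>v - u\<bar> g" "g 0 = f u" "g \<bar>v - u\<bar> = f v"
    "g ` {0..\<bar>v - u\<bar>} \<subseteq> f ` {a..b}"
proof (cases "u \<le> v")
  case True
  show ?thesis
  proof (rule that[of "\<lambda>t. f (u + t)"])
    show "geodesic_path M d 0 \<bar>v - u\<bar> (\<lambda>t. f (u + t))"
      using True u v by (intro geodesic_pathI) (auto simp: geodesic_pathD[OF f])
  qed (use True u v in auto)
next
  case False
  show ?thesis
  proof (rule that[of "\<lambda>t. f (u - t)"])
    show "geodesic_path M d 0 \<bar>v - u\<bar> (\<lambda>t. f (u - t))"
      using False u v by (intro geodesic_pathI) (auto simp: geodesic_pathD[OF f])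
  qed (use False u v in auto)
qed

section \<open>Hitting times of geodesics in closed sets\<close>

context Metric_space
begin

lemma geodesic_path_continuous:
  assumes f: "geodesic_path M d a b f"
  shows "continuous_map (top_of_set {a..b}) mtopology f"
  unfolding continuous_map_to_metric
proof (intro strip)
  fix x \<epsilon> :: real assume x: "x \<in> topspace (top_of_set {a..b})" and "\<epsilon> > 0"
  show "\<exists>U. openin (top_of_set {a..b}) U \<and> x \<in> U \<and> (\<forall>y\<in>U. f y \<in> mball (f x) \<epsilon>)"
  proof (intro exI conjI ballI)
    show "openin (top_of_set {a..b}) ({a..b} \<inter> ball x \<epsilon>)"
      by (simp add: openin_open_Int)
    show "x \<in> {a..b} \<inter> ball x \<epsilon>" using x \<open>\<epsilon> > 0\<close> by simp
    fix y assume "y \<in> {a..b} \<inter> ball x \<epsilon>"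
    then show "f y \<in> mball (f x) \<epsilon>"
      using x by (auto simp: geodesic_pathD[OF f] dist_real_def)
  qed
qed

lemma geodesic_path_closedin:
  assumes "geodesic_path M d a b f"
  shows "closedin mtopology (f ` {a..b})"
proof (rule compactin_imp_closedin[OF Hausdorff_space_mtopology])
  have "compactin (top_of_set {a..b}) {a..b}" by (simp add: compactin_subtopology)
  then show "compactin mtopology (f ` {a..b})"
    using image_compactin geodesic_path_continuous[OF assms] by blast
qed

lemma geodesic_path_hits_compact:
  assumes "geodesic_path M d a b f" "closedin mtopology C"
  shows "compact {s \<in> {a..b}. f s \<in> C}"
proof -
  have "closedin (top_of_set {a..b}) {s \<in> {a..b}. f s \<in> C}"
    using closedin_continuous_map_preimage[OF geodesic_path_continuous[OF assms(1)] assms(2)] by simp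
  then show ?thesis using closedin_compact by blast
qed

lemma geodesic_path_first_hit:
  assumes f: "geodesic_path M d a b f" and C: "closedin mtopology C" and s: "s \<in> {a..b}" "f s \<in> C"
  obtains u where "u \<in> {a..s}" "f u \<in> C" "\<And>t. a \<le> t \<Longrightarrow> t < u \<Longrightarrow> f t \<notin> C"
proof -
  have "{s \<in> {a..b}. f s \<in> C} \<noteq> {}" using s by blast
  from compact_attains_inf[OF geodesic_path_hits_compact[OF f C] this]
  obtain u where u: "u \<in> {a..b}" "f u \<in> C" "\<And>t. t \<in> {a..b} \<Longrightarrow> f t \<in> C \<Longrightarrow> u \<le> t" by auto
  show ?thesis
  proof (rule that[of u])
    show "f t \<notin> C" if "a \<le> t" "t < u" for t using u(1) u(3)[of t] that by auto
  qed (use u s in auto)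
qed

lemma geodesic_path_last_hit:
  assumes f: "geodesic_path M d a b f" and C: "closedin mtopology C" and s: "s \<in> {a..b}" "f s \<in> C"
  obtains u where "u \<in> {s..b}" "f u \<in> C" "\<And>t. u < t \<Longrightarrow> t \<le> b \<Longrightarrow> f t \<notin> C"
proof -
  have "{s \<in> {a..b}. f s \<in> C} \<noteq> {}" using s by blast
  from compact_attains_sup[OF geodesic_path_hits_compact[OF f C] this]
  obtain u where u: "u \<in> {a..b}" "f u \<in> C" "\<And>t. t \<in> {a..b} \<Longrightarrow> f t \<in> C \<Longrightarrow> t \<le> u" by auto
  show ?thesis
  proof (rule that[of u])
    show "f t \<notin> C" if "u < t" "t \<le> b" for t using u(1) u(3)[of t] that by auto
  qed (use u s in auto)
qed

end

lemma geodesic_set_path: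
  assumes "geodesic_set A d" "x \<in> A" "y \<in> A"
  obtains f l where "geodesic_path A d 0 l f" "f 0 = x" "f l = y"
proof -
  obtain a b g where g: "geodesic_path A d a b g" "g a = x" "g b = y"
    using assms unfolding geodesic_set_def by blast
  have ab: "a \<le> b" using geodesic_pathD(1)[OF g(1)] .
  obtain f where "geodesic_path A d 0 \<bar>b - a\<bar> f" "f 0 = g a" "f \<bar>b - a\<bar> = g b"
    using geodesic_path_segment[OF g(1), of a b] ab by (metis atLeastAtMost_iff order_refl)
  then show ?thesis using that g by metis
qed

text \<open>A relation, since a nearest point need neither exist nor be unique. In cones, nearest
  points are exhibited as limits of nearest vertices.\<close>

definition nearest :: "('b \<Rightarrow> 'b \<Rightarrow> real) \<Rightarrow> 'b set \<Rightarrow> 'b \<Rightarrow> 'b \<Rightarrow> bool" where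
  "nearest d A x p \<longleftrightarrow> p \<in> A \<and> (\<forall>a\<in>A. d x p \<le> d x a)"


section \<open>Tree-graded spaces\<close>

locale tree_graded_space =
  fixes M :: "'b set" and d :: "'b \<Rightarrow> 'b \<Rightarrow> real" and K :: "'k set" and P :: "'k \<Rightarrow> 'b set"
  assumes tree_graded: "tree_graded M d K P"
begin

lemma geodesic_metric_space: "geodesic_metric_space M d"
  using tree_graded by (simp add: tree_graded_def)

sublocale Metric_space M d
  using geodesic_metric_space by (simp add: geodesic_metric_space_def)

lemma geodesic_set: "geodesic_set M d"
  using geodesic_metric_space by (simp add: geodesic_metric_space_def)

lemma piece_closedin: "k \<in> K \<Longrightarrow> closedin mtopology (P k)"
  using tree_graded by (simp add: tree_graded_def)

lemma piece_geodesic: "k \<in> K \<Longrightarrow> geodesic_set (P k) d"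
  using tree_graded by (simp add: tree_graded_def)

lemma triangle_in_piece: "simple_geodesic_triangle M d T \<Longrightarrow> \<exists>k\<in>K. T \<subseteq> P k"
  using tree_graded by (simp add: tree_graded_def)

lemma piece_eqI:
  assumes "j \<in> K" "k \<in> K" "x \<in> P j" "x \<in> P k" "y \<in> P j" "y \<in> P k" "x \<noteq> y"
  shows "j = k"
proof -
  have "\<forall>j\<in>K. \<forall>k\<in>K. j \<noteq> k \<longrightarrow> (\<forall>x\<in>P j \<inter> P k. \<forall>y\<in>P j \<inter> P k. x = y)"
    using tree_graded by (simp add: tree_graded_def)
  then show ?thesis using assms by (metis IntI)
qed

lemma piece_subset: "k \<in> K \<Longrightarrow> P k \<subseteq> M"
  using piece_closedin closedin_subset by fastforce

text \<open>The third side \<open>j\<close> may run along \<open>g\<close> and \<open>h\<close> near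
  its ends. Cutting \<open>g\<close> and \<open>h\<close> where they first meet \<open>j\<close>
  leaves a simple loop made of three geodesics, and such a loop lies in one piece. The cut points
  are recorded to lie on \<open>j\<close> because this is how later arguments locate them.\<close>

lemma tripod_in_piece:
  assumes g: "geodesic_path M d 0 a g" and h: "geodesic_path M d 0 b h" and gh: "g 0 = h 0"
    and disj: "\<And>s t. \<lbrakk>s \<in> {0..a}; t \<in> {0..b}; g s = h t\<rbrakk> \<Longrightarrow> s = 0"
    and j: "geodesic_path M d 0 l j" and j0: "j 0 = g a" and jl: "j l = h b"
    and apex: "g 0 \<notin> j ` {0..l}"
  obtains k \<sigma> \<tau> where "k \<in> K" "\<sigma> \<in> {0<..a}" "\<tau> \<in> {0<..b}"
    "g ` {0..\<sigma>} \<subseteq> P k" "h ` {0..\<tau>} \<subseteq> P k" "g \<sigma> \<in> j ` {0..l}" "h \<tau> \<in> j ` {0..l}"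
proof -
  note gD = geodesic_pathD[OF g] and hD = geodesic_pathD[OF h] and jD = geodesic_pathD[OF j]
  have disj': "t = 0" if "s \<in> {0..a}" "t \<in> {0..b}" "g s = h t" for s t
  proof -
    have "s = 0" using disj that by blast
    then have "h t = h 0" using that gh by simp
    then show ?thesis using hD(3)[of t 0] that hD(1) hD(2)[of 0] by simp
  qed
  have cj: "closedin mtopology (j ` {0..l})" by (rule geodesic_path_closedin[OF j])
  obtain \<sigma> where \<sigma>: "\<sigma> \<in> {0..a}" "g \<sigma> \<in> j ` {0..l}" "\<And>t. 0 \<le> t \<Longrightarrow> t < \<sigma> \<Longrightarrow> g t \<notin> j ` {0..l}"
  proof -
    have "g a \<in> j ` {0..l}" using j0 jD(1) by (metis atLeastAtMost_iff image_eqI order_refl)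
    then show ?thesis using geodesic_path_first_hit[OF g cj, of a] gD(1) that by auto
  qed
  obtain \<tau> where \<tau>: "\<tau> \<in> {0..b}" "h \<tau> \<in> j ` {0..l}" "\<And>t. 0 \<le> t \<Longrightarrow> t < \<tau> \<Longrightarrow> h t \<notin> j ` {0..l}"
  proof -
    have "h b \<in> j ` {0..l}" using jl jD(1) by (metis atLeastAtMost_iff image_eqI order_refl)
    then show ?thesis using geodesic_path_first_hit[OF h cj, of b] hD(1) that by auto
  qed
  have \<sigma>0: "\<sigma> > 0" using \<sigma> apex by (cases "\<sigma> = 0") auto
  have \<tau>0: "\<tau> > 0" using \<tau> apex gh by (cases "\<tau> = 0") auto
  obtain u v where u: "u \<in> {0..l}" "g \<sigma> = j u" and v: "v \<in> {0..l}" "h \<tau> = j v" using \<sigma> \<tau> by blast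
  define m where "m = \<bar>v - u\<bar>"
  obtain i where i: "geodesic_path M d 0 m i" "i 0 = g \<sigma>" "i m = h \<tau>" "i ` {0..m} \<subseteq> j ` {0..l}"
    using geodesic_path_segment[OF j u(1) v(1)] u(2) v(2) unfolding m_def by metis
  note iD = geodesic_pathD[OF i(1)]
  have "g \<sigma> \<noteq> h \<tau>" using disj[of \<sigma> \<tau>] \<sigma> \<tau> \<sigma>0 by auto
  then have m0: "m > 0" using i(2,3) iD(1) by (cases "m = 0") auto
  \<comment> \<open>The loop runs along \<open>g\<close> to its cut, along the part \<open>i\<close>
    of \<open>j\<close> between the cuts, and backwards along \<open>h\<close> to the common
    origin.\<close>
  define F where "F t = (if t \<le> \<sigma> then g t else if t \<le> \<sigma> + m then i (t - \<sigma>) else h (\<sigma> + m + \<tau> - t))" for t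
  define L where "L = \<sigma> + m + \<tau>"
  have F1: "F t = g t" if "t \<le> \<sigma>" for t using that by (simp add: F_def)
  have F2: "F t = i (t - \<sigma>)" if "\<sigma> \<le> t" "t \<le> \<sigma> + m" for t
    using that i(2) by (auto simp: F_def)
  have F3: "F t = h (L - t)" if "\<sigma> + m \<le> t" for t
    using that i(3) m0 by (auto simp: F_def L_def)
  have p1: "geodesic_path M d 0 \<sigma> F"
    using \<sigma> by (intro geodesic_pathI) (auto simp: F1 gD)
  have p2: "geodesic_path M d \<sigma> (\<sigma> + m) F"
    using m0 by (intro geodesic_pathI) (auto simp: F2 iD)
  have p3: "geodesic_path M d (\<sigma> + m) L F"
    using \<tau> by (intro geodesic_pathI) (auto simp: F3 hD L_def)
  have ne12: "F s \<noteq> F t" if "0 \<le> s" "s < \<sigma>" "\<sigma> \<le> t" "t \<le> \<sigma> + m" for s t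
  proof -
    have "F t \<in> j ` {0..l}" using i(4) that by (auto simp: F2)
    then show ?thesis using \<sigma>(3)[of s] that by (auto simp: F1)
  qed
  \<comment> \<open>The strict bound \<open>t < L\<close> matters: at \<open>L\<close> the loop
    closes up in \<open>h 0 = g 0\<close>.\<close>
  have ne13: "F s \<noteq> F t" if "0 \<le> s" "s \<le> \<sigma>" "\<sigma> + m \<le> t" "t < L" for s t
  proof
    assume "F s = F t"
    then have "g s = h (L - t)" using that by (simp add: F1 F3)
    moreover have "s \<in> {0..a}" "L - t \<in> {0..b}" using that \<sigma> \<tau> by (auto simp: L_def)
    ultimately have "L - t = 0" using disj' by blast
    then show False using that by simp
  qed
  have ne23: "F s \<noteq> F t" if "\<sigma> \<le> s" "s \<le> \<sigma> + m" "\<sigma> + m < t" "t \<le> L" for s t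
  proof -
    have "F s \<in> j ` {0..l}" using i(4) that by (auto simp: F2)
    then show ?thesis using \<tau>(3)[of "L - t"] that by (auto simp: F3 L_def)
  qed
  have inj_path: "s = t" if "geodesic_path M d x y F" "F s = F t" "x \<le> s" "s \<le> y" "x \<le> t" "t \<le> y" for x y s t
    using geodesic_pathD(3)[OF that(1), of s t] geodesic_pathD(2)[OF that(1), of t] that by simp
  have inj': "F s \<noteq> F t" if "0 \<le> s" "s < t" "t < L" for s t
  proof -
    consider "t \<le> \<sigma>" | "s < \<sigma>" "\<sigma> < t" "t \<le> \<sigma> + m" | "s \<le> \<sigma>" "\<sigma> + m < t"
      | "\<sigma> \<le> s" "t \<le> \<sigma> + m" | "\<sigma> \<le> s" "s \<le> \<sigma> + m" "\<sigma> + m < t" | "\<sigma> + m < s" using that by linarith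
    then show ?thesis
    proof cases
      case 1 then show ?thesis using inj_path[OF p1, of s t] that by auto
    next
      case 2 then show ?thesis using ne12[of s t] that by auto
    next
      case 3 then show ?thesis using ne13[of s t] that by auto
    next
      case 4 then show ?thesis using inj_path[OF p2, of s t] that by auto
    next
      case 5 then show ?thesis using ne23[of s t] that by auto
    next
      case 6 then show ?thesis using inj_path[OF p3, of s t] that by auto
    qed
  qed
  have inj: "inj_on F {0..<L}"
    by (rule linorder_inj_onI) (use inj' in auto)
  have L0: "0 < L" using \<sigma>0 m0 \<tau>0 by (simp add: L_def)
  have "F L = F 0" using \<sigma>0 \<tau>0 gh by (simp add: F1 F3 L_def)
  then have "simple_geodesic_triangle M d (F ` {0..L})"
    unfolding simple_geodesic_triangle_def using p1 p2 p3 inj L0 by blast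
  then obtain k where k: "k \<in> K" "F ` {0..L} \<subseteq> P k" using triangle_in_piece by blast
  show ?thesis
  proof (rule that[OF k(1)])
    show "\<sigma> \<in> {0<..a}" "\<tau> \<in> {0<..b}" using \<sigma> \<tau> \<sigma>0 \<tau>0 by auto
    show "g ` {0..\<sigma>} \<subseteq> P k"
    proof safe
      fix s assume "s \<in> {0..\<sigma>}"
      then have "g s = F s" "s \<in> {0..L}" using m0 \<tau>0 by (auto simp: F1 L_def)
      then show "g s \<in> P k" using k(2) by auto
    qed
    show "h ` {0..\<tau>} \<subseteq> P k"
    proof safe
      fix s assume "s \<in> {0..\<tau>}"
      then have "h s = F (L - s)" "L - s \<in> {0..L}" using m0 \<sigma>0 by (auto simp: F3 L_def)
      then show "h s \<in> P k" using k(2) by auto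
    qed
  qed (use \<sigma> \<tau> in auto)
qed

text \<open>If two branches from a point outside the piece entered it at different points, a
  geodesic inside the piece would close them to a tripod. The piece of that tripod would share both
  entry points with \<open>P k\<close>, hence be the same piece, yet contain the origin of the
  fork.\<close>

lemma fork_endpoints_eq:
  assumes k: "k \<in> K" and g: "geodesic_path M d 0 a g" and h: "geodesic_path M d 0 b h"
    and gh: "g 0 = h 0"
    and disj: "\<And>s t. \<lbrakk>s \<in> {0..a}; t \<in> {0..b}; g s = h t\<rbrakk> \<Longrightarrow> s = 0"
    and z: "g 0 \<notin> P k"
    and ga: "g a \<in> P k" "\<And>s. 0 \<le> s \<Longrightarrow> s < a \<Longrightarrow> g s \<notin> P k"
    and hb: "h b \<in> P k" "\<And>s. 0 \<le> s \<Longrightarrow> s < b \<Longrightarrow> h s \<notin> P k"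
  shows "g a = h b"
proof (rule ccontr)
  assume ne: "g a \<noteq> h b"
  obtain j l where j: "geodesic_path (P k) d 0 l j" "j 0 = g a" "j l = h b"
    using geodesic_set_path[OF piece_geodesic[OF k] ga(1) hb(1)] .
  have jP: "j ` {0..l} \<subseteq> P k" using j(1) by (simp add: geodesic_path_def)
  have j': "geodesic_path M d 0 l j"
    using j(1) piece_subset[OF k] by (auto simp: geodesic_path_def)
  obtain i \<sigma> \<tau> where *: "i \<in> K" "\<sigma> \<in> {0<..a}" "\<tau> \<in> {0<..b}" "g ` {0..\<sigma>} \<subseteq> P i" "h ` {0..\<tau>} \<subseteq> P i"
    "g \<sigma> \<in> j ` {0..l}" "h \<tau> \<in> j ` {0..l}"
  proof -
    have apex: "g 0 \<notin> j ` {0..l}" using z jP by blast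
    show ?thesis
      by (rule tripod_in_piece[OF g h gh _ j' j(2,3)]) (fact disj apex that)+
  qed
  \<comment> \<open>The cut points lie on \<open>j\<close>, hence in the piece, which the branches
    meet only at their ends; so nothing was cut off.\<close>
  have "g \<sigma> \<in> P k" "h \<tau> \<in> P k" using *(6,7) jP by auto
  then have "\<sigma> = a" "\<tau> = b"
    using ga(2)[of \<sigma>] hb(2)[of \<tau>] *(2,3) by (cases "\<sigma> < a"; cases "\<tau> < b"; auto)+
  then have "g a \<in> P i" "h b \<in> P i" "g 0 \<in> P i" using *(2-5) by auto
  then have "i = k" using piece_eqI[OF *(1) k] ga(1) hb(1) ne by blast
  then show False using \<open>g 0 \<in> P i\<close> z by simp
qed

text \<open>On an excursion through \<open>g s\<close>, the two directions from \<open>g s\<close>,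
  followed up to the neighbouring visits \<open>u\<close> and \<open>v\<close> of the piece, form a
  fork. Its ends would coincide, which is impossible on a geodesic with
  \<open>v < u\<close>.\<close>

lemma geodesic_in_piece:
  assumes k: "k \<in> K" and g: "geodesic_path M d a b g" and ends: "g a \<in> P k" "g b \<in> P k" and s: "s \<in> {a..b}"
  shows "g s \<in> P k"
proof (rule ccontr)
  assume ns: "g s \<notin> P k"
  note gD = geodesic_pathD[OF g]
  have g1: "geodesic_path M d s b g" and g2: "geodesic_path M d a s g"
    using s by (auto intro: geodesic_path_subinterval[OF g])
  obtain u where u: "u \<in> {s..b}" "g u \<in> P k" "\<And>t. s \<le> t \<Longrightarrow> t < u \<Longrightarrow> g t \<notin> P k"
    using geodesic_path_first_hit[OF g1 piece_closedin[OF k], of b] ends s by auto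
  obtain v where v: "v \<in> {a..s}" "g v \<in> P k" "\<And>t. v < t \<Longrightarrow> t \<le> s \<Longrightarrow> g t \<notin> P k"
    using geodesic_path_last_hit[OF g2 piece_closedin[OF k], of a] ends s by auto
  have su: "s < u" and vs: "v < s" using u v ns by (cases "u = s"; cases "v = s"; auto)+
  have "g (s + (u - s)) = g (s - (s - v))"
  proof (rule fork_endpoints_eq[OF k, where g = "\<lambda>t. g (s + t)" and h = "\<lambda>t. g (s - t)"])
    show "geodesic_path M d 0 (u - s) (\<lambda>t. g (s + t))"
      using su u s by (intro geodesic_pathI) (auto simp: gD)
    show "geodesic_path M d 0 (s - v) (\<lambda>t. g (s - t))"
      using vs v s by (intro geodesic_pathI) (auto simp: gD)
    fix x y assume xy: "x \<in> {0..u - s}" "y \<in> {0..s - v}" "g (s + x) = g (s - y)"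
    have "d (g (s + x)) (g (s - y)) = \<bar>x + y\<bar>"
      using xy(1,2) u v s by (subst gD(3)) auto
    moreover have "d (g (s - y)) (g (s - y)) = 0" using gD(3)[of "s - y" "s - y"] xy v s by auto
    ultimately show "x = 0" using xy by auto
  qed (use ns u v su vs in auto)
  then have "d (g u) (g v) = 0" using u v s by (simp add: gD(2))
  then show False using gD(3)[of u v] u v su vs s by auto
qed

text \<open>Both \<open>f\<close> and a geodesic \<open>h\<close> from \<open>f 0\<close> to
  \<open>p\<close> are parametrised by the distance from the same point, so they meet only at equal
  parameters. After their last common point they form a fork, so \<open>f\<close> enters the piece
  at \<open>p\<close>. In particular nearest points in a piece are unique.\<close>

lemma geodesic_to_piece_passes_nearest:
  assumes k: "k \<in> K" and f: "geodesic_path M d 0 l f" and l: "f l \<in> P k" and p: "nearest d (P k) (f 0) p"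
  shows "d (f 0) p \<le> l" "f (d (f 0) p) = p"
proof -
  note fD = geodesic_pathD[OF f]
  define x where "x = f 0"
  have xM: "x \<in> M" using fD(1,2) by (simp add: x_def)
  have pP: "p \<in> P k" and pmin: "\<And>a. a \<in> P k \<Longrightarrow> d x p \<le> d x a"
    using p by (auto simp: nearest_def x_def)
  have pM: "p \<in> M" using pP piece_subset[OF k] by blast
  have "d x (f l) = l" using fD(3)[of 0 l] fD(1) by (simp add: x_def)
  then show "d (f 0) p \<le> l" using pmin[OF l] by (simp add: x_def)
  show "f (d (f 0) p) = p"
  proof (cases "x \<in> P k")
    case True
    then have "d x p \<le> 0" using pmin[OF True] xM by simp
    then have "x = p" using xM pM by (metis antisym nonneg zero)
    then show ?thesis using xM unfolding x_def by simp
  next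
    case False
    obtain e where e: "e \<in> {0..l}" "f e \<in> P k" "\<And>t. 0 \<le> t \<Longrightarrow> t < e \<Longrightarrow> f t \<notin> P k"
      using geodesic_path_first_hit[OF f piece_closedin[OF k], of l] l fD(1) by auto
    obtain h m where h: "geodesic_path M d 0 m h" "h 0 = x" "h m = p"
      using geodesic_set_path[OF geodesic_set xM pM] .
    note hD = geodesic_pathD[OF h(1)]
    have m: "m = d x p" using hD(3)[of 0 m] hD(1) h by simp
    have hbefore: "h s \<notin> P k" if "0 \<le> s" "s < m" for s
    proof
      assume "h s \<in> P k"
      then have "d x p \<le> d x (h s)" using pmin by blast
      moreover have "d x (h s) = s" using hD(3)[of 0 s] that h by simp
      ultimately show False using that m by simp
    qed
    have param: "s = t" if "f s = h t" "s \<in> {0..l}" "t \<in> {0..m}" for s t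
    proof -
      have "d x (f s) = s" using fD(3)[of 0 s] that by (simp add: x_def)
      moreover have "d x (h t) = t" using hD(3)[of 0 t] that h by simp
      ultimately show ?thesis using that by simp
    qed
    have fe: "geodesic_path M d 0 e f" using e by (auto intro: geodesic_path_subinterval[OF f])
    obtain w where w: "w \<in> {0..e}" "f w \<in> h ` {0..m}" "\<And>t. w < t \<Longrightarrow> t \<le> e \<Longrightarrow> f t \<notin> h ` {0..m}"
    proof -
      have "f 0 \<in> h ` {0..m}" using h hD(1) by (auto simp: x_def intro!: image_eqI[of _ _ 0])
      then show ?thesis
        using geodesic_path_last_hit[OF fe geodesic_path_closedin[OF h(1)], of 0] e that by auto
    qed
    obtain t where t: "t \<in> {0..m}" "f w = h t" using w by blast
    have "w = t" using param[of w t] t w e by auto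
    have "f e = p"
    proof (cases "f w \<in> P k")
      case True
      then have "w = e" using e(3)[of w] w by force
      moreover have "w = m" using hbefore[of w] True t \<open>w = t\<close> by force
      ultimately show ?thesis using t h \<open>w = t\<close> by simp
    next
      case False
      have "f (w + (e - w)) = h (w + (m - w))"
      proof (rule fork_endpoints_eq[OF k, where g = "\<lambda>s. f (w + s)" and h = "\<lambda>s. h (w + s)"])
        show "geodesic_path M d 0 (e - w) (\<lambda>s. f (w + s))"
          using w e by (intro geodesic_pathI) (auto simp: fD)
        show "geodesic_path M d 0 (m - w) (\<lambda>s. h (w + s))"
          using w t \<open>w = t\<close> by (intro geodesic_pathI) (auto simp: hD)
        show "f (w + 0) = h (w + 0)" using t \<open>w = t\<close> by simp
        fix s u assume su: "s \<in> {0..e - w}" "u \<in> {0..m - w}" "f (w + s) = h (w + u)"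
        then have "f (w + s) \<in> h ` {0..m}" using w by auto
        then show "s = 0" using w(3)[of "w + s"] su by (cases "s = 0") auto
      qed (use False w e h t \<open>w = t\<close> hbefore in \<open>auto simp: pP\<close>)
      then show ?thesis using h by simp
    qed
    moreover have "d x (f e) = e" using fD(3)[of 0 e] e by (simp add: x_def)
    ultimately show ?thesis by (metis x_def)
  qed
qed

text \<open>The visit splits \<open>f\<close> into two geodesics that end in the piece, the second
  one read backwards from \<open>f l\<close>.\<close>

lemma geodesic_hits_piece_gates:
  assumes k: "k \<in> K" and f: "geodesic_path M d 0 l f" and s: "s \<in> {0..l}" "f s \<in> P k"
    and p: "nearest d (P k) (f 0) p" and q: "nearest d (P k) (f l) q"
  shows "f (d (f 0) p) = p \<and> f (l - d (f l) q) = q \<and> d (f 0) p \<le> l - d (f l) q"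
proof -
  note fD = geodesic_pathD[OF f]
  have f1: "geodesic_path M d 0 s f" using s by (auto intro: geodesic_path_subinterval[OF f])
  have f2: "geodesic_path M d 0 (l - s) (\<lambda>t. f (l - t))"
    using s by (intro geodesic_pathI) (auto simp: fD)
  note 1 = geodesic_to_piece_passes_nearest[OF k f1 s(2) p]
  have "nearest d (P k) (f (l - 0)) q" using q by simp
  note 2 = geodesic_to_piece_passes_nearest[OF k f2 _ this]
  show ?thesis using 1 2(1,2) s by simp
qed

text \<open>If the geodesic misses the piece, then \<open>f 0\<close>, \<open>p\<close>, \<open>q\<close>, \<open>f l\<close> span a quadrilateral; the sides
  at \<open>q\<close> form a geodesic, so a tripod with apex \<open>p\<close> puts \<open>p\<close> and \<open>q\<close> in one more piece.\<close>

lemma geodesic_passes_gates: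
  assumes k: "k \<in> K" and f: "geodesic_path M d 0 l f"
    and p: "nearest d (P k) (f 0) p" and q: "nearest d (P k) (f l) q" and pq: "p \<noteq> q"
  shows "f (d (f 0) p) = p \<and> f (l - d (f l) q) = q \<and> d (f 0) p \<le> l - d (f l) q"
proof -
  note fD = geodesic_pathD[OF f]
  define x y where "x = f 0" and "y = f l"
  have xM: "x \<in> M" and yM: "y \<in> M" using fD(1,2) by (auto simp: x_def y_def)
  have pP: "p \<in> P k" and qP: "q \<in> P k" using p q by (auto simp: nearest_def)
  have pM: "p \<in> M" using pP piece_subset[OF k] by auto
  have "\<exists>s\<in>{0..l}. f s \<in> P k"
  proof (rule ccontr)
    assume none: "\<not> (\<exists>s\<in>{0..l}. f s \<in> P k)"
    obtain g a where g: "geodesic_path M d 0 a g" "g 0 = p" "g a = x"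
      using geodesic_set_path[OF geodesic_set pM xM] .
    obtain h b where h: "geodesic_path M d 0 b h" "h 0 = p" "h b = y"
      using geodesic_set_path[OF geodesic_set pM yM] .
    note gD = geodesic_pathD[OF g(1)] and hD = geodesic_pathD[OF h(1)]
    have a: "a = d x p" using gD(3)[of 0 a] gD(1) g commute by simp
    have gP: "s = 0" if "s \<in> {0..a}" "g s \<in> P k" for s
    proof -
      have "d x p \<le> d x (g s)" using p that by (auto simp: nearest_def x_def)
      also have "\<dots> = a - s" using gD(3)[of a s] that g by simp
      finally show ?thesis using a that by simp
    qed
    have h': "geodesic_path M d 0 b (\<lambda>t. h (b - t))"
      using hD(1) by (intro geodesic_pathI) (auto simp: hD)
    have nq: "nearest d (P k) (h (b - 0)) q" using q h by (simp add: y_def)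
    \<comment> \<open>Read from \<open>y\<close>, the geodesic \<open>h\<close> ends in the piece,
      namely at \<open>p\<close>, so it passes through the gate \<open>q\<close> of
      \<open>y\<close>. Below, \<open>c\<close> is the time of \<open>q\<close> counted from
      \<open>p\<close>.\<close>
    have hq: "d y q \<le> b" "h (b - d y q) = q"
      using geodesic_to_piece_passes_nearest[OF k h' _ nq] h pP by auto
    define c where "c = b - d y q"
    have c0: "0 \<le> c" "h c = q" using hq by (auto simp: c_def)
    have hin: "h t \<in> P k" if "t \<in> {0..c}" for t
    proof -
      have "c \<le> b" by (simp add: c_def)
      then have "geodesic_path M d 0 c h" by (rule geodesic_path_subinterval[OF h(1) order_refl c0(1)])
      then show ?thesis using geodesic_in_piece[OF k, of 0 c h t] h(2) c0(2) pP qP that by auto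
    qed
    have disj: "s = 0" if "s \<in> {0..a}" "t \<in> {0..b}" "g s = h t" for s t
    proof (cases "t \<le> c")
      case True
      then show ?thesis using hin[of t] gP[of s] that by auto
    next
      case False
      \<comment> \<open>A common point off the piece would have both gates \<open>p\<close> and \<open>q\<close>.\<close>
      have np: "nearest d (P k) (g s) p"
        unfolding nearest_def
      proof (intro conjI ballI pP)
        fix z assume z: "z \<in> P k"
        have zM: "z \<in> M" using z piece_subset[OF k] by blast
        have gs: "g s \<in> M" using gD(2)[of s] that(1) by simp
        have "d x p \<le> d x z" using p z by (auto simp: nearest_def x_def)
        also have "\<dots> \<le> d x (g s) + d (g s) z" using triangle[OF xM gs zM] .
        also have "d x (g s) = a - s" using gD(3)[of a s] that g by simp
        finally have "s \<le> d (g s) z" using a by simp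
        moreover have "d (g s) p = s" using gD(3)[of s 0] that g by simp
        ultimately show "d (g s) p \<le> d (g s) z" by simp
      qed
      have h2: "geodesic_path M d 0 (t - c) (\<lambda>r. h (t - r))"
        using False that c0 by (intro geodesic_pathI) (auto simp: hD)
      have n2: "nearest d (P k) (h (t - 0)) p" using np that by simp
      have end2: "h (t - (t - c)) \<in> P k" using c0 qP by simp
      have r: "d (h t) p \<le> t - c" "h (t - d (h t) p) = p"
        using geodesic_to_piece_passes_nearest[OF k h2 end2 n2] by simp_all
      have "d (h t) p = t" using hD(3)[of t 0] that h by simp
      then have "c = 0" using r c0 by simp
      then show ?thesis using c0 h pq by simp
    qed
    have apex: "g 0 \<notin> f ` {0..l}" using none g pP by auto
    obtain i \<sigma> \<tau> where *: "i \<in> K" "\<sigma> \<in> {0<..a}" "\<tau> \<in> {0<..b}" "g ` {0..\<sigma>} \<subseteq> P i" "h ` {0..\<tau>} \<subseteq> P i"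
      "g \<sigma> \<in> f ` {0..l}" "h \<tau> \<in> f ` {0..l}"
      using tripod_in_piece[OF g(1) h(1) _ _ f _ _ apex] disj g h x_def y_def by metis
    \<comment> \<open>\<open>h\<close> stays in \<open>P k\<close> until time \<open>c\<close>, but
      \<open>h \<tau>\<close> lies on \<open>f\<close> and so outside. The piece of the tripod
      therefore contains \<open>p\<close> and \<open>q\<close> and would have to be
      \<open>P k\<close>, although it contains \<open>g \<sigma>\<close>.\<close>
    have "g \<sigma> \<notin> P k" "h \<tau> \<notin> P k" using none *(6,7) by auto
    then have "\<tau> > c" using *(3) hin[of \<tau>] by (cases "\<tau> > c") auto
    then have "h c \<in> P i" "g 0 \<in> P i" "g \<sigma> \<in> P i" using *(2,4,5) c0 by auto
    then have "i = k" using piece_eqI[OF *(1) k] pP qP pq c0(2) g(2) by metis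
    then show False using \<open>g \<sigma> \<in> P i\<close> \<open>g \<sigma> \<notin> P k\<close> by simp
  qed
  then show ?thesis using geodesic_hits_piece_gates[OF k f _ _ p q] by blast
qed

end


section \<open>Asymptotic cones\<close>

text \<open>Zorn's lemma for proper filters finer than \<open>sequentially\<close>. The order
  \<open>le\<close> is reversed, so the upper bound of a chain is its infimum, which is proper
  because of the chain property.\<close>

lemma nonprincipal_ultrafilter_exists: "\<exists>\<omega>. nonprincipal_ultrafilter \<omega>"
proof -
  define A where "A = {F :: nat filter. F \<noteq> bot \<and> F \<le> sequentially}"
  define le where "le F G \<longleftrightarrow> G \<le> F" for F G :: "nat filter"
  have "\<exists>\<omega>\<in>A. \<forall>F\<in>A. le \<omega> F \<longrightarrow> F = \<omega>"
  proof (rule predicate_Zorn)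
    show "partial_order_on A (relation_of le A)"
      by (rule partial_order_on_relation_ofI) (auto simp: le_def)
    fix C assume C: "C \<in> Chains (relation_of le A)"
    then have CA: "C \<subseteq> A" and chain: "\<And>F G. F \<in> C \<Longrightarrow> G \<in> C \<Longrightarrow> F \<le> G \<or> G \<le> F"
      by (auto simp: Chains_def relation_of_def le_def)
    show "\<exists>u\<in>A. \<forall>F\<in>C. le F u"
    proof (cases "C = {}")
      case True
      then show ?thesis by (auto simp: A_def intro!: exI[of _ sequentially])
    next
      case False
      have "eventually P (Inf C) \<longleftrightarrow> (\<exists>F\<in>C. eventually P F)" for P
        using chain by (intro eventually_Inf_base[OF False]) (metis inf.absorb1 inf.absorb2 order_refl)
      then have "Inf C \<noteq> bot"
        using CA by (auto simp: A_def trivial_limit_def)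
      moreover have "Inf C \<le> sequentially"
        using False CA by (auto simp: A_def intro: Inf_lower2)
      ultimately show ?thesis
        by (auto simp: A_def le_def intro!: bexI[of _ "Inf C"] Inf_lower)
    qed
  qed
  then obtain \<omega> where \<omega>: "\<omega> \<noteq> bot" "\<omega> \<le> sequentially"
    and max: "\<And>F. F \<noteq> bot \<Longrightarrow> F \<le> \<omega> \<Longrightarrow> F = \<omega>"
    unfolding A_def le_def by (metis (mono_tags, lifting) mem_Collect_eq order_trans)
  have "eventually P \<omega> \<or> eventually (\<lambda>n. \<not> P n) \<omega>" for P
  proof (cases "eventually P \<omega>")
    case False
    \<comment> \<open>Adding the complement of \<open>P\<close> keeps the filter proper, so by
      maximality it belonged to the filter already.\<close>
    then have "inf \<omega> (principal {n. \<not> P n}) \<noteq> bot"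
      by (simp add: eventually_False[symmetric] eventually_inf_principal)
    then have "inf \<omega> (principal {n. \<not> P n}) = \<omega>" by (rule max) simp
    then have "eventually (\<lambda>n. n \<in> {n. \<not> P n}) \<omega>"
      by (metis inf.cobounded2 le_principal)
    then show ?thesis by simp
  qed simp
  moreover have "eventually (\<lambda>n. n \<noteq> m) \<omega>" for m
    using \<omega>(2) by (rule filter_leD) (use eventually_gt_at_top[of m] in \<open>auto elim: eventually_mono\<close>)
  ultimately show ?thesis using \<omega>(1) unfolding nonprincipal_ultrafilter_def by blast
qed

context
  fixes \<omega> assumes ultra: "nonprincipal_ultrafilter \<omega>"
begin

lemma ultrafilter_neq_bot: "\<omega> \<noteq> bot"
  and ultrafilter_cases: "eventually P \<omega> \<or> eventually (\<lambda>n. \<not> P n) \<omega>"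
  using ultra by (auto simp: nonprincipal_ultrafilter_def)

lemma ultrafilter_le_sequentially: "\<omega> \<le> sequentially"
proof (rule filter_leI)
  fix P :: "nat \<Rightarrow> bool" assume "eventually P sequentially"
  then obtain N where N: "\<And>n. n \<ge> N \<Longrightarrow> P n" by (auto simp: eventually_sequentially)
  have "eventually (\<lambda>n. \<forall>m\<in>{..<N}. n \<noteq> m) \<omega>"
    using ultra by (intro eventually_ball_finite) (auto simp: nonprincipal_ultrafilter_def)
  then show "eventually P \<omega>" by (rule eventually_mono) (use N in \<open>force simp: not_less[symmetric]\<close>)
qed

lemma ultrafilter_filterlim_at_top:
  assumes "\<And>n. real n \<le> r n"
  shows "filterlim r at_top \<omega>"
proof (rule filterlim_mono[OF _ order_refl ultrafilter_le_sequentially])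
  show "filterlim r at_top sequentially"
    by (rule filterlim_at_top_mono[OF filterlim_real_sequentially]) (simp add: assms)
qed

text \<open>Compactness gives the image filter a cluster point, and for an ultrafilter a cluster
  point is a limit.\<close>

lemma ultrafilter_bounded_tendsto:
  fixes f :: "nat \<Rightarrow> real"
  assumes "eventually (\<lambda>n. \<bar>f n\<bar> \<le> B) \<omega>"
  obtains l where "(f \<longlongrightarrow> l) \<omega>"
proof -
  have "filtermap f \<omega> \<noteq> bot" using ultrafilter_neq_bot by (simp add: filtermap_bot_iff)
  moreover have "eventually (\<lambda>x. x \<in> {-B..B}) (filtermap f \<omega>)"
    using assms by (auto simp: eventually_filtermap abs_le_iff elim!: eventually_mono)
  ultimately obtain l where l: "inf (nhds l) (filtermap f \<omega>) \<noteq> bot"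
    using compact_Icc[of "-B" B] unfolding compact_filter by blast
  have "(f \<longlongrightarrow> l) \<omega>"
  proof (rule topological_tendstoI, rule ccontr)
    fix S assume S: "open S" "l \<in> S" "\<not> eventually (\<lambda>n. f n \<in> S) \<omega>"
    then have "eventually (\<lambda>n. f n \<notin> S) \<omega>" using ultrafilter_cases by blast
    then have "eventually (\<lambda>x. x \<notin> S) (filtermap f \<omega>)" by (simp add: eventually_filtermap)
    moreover have "eventually (\<lambda>x. x \<in> S) (nhds l)" using S by (simp add: eventually_nhds_in_open)
    ultimately have "eventually (\<lambda>x. False) (inf (nhds l) (filtermap f \<omega>))"
      unfolding eventually_inf by blast
    then show False using l by (simp add: trivial_limit_def)
  qed
  then show ?thesis using that by blast
qed

end

text \<open>Integer times suffice: steps of length one become negligible in a cone, so the interiors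
  of edges never have to be parametrised.\<close>

definition discrete_geodesic :: "'b set \<Rightarrow> ('b \<Rightarrow> 'b \<Rightarrow> real) \<Rightarrow> (nat \<Rightarrow> 'b) \<Rightarrow> nat \<Rightarrow> bool" where
  "discrete_geodesic M d g a \<longleftrightarrow>
     (\<forall>i\<le>a. g i \<in> M) \<and> (\<forall>i\<le>a. \<forall>j\<le>a. d (g i) (g j) = \<bar>real i - real j\<bar>)"

section \<open>Cones of relatively hyperbolic spaces\<close>

locale rel_hyp_space =
  fixes M :: "'b set" and d :: "'b \<Rightarrow> 'b \<Rightarrow> real" and \<P> :: "'b set set"
  assumes rel_hyp: "relatively_hyperbolic_space M d \<P>"
begin

sublocale Metric_space M d
  using rel_hyp by (simp add: relatively_hyperbolic_space_def geodesic_metric_space_def)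

lemma peripheral_subset: "A \<in> \<P> \<Longrightarrow> A \<subseteq> M"
  using rel_hyp by (simp add: relatively_hyperbolic_space_def)

end

text \<open>The base points \<open>e\<close> may move with \<open>n\<close>, as is needed to rescale
  counterexamples that occur at different places.\<close>

locale cone = rel_hyp_space M d \<P> for M :: "'b set" and d \<P> +
  fixes \<omega> :: "nat filter" and e :: "nat \<Rightarrow> 'b" and r :: "nat \<Rightarrow> real"
  assumes ultra: "nonprincipal_ultrafilter \<omega>" and base: "\<And>n. e n \<in> M"
    and scale: "filterlim r at_top \<omega>"
begin

abbreviation "seqs \<equiv> cone_seqs \<omega> M d e r"
abbreviation "cls \<equiv> cone_class \<omega> M d e r"
abbreviation "C \<equiv> asymptotic_cone \<omega> M d e r"
abbreviation "dC \<equiv> cone_dist \<omega> M d e r"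
abbreviation "piece_classes \<equiv> {\<alpha> \<in> seq_classes \<omega> \<P>. ultralimit \<omega> M d e r \<alpha> \<noteq> {}}"
abbreviation "ulim A \<equiv> ultralimit \<omega> M d e r (seq_class \<omega> \<P> A)"

sublocale T: tree_graded_space C dC piece_classes "ultralimit \<omega> M d e r"
  using rel_hyp ultra base scale
  by unfold_locales (auto simp: relatively_hyperbolic_space_def)

lemma neq_bot: "\<omega> \<noteq> bot"
  using ultra by (rule ultrafilter_neq_bot)

lemma scale_pos: "eventually (\<lambda>n. r n > 0) \<omega>"
  using scale by (simp add: filterlim_at_top_dense)

lemma const_over_scale: "((\<lambda>n. c / r n) \<longlongrightarrow> 0) \<omega>"
  by (intro tendsto_divide_0[OF tendsto_const] filterlim_at_top_imp_at_infinity[OF scale])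

lemma seqsD: "x \<in> seqs \<Longrightarrow> x n \<in> M"
  by (simp add: cone_seqs_def)

lemma seqsI:
  assumes "\<And>n. x n \<in> M" "y \<in> seqs" "eventually (\<lambda>n. d (x n) (y n) \<le> c * r n) \<omega>"
  shows "x \<in> seqs"
proof -
  obtain B where B: "eventually (\<lambda>n. d (y n) (e n) / r n \<le> B) \<omega>" using assms(2) by (auto simp: cone_seqs_def)
  have "eventually (\<lambda>n. d (x n) (e n) / r n \<le> c + B) \<omega>"
    using B assms(3) scale_pos
  proof eventually_elim
    case (elim n)
    have "d (x n) (e n) \<le> d (x n) (y n) + d (y n) (e n)"
      using assms(1) seqsD[OF assms(2)] base by (intro triangle)
    also have "\<dots> \<le> c * r n + B * r n" using elim by (simp add: divide_simps)
    finally show ?case using elim by (simp add: field_simps)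
  qed
  then show ?thesis using assms(1) by (auto simp: cone_seqs_def)
qed

lemma base_seqs: "e \<in> seqs"
  using base by (auto simp: cone_seqs_def intro!: exI[of _ 0])

lemma cls_in_cone: "x \<in> seqs \<Longrightarrow> cls x \<in> C"
  by (simp add: asymptotic_cone_def)

lemma cls_self: "x \<in> seqs \<Longrightarrow> x \<in> cls x"
  using seqsD by (auto simp: cone_class_def)

text \<open>Resolves the \<open>THE\<close> in \<open>cone_dist\<close>: the ratios are bounded, so
  they converge along the ultrafilter, and by the quadrilateral inequality all representatives of
  the two classes have the same limit.\<close>

lemma dist_tendsto:
  assumes x: "x \<in> seqs" and y: "y \<in> seqs"
  shows "((\<lambda>n. d (x n) (y n) / r n) \<longlongrightarrow> dC (cls x) (cls y)) \<omega>"
proof -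
  obtain B1 where B1: "eventually (\<lambda>n. d (x n) (e n) / r n \<le> B1) \<omega>" using x by (auto simp: cone_seqs_def)
  obtain B2 where B2: "eventually (\<lambda>n. d (y n) (e n) / r n \<le> B2) \<omega>" using y by (auto simp: cone_seqs_def)
  have bound: "eventually (\<lambda>n. \<bar>d (x n) (y n) / r n\<bar> \<le> B1 + B2) \<omega>"
    using B1 B2 scale_pos
  proof eventually_elim
    case (elim n)
    have "d (x n) (y n) \<le> d (x n) (e n) + d (y n) (e n)"
      using seqsD[OF x] seqsD[OF y] base by (intro triangle')
    then have "d (x n) (y n) / r n \<le> d (x n) (e n) / r n + d (y n) (e n) / r n"
      using elim by (simp add: add_divide_distrib[symmetric] divide_right_mono)
    then show ?case using elim by simp
  qed
  obtain l where l: "((\<lambda>n. d (x n) (y n) / r n) \<longlongrightarrow> l) \<omega>"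
    by (rule ultrafilter_bounded_tendsto[OF ultra bound])
  have all: "((\<lambda>n. d (x' n) (y' n) / r n) \<longlongrightarrow> l) \<omega>" if x': "x' \<in> cls x" and y': "y' \<in> cls y" for x' y'
  proof -
    have s: "x' \<in> seqs" "y' \<in> seqs" using x' y' by (auto simp: cone_class_def)
    have lim0: "((\<lambda>n. d (x n) (x' n) / r n + d (y n) (y' n) / r n) \<longlongrightarrow> 0) \<omega>"
      using x' y' by (auto simp: cone_class_def intro: tendsto_add_zero)
    have "\<forall>\<^sub>F n in \<omega>. norm (d (x n) (y n) / r n - d (x' n) (y' n) / r n)
        \<le> d (x n) (x' n) / r n + d (y n) (y' n) / r n"
      using scale_pos
    proof eventually_elim
      case (elim n)
      note m = seqsD[OF x, of n] seqsD[OF y, of n] seqsD[OF s(1), of n] seqsD[OF s(2), of n]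
      have "\<bar>d (x n) (y n) - d (x' n) (y' n)\<bar> \<le> d (x n) (x' n) + d (y n) (y' n)"
        using triangle[of "x n" "x' n" "y n"] triangle[of "x' n" "y' n" "y n"]
          triangle[of "x' n" "x n" "y' n"] triangle[of "x n" "y n" "y' n"] m
        by (simp add: commute)
      then have "\<bar>d (x n) (y n) - d (x' n) (y' n)\<bar> / r n \<le> (d (x n) (x' n) + d (y n) (y' n)) / r n"
        using elim by (simp add: divide_right_mono)
      then show ?case using elim by (simp add: diff_divide_distrib[symmetric] add_divide_distrib)
    qed
    then have "((\<lambda>n. d (x n) (y n) / r n - d (x' n) (y' n) / r n) \<longlongrightarrow> 0) \<omega>"
      by (rule Lim_null_comparison[OF _ lim0])
    from tendsto_diff[OF l this] show ?thesis by simp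
  qed
  have "(THE l. \<forall>x'\<in>cls x. \<forall>y'\<in>cls y. ((\<lambda>n. d (x' n) (y' n) / r n) \<longlongrightarrow> l) \<omega>) = l"
  proof (rule the_equality)
    fix l' assume "\<forall>x'\<in>cls x. \<forall>y'\<in>cls y. ((\<lambda>n. d (x' n) (y' n) / r n) \<longlongrightarrow> l') \<omega>"
    then have "((\<lambda>n. d (x n) (y n) / r n) \<longlongrightarrow> l') \<omega>" using cls_self x y by blast
    then show "l' = l" using tendsto_unique[OF neq_bot _ l] by blast
  qed (use all in blast)
  then have "dC (cls x) (cls y) = l" using cls_in_cone x y by (simp add: cone_dist_def)
  then show ?thesis using l by simp
qed

lemma dist_le:
  assumes "x \<in> seqs" "y \<in> seqs" "eventually (\<lambda>n. d (x n) (y n) \<le> f n) \<omega>" "((\<lambda>n. f n / r n) \<longlongrightarrow> c) \<omega>"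
  shows "dC (cls x) (cls y) \<le> c"
proof (rule tendsto_le[OF neq_bot assms(4) dist_tendsto[OF assms(1,2)]])
  show "\<forall>\<^sub>F n in \<omega>. d (x n) (y n) / r n \<le> f n / r n"
    using assms(3) scale_pos by eventually_elim (simp add: divide_right_mono)
qed

lemma dist_ge:
  assumes "x \<in> seqs" "y \<in> seqs" "eventually (\<lambda>n. f n \<le> d (x n) (y n)) \<omega>" "((\<lambda>n. f n / r n) \<longlongrightarrow> c) \<omega>"
  shows "c \<le> dC (cls x) (cls y)"
proof (rule tendsto_le[OF neq_bot dist_tendsto[OF assms(1,2)] assms(4)])
  show "\<forall>\<^sub>F n in \<omega>. f n / r n \<le> d (x n) (y n) / r n"
    using assms(3) scale_pos by eventually_elim (simp add: divide_right_mono)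
qed

lemma dist_eq:
  assumes "x \<in> seqs" "y \<in> seqs" "eventually (\<lambda>n. d (x n) (y n) = f n) \<omega>" "((\<lambda>n. f n / r n) \<longlongrightarrow> c) \<omega>"
  shows "dC (cls x) (cls y) = c"
proof (rule antisym)
  show "dC (cls x) (cls y) \<le> c"
    using assms(3) by (intro dist_le[OF assms(1,2) _ assms(4)]) (auto elim: eventually_mono)
  show "c \<le> dC (cls x) (cls y)"
    using assms(3) by (intro dist_ge[OF assms(1,2) _ assms(4)]) (auto elim: eventually_mono)
qed

lemma cls_eqI:
  assumes "x \<in> seqs" "y \<in> seqs" "eventually (\<lambda>n. d (x n) (y n) \<le> f n) \<omega>" "((\<lambda>n. f n / r n) \<longlongrightarrow> 0) \<omega>"
  shows "cls x = cls y"
proof -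
  have "dC (cls x) (cls y) = 0" using dist_le[OF assms] T.nonneg by (rule antisym)
  then show ?thesis using cls_in_cone assms(1,2) by simp
qed

lemma cls_eq_tendsto:
  assumes "x \<in> seqs" "y \<in> seqs" "cls x = cls y"
  shows "((\<lambda>n. d (x n) (y n) / r n) \<longlongrightarrow> 0) \<omega>"
  using dist_tendsto[OF assms(1,2)] assms cls_in_cone[OF assms(2)] by simp

text \<open>Members of the class of \<open>A\<close> agree with \<open>A\<close> almost surely, so
  membership may be tested on \<open>A\<close> itself.\<close>

lemma ulim_iff:
  assumes A: "\<And>n. A n \<in> \<P>"
  shows "\<xi> \<in> ulim A \<longleftrightarrow> (\<exists>x\<in>seqs. \<xi> = cls x \<and> eventually (\<lambda>n. x n \<in> A n) \<omega>)"
proof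
  assume "\<xi> \<in> ulim A"
  then obtain x A' where x: "x \<in> seqs" "\<xi> = cls x" "eventually (\<lambda>n. x n \<in> A' n) \<omega>" "eventually (\<lambda>n. A' n = A n) \<omega>"
    by (auto simp: ultralimit_def seq_class_def)
  have "eventually (\<lambda>n. x n \<in> A n) \<omega>" using x(3,4) by eventually_elim simp
  then show "\<exists>x\<in>seqs. \<xi> = cls x \<and> eventually (\<lambda>n. x n \<in> A n) \<omega>" using x by blast
next
  assume "\<exists>x\<in>seqs. \<xi> = cls x \<and> eventually (\<lambda>n. x n \<in> A n) \<omega>"
  then obtain x where "x \<in> seqs" "\<xi> = cls x" "eventually (\<lambda>n. x n \<in> A n) \<omega>" by blast
  moreover have "A \<in> seq_class \<omega> \<P> A" using A by (simp add: seq_class_def)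
  ultimately show "\<xi> \<in> ulim A" unfolding ultralimit_def by blast
qed

lemma cls_in_ulim:
  "\<lbrakk>\<And>n. A n \<in> \<P>; x \<in> seqs; eventually (\<lambda>n. x n \<in> A n) \<omega>\<rbrakk> \<Longrightarrow> cls x \<in> ulim A"
  using ulim_iff by blast

lemma piece_class:
  "\<lbrakk>\<And>n. A n \<in> \<P>; \<xi> \<in> ulim A\<rbrakk> \<Longrightarrow> seq_class \<omega> \<P> A \<in> piece_classes"
  by (auto simp: seq_classes_def)

lemma piece_class_repr:
  assumes "\<alpha> \<in> piece_classes"
  obtains A where "\<And>n. A n \<in> \<P>" "\<alpha> = seq_class \<omega> \<P> A"
  using assms by (auto simp: seq_classes_def)

lemma seq_class_eqD:
  assumes "seq_class \<omega> \<P> A = seq_class \<omega> \<P> B" "\<And>n. A n \<in> \<P>"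
  shows "eventually (\<lambda>n. A n = B n) \<omega>"
proof -
  have "A \<in> seq_class \<omega> \<P> A" using assms(2) by (simp add: seq_class_def)
  then have "A \<in> seq_class \<omega> \<P> B" using assms(1) by simp
  then show ?thesis by (simp add: seq_class_def)
qed

lemma nearest_cls:
  assumes A: "\<And>n. A n \<in> \<P>" and x: "x \<in> seqs" and p: "p \<in> seqs"
    and near: "eventually (\<lambda>n. nearest d (A n) (x n) (p n)) \<omega>"
  shows "nearest dC (ulim A) (cls x) (cls p)"
  unfolding nearest_def
proof (intro conjI ballI)
  show "cls p \<in> ulim A"
    using near by (intro cls_in_ulim[OF A p]) (auto simp: nearest_def elim: eventually_mono)
  fix \<eta> assume "\<eta> \<in> ulim A"
  then obtain y where y: "y \<in> seqs" "\<eta> = cls y" "eventually (\<lambda>n. y n \<in> A n) \<omega>"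
    unfolding ulim_iff[OF A] by blast
  have "eventually (\<lambda>n. d (x n) (p n) \<le> d (x n) (y n)) \<omega>"
    using near y(3) by eventually_elim (auto simp: nearest_def)
  then show "dC (cls x) (cls p) \<le> dC (cls x) \<eta>"
    using dist_le[OF x p _ dist_tendsto[OF x y(1)]] y(2) by simp
qed

section \<open>Limits of discrete geodesics\<close>

lemma path_point_seqs:
  assumes g: "\<And>n. discrete_geodesic M d (g n) (a n)" and g0: "(\<lambda>n. g n 0) \<in> seqs"
    and i: "\<And>n. i n \<le> a n" and s: "((\<lambda>n. real (i n) / r n) \<longlongrightarrow> s) \<omega>"
  shows "(\<lambda>n. g n (i n)) \<in> seqs"
proof (rule seqsI[OF _ g0])
  show "g n (i n) \<in> M" for n using g i by (auto simp: discrete_geodesic_def)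
  have "eventually (\<lambda>n. real (i n) / r n < s + 1) \<omega>" using order_tendstoD(2)[OF s, of "s + 1"] by simp
  then show "eventually (\<lambda>n. d (g n (i n)) (g n 0) \<le> (s + 1) * r n) \<omega>"
    using scale_pos
  proof eventually_elim
    case (elim n)
    have "d (g n (i n)) (g n 0) = real (i n)" using g[of n] i[of n] by (auto simp: discrete_geodesic_def)
    then show ?case using elim by (simp add: divide_simps)
  qed
qed

lemma path_point_dist:
  assumes g: "\<And>n. discrete_geodesic M d (g n) (a n)" and g0: "(\<lambda>n. g n 0) \<in> seqs"
    and i: "\<And>n. i n \<le> a n" "((\<lambda>n. real (i n) / r n) \<longlongrightarrow> s) \<omega>"
    and j: "\<And>n. j n \<le> a n" "((\<lambda>n. real (j n) / r n) \<longlongrightarrow> t) \<omega>"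
  shows "dC (cls (\<lambda>n. g n (i n))) (cls (\<lambda>n. g n (j n))) = \<bar>s - t\<bar>"
proof (rule dist_eq[OF path_point_seqs[OF g g0 i] path_point_seqs[OF g g0 j]])
  show "eventually (\<lambda>n. d (g n (i n)) (g n (j n)) = \<bar>real (i n) - real (j n)\<bar>) \<omega>"
    using g i(1) j(1) by (intro always_eventually) (auto simp: discrete_geodesic_def)
  have "((\<lambda>n. \<bar>real (i n) / r n - real (j n) / r n\<bar>) \<longlongrightarrow> \<bar>s - t\<bar>) \<omega>"
    by (intro tendsto_intros i j)
  then show "((\<lambda>n. \<bar>real (i n) - real (j n)\<bar> / r n) \<longlongrightarrow> \<bar>s - t\<bar>) \<omega>"
  proof (rule Lim_transform_eventually)
    show "\<forall>\<^sub>F n in \<omega>. \<bar>real (i n) / r n - real (j n) / r n\<bar> = \<bar>real (i n) - real (j n)\<bar> / r n"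
      using scale_pos by eventually_elim (simp add: diff_divide_distrib[symmetric])
  qed
qed

text \<open>The truncation at \<open>a n\<close> makes every value a legal time of the path;
  \<open>long\<close> makes it harmless in the limit.\<close>

definition index :: "(nat \<Rightarrow> nat) \<Rightarrow> real \<Rightarrow> nat \<Rightarrow> nat" where
  "index a s n = min (nat \<lfloor>s * r n\<rfloor>) (a n)"

lemma index_le: "index a s n \<le> a n"
  by (simp add: index_def)

text \<open>Only times below \<open>l\<close> are tested, so rescaled lengths that converge to
  exactly \<open>l\<close> qualify, as do rescaled lengths that tend to infinity.\<close>

definition long :: "(nat \<Rightarrow> nat) \<Rightarrow> real \<Rightarrow> bool" where
  "long a l \<longleftrightarrow> (\<forall>s<l. eventually (\<lambda>n. s * r n \<le> a n) \<omega>)"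

lemma long_mono: "long a l \<Longrightarrow> l' \<le> l \<Longrightarrow> long a l'"
  by (auto simp: long_def)

lemma index_tendsto:
  assumes s: "0 \<le> s" "long a s"
  shows "((\<lambda>n. real (index a s n) / r n) \<longlongrightarrow> s) \<omega>"
proof (rule order_tendstoI)
  fix y assume y: "s < y"
  show "eventually (\<lambda>n. real (index a s n) / r n < y) \<omega>"
    using scale_pos
  proof eventually_elim
    case (elim n)
    have "real (nat \<lfloor>s * r n\<rfloor>) \<le> s * r n" using s elim by simp
    then have "real (index a s n) \<le> s * r n" by (simp add: index_def min_def)
    also have "\<dots> < y * r n" using y elim by simp
    finally show ?case using elim by (simp add: divide_simps)
  qed
next
  fix y assume y: "y < s"
  \<comment> \<open>\<open>long\<close> gives a non-strict bound; the intermediate \<open>z\<close>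
    turns it into the strict bound needed for \<open>y\<close>.\<close>
  define z where "z = (y + s) / 2"
  have "z < s" using y by (simp add: z_def)
  then have "eventually (\<lambda>n. z * r n \<le> a n) \<omega>" using s(2) by (simp add: long_def)
  moreover have "eventually (\<lambda>n. 1 / r n < s - y) \<omega>" using order_tendstoD(2)[OF const_over_scale, of "s - y" 1] y by simp
  ultimately show "eventually (\<lambda>n. y < real (index a s n) / r n) \<omega>"
    using scale_pos
  proof eventually_elim
    case (elim n)
    have "1 < s * r n - y * r n" using elim by (simp add: divide_simps left_diff_distrib)
    then have "y * r n < real (nat \<lfloor>s * r n\<rfloor>)" using s elim by linarith
    moreover have "y * r n < z * r n" by (rule mult_strict_right_mono) (use elim y z_def in auto)
    from this elim(1) have "y * r n < a n" by (rule less_le_trans)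
    ultimately have "y * r n < real (index a s n)" using elim by (auto simp: index_def min_def)
    then show ?case using elim by (simp add: divide_simps)
  qed
qed

definition limit_path :: "(nat \<Rightarrow> nat \<Rightarrow> 'b) \<Rightarrow> (nat \<Rightarrow> nat) \<Rightarrow> real \<Rightarrow> (nat \<Rightarrow> 'b) set" where
  "limit_path g a s = cls (\<lambda>n. g n (index a s n))"

text \<open>Frees later arguments from the rounding in \<open>index\<close>: any integer times with
  the right rescaled limit give the same point of the cone.\<close>

lemma limit_path_eq:
  assumes g: "\<And>n. discrete_geodesic M d (g n) (a n)" and g0: "(\<lambda>n. g n 0) \<in> seqs"
    and s: "0 \<le> s" "long a s" and i: "\<And>n. i n \<le> a n" "((\<lambda>n. real (i n) / r n) \<longlongrightarrow> s) \<omega>"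
  shows "limit_path g a s = cls (\<lambda>n. g n (i n))"
proof -
  note j = index_le index_tendsto[OF s]
  have "dC (limit_path g a s) (cls (\<lambda>n. g n (i n))) = 0"
    unfolding limit_path_def using path_point_dist[OF g g0 j i] by simp
  moreover have "limit_path g a s \<in> C" "cls (\<lambda>n. g n (i n)) \<in> C"
    unfolding limit_path_def using path_point_seqs[OF g g0 j] path_point_seqs[OF g g0 i] cls_in_cone by auto
  ultimately show ?thesis by simp
qed

lemma limit_path_geodesic:
  assumes g: "\<And>n. discrete_geodesic M d (g n) (a n)" and g0: "(\<lambda>n. g n 0) \<in> seqs"
    and l: "0 \<le> l" "long a l"
  shows "geodesic_path C dC 0 l (limit_path g a)"
proof (rule geodesic_pathI[OF l(1)])
  note idx = index_le index_tendsto[OF _ long_mono[OF l(2)]]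
  show "limit_path g a s \<in> C" if "0 \<le> s" "s \<le> l" for s
    unfolding limit_path_def using path_point_seqs[OF g g0 idx] that cls_in_cone by blast
  show "dC (limit_path g a s) (limit_path g a t) = \<bar>s - t\<bar>"
    if "0 \<le> s" "s \<le> l" "0 \<le> t" "t \<le> l" for s t
    unfolding limit_path_def using path_point_dist[OF g g0 idx idx] that by blast
qed

lemma limit_path_0: "limit_path g a 0 = cls (\<lambda>n. g n 0)"
  by (simp add: limit_path_def index_def)

end

section \<open>Bounded coarse intersections\<close>

context rel_hyp_space
begin

text \<open>With counterexamples rescaled by \<open>d (u n) (v n)\<close>, the constant
  \<open>R\<close> disappears and the limits of \<open>u\<close> and \<open>v\<close> are at
  distance 1 in both ultralimits. Two pieces sharing two points have the same index, so
  \<open>A n = A' n\<close> almost surely.\<close>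

lemma coarse_intersection_bounded:
  "\<exists>\<Delta>. \<forall>A\<in>\<P>. \<forall>A'\<in>\<P>. \<forall>u\<in>M. \<forall>v\<in>M. \<forall>a\<in>A. \<forall>b\<in>A. \<forall>a'\<in>A'. \<forall>b'\<in>A'.
     A \<noteq> A' \<and> d u a \<le> R \<and> d v b \<le> R \<and> d u a' \<le> R \<and> d v b' \<le> R \<longrightarrow> d u v \<le> \<Delta>"
proof (rule ccontr)
  assume neg: "\<not> ?thesis"
  have "\<exists>A A' u v a b a' b'. A \<in> \<P> \<and> A' \<in> \<P> \<and> u \<in> M \<and> v \<in> M \<and> a \<in> A \<and> b \<in> A \<and> a' \<in> A' \<and> b' \<in> A' \<and>
     A \<noteq> A' \<and> d u a \<le> R \<and> d v b \<le> R \<and> d u a' \<le> R \<and> d v b' \<le> R \<and> real n \<le> d u v" for n :: nat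
  proof (rule ccontr)
    assume no: "\<not> ?thesis"
    have "\<forall>A\<in>\<P>. \<forall>A'\<in>\<P>. \<forall>u\<in>M. \<forall>v\<in>M. \<forall>a\<in>A. \<forall>b\<in>A. \<forall>a'\<in>A'. \<forall>b'\<in>A'.
       A \<noteq> A' \<and> d u a \<le> R \<and> d v b \<le> R \<and> d u a' \<le> R \<and> d v b' \<le> R \<longrightarrow> d u v \<le> real n"
    proof (intro ballI impI, rule ccontr)
      fix A A' u v a b a' b'
      assume *: "A \<in> \<P>" "A' \<in> \<P>" "u \<in> M" "v \<in> M" "a \<in> A" "b \<in> A" "a' \<in> A'" "b' \<in> A'"
        "A \<noteq> A' \<and> d u a \<le> R \<and> d v b \<le> R \<and> d u a' \<le> R \<and> d v b' \<le> R" "\<not> d u v \<le> real n"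
      have "real n \<le> d u v" using *(10) by simp
      then show False using * no by blast
    qed
    then show False using neg by blast
  qed
  then obtain A A' u v a b a' b' where
    A: "\<And>n. A n \<in> \<P>" and A': "\<And>n. A' n \<in> \<P>" and u: "\<And>n. u n \<in> M" and v: "\<And>n. v n \<in> M"
    and in_A: "\<And>n. a n \<in> A n" "\<And>n. b n \<in> A n" "\<And>n. a' n \<in> A' n" "\<And>n. b' n \<in> A' n"
    and ne: "\<And>n. A n \<noteq> A' n"
    and near: "\<And>n. d (u n) (a n) \<le> R" "\<And>n. d (v n) (b n) \<le> R" "\<And>n. d (u n) (a' n) \<le> R" "\<And>n. d (v n) (b' n) \<le> R"
    and far: "\<And>n. real n \<le> d (u n) (v n)"
    by metis
  obtain \<omega> where ultra: "nonprincipal_ultrafilter \<omega>" using nonprincipal_ultrafilter_exists by blast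
  define r where "r n = d (u n) (v n)" for n
  interpret cone M d \<P> \<omega> u r
    using ultra u ultrafilter_filterlim_at_top[OF ultra, of r] far by unfold_locales (auto simp: r_def)
  have us: "u \<in> seqs" by (rule base_seqs)
  have vs: "v \<in> seqs" by (rule seqsI[OF v us, where c = 1]) (simp add: r_def commute)
  have close: "x \<in> seqs \<and> cls y = cls x" if "y \<in> seqs" "\<And>n. x n \<in> M" "\<And>n. d (y n) (x n) \<le> R" for x y
  proof
    have "eventually (\<lambda>n. R \<le> r n) \<omega>" using scale by (simp add: filterlim_at_top)
    then have "eventually (\<lambda>n. d (x n) (y n) \<le> 1 * r n) \<omega>"
      by eventually_elim (use that(3) commute in \<open>simp, metis order_trans\<close>)
    then show x: "x \<in> seqs" by (rule seqsI[OF that(2,1)])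
    show "cls y = cls x" by (rule cls_eqI[OF that(1) x _ const_over_scale[of R]]) (simp add: that)
  qed
  have inM: "a n \<in> M" "b n \<in> M" "a' n \<in> M" "b' n \<in> M" for n
    using in_A peripheral_subset A A' by blast+
  have c: "a \<in> seqs" "cls u = cls a" "b \<in> seqs" "cls v = cls b" "a' \<in> seqs" "cls u = cls a'" "b' \<in> seqs" "cls v = cls b'"
    using close[OF us inM(1) near(1)] close[OF vs inM(2) near(2)]
      close[OF us inM(3) near(3)] close[OF vs inM(4) near(4)] by auto
  have i: "cls u \<in> ulim A" "cls v \<in> ulim A" "cls u \<in> ulim A'" "cls v \<in> ulim A'"
    using cls_in_ulim[OF A c(1)] cls_in_ulim[OF A c(3)] cls_in_ulim[OF A' c(5)] cls_in_ulim[OF A' c(7)]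
      in_A c by auto
  have "((\<lambda>n. r n / r n) \<longlongrightarrow> 1) \<omega>"
    by (rule Lim_transform_eventually[OF tendsto_const]) (use scale_pos in eventually_elim, simp)
  then have "dC (cls u) (cls v) = 1"
    using dist_eq[OF us vs, of r 1] by (simp add: r_def)
  then have "cls u \<noteq> cls v" using cls_in_cone[OF us] by auto
  then have "seq_class \<omega> \<P> A = seq_class \<omega> \<P> A'"
    using T.piece_eqI[OF piece_class[OF A i(1)] piece_class[OF A' i(3)] i(1,3,2,4)] by blast
  then have "eventually (\<lambda>n. A n = A' n) \<omega>" using seq_class_eqD A by blast
  then show False using ne ultrafilter_neq_bot[OF ultra] by simp
qed

end


section \<open>Contraction of nearest-point projections\<close>

text \<open>The gate \<open>a\<close> of a far point \<open>G s\<close> is close to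
  \<open>G s\<close>, hence far from \<open>G 0\<close> and different from \<open>e\<close>. So the
  geodesic from \<open>G 0\<close> to \<open>G s\<close> passes \<open>e\<close> and then
  \<open>a\<close>, and between the two it stays in the piece.\<close>

lemma (in tree_graded_space) ray_enters_piece:
  assumes k: "k \<in> K" and G: "\<And>l. 0 \<le> l \<Longrightarrow> geodesic_path M d 0 l G"
    and near: "\<And>s. 1 < s \<Longrightarrow> \<exists>a. nearest d (P k) (G s) a \<and> d (G s) a \<le> s / 10"
    and e: "nearest d (P k) (G 0) e"
  shows "G (d (G 0) e) = e" and "\<And>u. d (G 0) e \<le> u \<Longrightarrow> G u \<in> P k"
proof -
  define \<delta> where "\<delta> = d (G 0) e"
  have \<delta>0: "0 \<le> \<delta>" by (simp add: \<delta>_def)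
  have *: "G \<delta> = e \<and> G u \<in> P k" if u: "\<delta> \<le> u" for u
  proof -
    \<comment> \<open>Large enough that \<open>9 / 10 * s\<close> exceeds \<open>u\<close>, hence
      also \<open>\<delta>\<close>, and that \<open>near\<close> applies.\<close>
    define s where "s = 2 + 2 * u"
    have s: "1 < s" "0 \<le> s" using u \<delta>0 by (auto simp: s_def)
    obtain a where a: "nearest d (P k) (G s) a" "d (G s) a \<le> s / 10" using near[OF s(1)] by blast
    have aP: "a \<in> P k" using a by (simp add: nearest_def)
    have aM: "a \<in> M" using aP piece_subset[OF k] by blast
    note GD = geodesic_pathD[OF G[OF s(2)]]
    have "s = d (G 0) (G s)" using GD(3)[of 0 s] s by simp
    also have "\<dots> \<le> d (G 0) a + d (G s) a" using GD(2)[of 0] GD(2)[of s] s aM by (intro triangle') auto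
    finally have "\<delta> < d (G 0) a" using a(2) u \<delta>0 by (simp add: s_def)
    then have ne: "e \<noteq> a" by (auto simp: \<delta>_def)
    from geodesic_passes_gates[OF k G[OF s(2)] e a(1) ne]
    have 1: "G \<delta> = e" "G (s - d (G s) a) = a" "\<delta> \<le> s - d (G s) a" by (auto simp: \<delta>_def)
    have "geodesic_path M d \<delta> (s - d (G s) a) G"
      by (rule geodesic_path_subinterval[OF G[OF s(2)] \<delta>0 1(3)]) simp
    then have "G u \<in> P k"
    proof (rule geodesic_in_piece[OF k])
      show "G \<delta> \<in> P k" using 1(1) e by (simp add: nearest_def)
      show "G (s - d (G s) a) \<in> P k" using 1(2) aP by simp
      show "u \<in> {\<delta>..s - d (G s) a}" using u a(2) \<delta>0 by (simp add: s_def)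
    qed
    then show ?thesis using 1 by simp
  qed
  show "G (d (G 0) e) = e" using *[of \<delta>] by (simp add: \<delta>_def)
  show "\<And>u. d (G 0) e \<le> u \<Longrightarrow> G u \<in> P k" using * by (simp add: \<delta>_def)
qed

lemma discrete_geodesic_mono:
  "\<lbrakk>discrete_geodesic M d g a; M \<subseteq> M'; a' \<le> a\<rbrakk> \<Longrightarrow> discrete_geodesic M' d g a'"
  by (auto simp: discrete_geodesic_def)

lemma (in cone) long_if_tendsto:
  assumes "((\<lambda>n. real (a n) / r n) \<longlongrightarrow> l) \<omega>"
  shows "long a l"
  unfolding long_def
proof (intro allI impI)
  fix s assume "s < l"
  then have "eventually (\<lambda>n. s < real (a n) / r n) \<omega>" using order_tendstoD(1)[OF assms] by blast
  then show "eventually (\<lambda>n. s * r n \<le> real (a n)) \<omega>"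
    using scale_pos by eventually_elim (simp add: divide_simps split: if_splits)
qed

text \<open>The locale isolates what is used of the Cayley graph: an integer-valued metric on a set \<open>V\<close> of
  vertices, any two of which are joined by a geodesic edge path.\<close>

locale rel_hyp_graph = rel_hyp_space M d \<P> for M :: "'b set" and d \<P> +
  fixes V :: "'b set"
  assumes vertices: "V \<subseteq> M"
    and peripheral_vertices: "A \<in> \<P> \<Longrightarrow> A \<subseteq> V"
    and peripheral_nonempty: "A \<in> \<P> \<Longrightarrow> A \<noteq> {}"
    and dist_nat: "\<lbrakk>u \<in> V; v \<in> V\<rbrakk> \<Longrightarrow> d u v \<in> \<nat>"
    and edge_path: "\<lbrakk>u \<in> V; v \<in> V\<rbrakk> \<Longrightarrow> \<exists>g k. discrete_geodesic V d g k \<and> g 0 = u \<and> g k = v"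
begin

definition proj :: "'b set \<Rightarrow> 'b \<Rightarrow> 'b" where
  "proj A u = (SOME p. nearest d A u p)"

text \<open>Distances between vertices are natural numbers, so the minimum is attained even when
  \<open>A\<close> is infinite.\<close>

lemma nearest_proj:
  assumes A: "A \<in> \<P>" and u: "u \<in> V"
  shows "nearest d A u (proj A u)"
proof -
  obtain a0 where "a0 \<in> A" using peripheral_nonempty[OF A] by blast
  then obtain p where p: "p \<in> A" "\<And>a. a \<in> A \<Longrightarrow> nat \<lfloor>d u p\<rfloor> \<le> nat \<lfloor>d u a\<rfloor>"
    using ex_has_least_nat[of "\<lambda>a. a \<in> A" a0 "\<lambda>a. nat \<lfloor>d u a\<rfloor>"] by blast
  have "d u p \<le> d u a" if "a \<in> A" for a
  proof -
    have "p \<in> V" "a \<in> V" using p(1) that peripheral_vertices[OF A] by auto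
    then obtain k l :: nat where "d u p = k" "d u a = l" using dist_nat[OF u] by (meson Nats_cases)
    then show ?thesis using p(2)[OF that] by simp
  qed
  then have "nearest d A u p" using p(1) by (simp add: nearest_def)
  then show ?thesis unfolding proj_def by (rule someI)
qed

lemma proj_in: "\<lbrakk>A \<in> \<P>; u \<in> V\<rbrakk> \<Longrightarrow> proj A u \<in> A"
  and proj_le: "\<lbrakk>A \<in> \<P>; u \<in> V; a \<in> A\<rbrakk> \<Longrightarrow> d u (proj A u) \<le> d u a"
  using nearest_proj by (auto simp: nearest_def)

lemma proj_in_space: "\<lbrakk>A \<in> \<P>; u \<in> V\<rbrakk> \<Longrightarrow> proj A u \<in> M"
  using proj_in peripheral_subset by blast

end

locale graph_cone = rel_hyp_graph M d \<P> V + cone M d \<P> \<omega> e r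
  for M :: "'b set" and d \<P> V \<omega> e r
begin

text \<open>A point of the ultralimit bounds the distance of \<open>x n\<close> from
  \<open>A n\<close> by a multiple of the scale, so the projections do not escape from the
  cone.\<close>

lemma nearest_cls_proj:
  assumes A: "\<And>n. A n \<in> \<P>" and x: "x \<in> seqs" "\<And>n. x n \<in> V" and ne: "ulim A \<noteq> {}"
  shows "nearest dC (ulim A) (cls x) (cls (\<lambda>n. proj (A n) (x n)))"
proof -
  obtain \<eta> where "\<eta> \<in> ulim A" using ne by blast
  then obtain y where y: "y \<in> seqs" "\<forall>\<^sub>F n in \<omega>. y n \<in> A n" unfolding ulim_iff[OF A] by blast
  define c where "c = dC (cls x) (cls y) + 1"
  have "(\<lambda>n. proj (A n) (x n)) \<in> seqs"
  proof (rule seqsI[OF _ x(1)])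
    show "proj (A n) (x n) \<in> M" for n using proj_in_space A x(2) by blast
    have "\<forall>\<^sub>F n in \<omega>. d (x n) (y n) / r n < c"
      using order_tendstoD(2)[OF dist_tendsto[OF x(1) y(1)], of c] by (simp add: c_def)
    then show "\<forall>\<^sub>F n in \<omega>. d (proj (A n) (x n)) (x n) \<le> c * r n"
      using y(2) scale_pos
    proof eventually_elim
      case (elim n)
      have "d (proj (A n) (x n)) (x n) \<le> d (x n) (y n)"
        using proj_le[OF A x(2) elim(2)] by (simp add: commute)
      then show ?case using elim(1,3) by (simp add: divide_simps)
    qed
  qed
  then show ?thesis using nearest_proj[OF A x(2)] by (intro nearest_cls[OF A x(1)]) auto
qed

text \<open>Carries information back from the cone: membership in the ultralimit means that the
  distance to \<open>A n\<close> is negligible at this scale.\<close>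

lemma proj_dist_tendsto_0:
  assumes A: "\<And>n. A n \<in> \<P>" and x: "x \<in> seqs" "\<And>n. x n \<in> V" and mem: "cls x \<in> ulim A"
  shows "((\<lambda>n. d (x n) (proj (A n) (x n)) / r n) \<longlongrightarrow> 0) \<omega>"
proof -
  obtain z where z: "z \<in> seqs" "cls x = cls z" "\<forall>\<^sub>F n in \<omega>. z n \<in> A n"
    using mem unfolding ulim_iff[OF A] by blast
  show ?thesis
  proof (rule Lim_null_comparison[OF _ cls_eq_tendsto[OF x(1) z(1,2)]])
    show "\<forall>\<^sub>F n in \<omega>. norm (d (x n) (proj (A n) (x n)) / r n) \<le> d (x n) (z n) / r n"
      using z(3) scale_pos
    proof eventually_elim
      case (elim n)
      then show ?case using proj_le[OF A x(2) elim(1)] by (simp add: divide_right_mono)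
    qed
  qed
qed

end

text \<open>A sequence of strips: geodesics \<open>g n\<close> and \<open>h n\<close> leave \<open>A n\<close> orthogonally at points at distance
  at least \<open>n\<close>, and \<open>s1 n\<close> is the first time at which \<open>g n\<close> comes closer to \<open>h n\<close> than half of its
  distance from \<open>A n\<close>. Such strips do not exist. At scale \<open>s1\<close> the feet coincide, so the two
  geodesics bound a second piece \<open>A'\<close> starting at their common foot. At the (smaller) scale \<open>s2\<close> at
  which they enter \<open>A'\<close>, both become rays that eventually run inside \<open>A'\<close>, and tree-gradedness
  fails whether or not the feet are distinct at that scale.\<close>

locale strips = rel_hyp_graph M d \<P> V for M :: "'b set" and d \<P> V +
  fixes A :: "nat \<Rightarrow> 'b set" and g h :: "nat \<Rightarrow> nat \<Rightarrow> 'b" and s1 t1 :: "nat \<Rightarrow> nat"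
    and \<omega> :: "nat filter"
  assumes A: "\<And>n. A n \<in> \<P>"
    and g_geodesic: "\<And>n. discrete_geodesic V d (g n) (s1 n)"
    and h_geodesic: "\<And>n. discrete_geodesic V d (h n) (t1 n)"
    and feet: "\<And>n. g n 0 \<in> A n" "\<And>n. h n 0 \<in> A n"
    and g_orthogonal: "\<And>n i z. \<lbrakk>i \<le> s1 n; z \<in> A n\<rbrakk> \<Longrightarrow> real i \<le> d (g n i) z"
    and h_orthogonal: "\<And>n i z. \<lbrakk>i \<le> t1 n; z \<in> A n\<rbrakk> \<Longrightarrow> real i \<le> d (h n i) z"
    and wide: "\<And>n. real n \<le> d (g n 0) (h n 0)"
    and close: "\<And>n. 2 * d (g n (s1 n)) (h n (t1 n)) \<le> real (s1 n)"
    and separated: "\<And>n i j. \<lbrakk>i \<le> s1 n; j \<le> t1 n\<rbrakk> \<Longrightarrow> real i / 2 - 2 \<le> d (g n i) (h n j)"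
    and ultra: "nonprincipal_ultrafilter \<omega>"
begin

definition width :: "nat \<Rightarrow> real" where
  "width n = d (g n 0) (h n 0)"

lemma g_vertex: "i \<le> s1 n \<Longrightarrow> g n i \<in> V"
  and h_vertex: "j \<le> t1 n \<Longrightarrow> h n j \<in> V"
  using g_geodesic h_geodesic by (auto simp: discrete_geodesic_def)

lemma g_point: "i \<le> s1 n \<Longrightarrow> g n i \<in> M"
  and h_point: "j \<le> t1 n \<Longrightarrow> h n j \<in> M"
  using g_vertex h_vertex vertices by auto

lemma g_dist: "\<lbrakk>i \<le> s1 n; j \<le> s1 n\<rbrakk> \<Longrightarrow> d (g n i) (g n j) = \<bar>real i - real j\<bar>"
  and h_dist: "\<lbrakk>i \<le> t1 n; j \<le> t1 n\<rbrakk> \<Longrightarrow> d (h n i) (h n j) = \<bar>real i - real j\<bar>"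
  using g_geodesic h_geodesic by (auto simp: discrete_geodesic_def)

lemma g_geodesic_M: "a \<le> s1 n \<Longrightarrow> discrete_geodesic M d (g n) a"
  and h_geodesic_M: "a \<le> t1 n \<Longrightarrow> discrete_geodesic M d (h n) a"
  using discrete_geodesic_mono[OF g_geodesic vertices] discrete_geodesic_mono[OF h_geodesic vertices] by auto

lemma g_nearest: "i \<le> s1 n \<Longrightarrow> nearest d (A n) (g n i) (g n 0)"
  using g_orthogonal feet g_dist[of i n 0] by (simp add: nearest_def)

lemma h_nearest: "i \<le> t1 n \<Longrightarrow> nearest d (A n) (h n i) (h n 0)"
  using h_orthogonal feet h_dist[of i n 0] by (simp add: nearest_def)

text \<open>The end of \<open>g n\<close> is at distance at least \<open>s1 n\<close> from
  \<open>A n\<close> and within half of that of the end of \<open>h n\<close>, which is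
  \<open>t1 n\<close> away from its foot.\<close>

lemma t1_ge: "real (s1 n) \<le> 2 * real (t1 n)"
proof -
  have "real (s1 n) \<le> d (g n (s1 n)) (h n 0)" using g_orthogonal feet by simp
  also have "\<dots> \<le> d (g n (s1 n)) (h n (t1 n)) + d (h n (t1 n)) (h n 0)"
    using g_point h_point by (intro triangle) auto
  also have "d (h n (t1 n)) (h n 0) = t1 n" using h_dist[of "t1 n" n 0] by simp
  finally show ?thesis using close[of n] by simp
qed

lemma t1_le: "2 * real (t1 n) \<le> 3 * real (s1 n)"
proof -
  have "real (t1 n) \<le> d (h n (t1 n)) (g n 0)" using h_orthogonal feet by simp
  also have "\<dots> \<le> d (g n (s1 n)) (h n (t1 n)) + d (g n (s1 n)) (g n 0)"
    using g_point h_point by (intro triangle'') auto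
  also have "d (g n (s1 n)) (g n 0) = s1 n" using g_dist[of "s1 n" n 0] by simp
  finally show ?thesis using close[of n] by simp
qed

lemma quarter_le: "4 * i \<le> s1 n \<Longrightarrow> i \<le> s1 n \<and> i \<le> t1 n"
  using t1_ge[of n] by linarith

text \<open>A sum, so that length and width both have finite rescaled limits whichever dominates,
  and these limits add up to 1.\<close>

definition r1 :: "nat \<Rightarrow> real" where
  "r1 n = real (s1 n) + width n"

lemma width_ge: "real n \<le> width n" and width_nonneg: "0 \<le> width n"
  using wide by (auto simp: width_def)

lemma outer_cone: "cone M d \<P> \<omega> (\<lambda>n. g n 0) r1"
proof unfold_locales
  show "filterlim r1 at_top \<omega>"
  proof (rule ultrafilter_filterlim_at_top[OF ultra])
    show "real n \<le> r1 n" for n using width_ge[of n] by (simp add: r1_def)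
  qed
qed (use ultra g_point in auto)

lemma tendsto_fraction:
  fixes f r :: "nat \<Rightarrow> real"
  assumes "\<And>n. 0 \<le> f n" "\<And>n. f n \<le> B * r n" "0 \<le> B" "\<And>n. 0 \<le> r n"
  obtains l where "((\<lambda>n. f n / r n) \<longlongrightarrow> l) \<omega>"
proof (rule ultrafilter_bounded_tendsto[OF ultra])
  have "\<bar>f n / r n\<bar> \<le> B" for n
    using assms(1,2)[of n] assms(3) assms(4)[of n] by (cases "r n = 0") (auto simp: divide_simps)
  then show "eventually (\<lambda>n. \<bar>f n / r n\<bar> \<le> B) \<omega>" by simp
qed (use that in blast)

text \<open>In the cone at scale \<open>r1\<close> the far ends \<open>x\<close>, \<open>y\<close>
  have gates \<open>p\<close>, \<open>q\<close>. If these differed, a geodesic from \<open>x\<close>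
  to \<open>y\<close> would pass both and be longer than \<open>dC x y\<close> allows. So the width
  vanishes, the limit paths leave from one point, and \<open>separated\<close> keeps them apart
  afterwards: they are two sides of a tripod. Its piece, represented by \<open>A'\<close>, contains
  both paths up to time 1/2, hence at all times up to a quarter of \<open>s1\<close>.\<close>

lemma second_piece:
  "\<exists>A'. (\<forall>n. A' n \<in> \<P>) \<and> ((\<lambda>n. width n / r1 n) \<longlongrightarrow> 0) \<omega> \<and>
     (\<forall>i. (\<forall>n. 4 * i n \<le> s1 n) \<longrightarrow>
       ((\<lambda>n. d (g n (i n)) (proj (A' n) (g n (i n))) / r1 n) \<longlongrightarrow> 0) \<omega> \<and>
       ((\<lambda>n. d (h n (i n)) (proj (A' n) (h n (i n))) / r1 n) \<longlongrightarrow> 0) \<omega>)"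
proof -
  interpret graph_cone M d \<P> V \<omega> "\<lambda>n. g n 0" r1
    by (intro graph_cone.intro rel_hyp_graph_axioms outer_cone)
  have r1_nonneg: "0 \<le> r1 n" for n using width_nonneg by (simp add: r1_def)
  have s1_le: "real (s1 n) \<le> 1 * r1 n" for n using width_nonneg[of n] by (simp add: r1_def)
  have t1_le': "real (t1 n) \<le> 2 * r1 n" for n using s1_le[of n] t1_le[of n] by simp
  obtain \<sigma> where \<sigma>: "((\<lambda>n. real (s1 n) / r1 n) \<longlongrightarrow> \<sigma>) \<omega>"
    by (rule tendsto_fraction[of "\<lambda>n. real (s1 n)" 1 r1]) (use s1_le r1_nonneg in auto)
  obtain \<tau> where \<tau>: "((\<lambda>n. real (t1 n) / r1 n) \<longlongrightarrow> \<tau>) \<omega>"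
    by (rule tendsto_fraction[of "\<lambda>n. real (t1 n)" 2 r1]) (use t1_le' r1_nonneg in auto)
  obtain \<kappa> where \<kappa>: "((\<lambda>n. width n / r1 n) \<longlongrightarrow> \<kappa>) \<omega>"
    by (rule tendsto_fraction[of width 1 r1]) (use width_nonneg r1_nonneg in \<open>auto simp: r1_def\<close>)
  have "((\<lambda>n. real (s1 n) / r1 n + width n / r1 n) \<longlongrightarrow> 1) \<omega>"
  proof (rule Lim_transform_eventually[OF tendsto_const])
    show "\<forall>\<^sub>F n in \<omega>. 1 = real (s1 n) / r1 n + width n / r1 n"
      using scale_pos by eventually_elim (simp add: r1_def add_divide_distrib[symmetric])
  qed
  with tendsto_add[OF \<sigma> \<kappa>] have \<sigma>\<kappa>: "\<sigma> + \<kappa> = 1" using tendsto_unique[OF neq_bot] by blast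
  have \<sigma>0: "0 \<le> \<sigma>" and \<tau>0: "0 \<le> \<tau>"
    using tendsto_lowerbound[OF \<sigma> _ neq_bot, of 0] tendsto_lowerbound[OF \<tau> _ neq_bot, of 0] r1_nonneg by auto
  have g0: "(\<lambda>n. g n 0) \<in> seqs" by (rule base_seqs)
  have h0: "(\<lambda>n. h n 0) \<in> seqs"
  proof (rule seqsI[OF _ g0])
    show "h n 0 \<in> M" for n using h_point by simp
    show "\<forall>\<^sub>F n in \<omega>. d (h n 0) (g n 0) \<le> 1 * r1 n"
      by (intro always_eventually allI) (simp add: r1_def width_def commute)
  qed
  note gg = g_geodesic_M[OF order_refl] and hg = h_geodesic_M[OF order_refl]
  have gs: "(\<lambda>n. g n (s1 n)) \<in> seqs" and ht: "(\<lambda>n. h n (t1 n)) \<in> seqs"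
    using path_point_seqs[OF gg g0 _ \<sigma>] path_point_seqs[OF hg h0 _ \<tau>] by auto
  define p q x y where "p = cls (\<lambda>n. g n 0)" and "q = cls (\<lambda>n. h n 0)"
    and "x = cls (\<lambda>n. g n (s1 n))" and "y = cls (\<lambda>n. h n (t1 n))"
  have pC: "p \<in> C" "q \<in> C" "x \<in> C" "y \<in> C" using g0 h0 gs ht cls_in_cone by (auto simp: p_def q_def x_def y_def)
  have zero_lim: "((\<lambda>n. real 0 / r1 n) \<longlongrightarrow> 0) \<omega>" by simp
  have dxp: "dC x p = \<sigma>"
    using path_point_dist[OF gg g0 _ \<sigma> _ zero_lim] \<sigma>0 by (simp add: x_def p_def)
  have dyq: "dC y q = \<tau>"
    using path_point_dist[OF hg h0 _ \<tau> _ zero_lim] \<tau>0 by (simp add: y_def q_def)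
  have dpq: "dC p q = \<kappa>"
    using dist_eq[OF g0 h0 _ \<kappa>] by (simp add: p_def q_def width_def)
  have dxy: "dC x y \<le> \<sigma> / 2"
    unfolding x_def y_def
  proof (rule dist_le[OF gs ht])
    show "\<forall>\<^sub>F n in \<omega>. d (g n (s1 n)) (h n (t1 n)) \<le> real (s1 n) / 2"
      using close by (intro always_eventually allI) (simp add: mult.commute)
    show "((\<lambda>n. real (s1 n) / 2 / r1 n) \<longlongrightarrow> \<sigma> / 2) \<omega>"
      using tendsto_divide[OF \<sigma> tendsto_const[of 2]] by (simp add: field_simps)
  qed
  have near_xp: "nearest dC (ulim A) x p"
    unfolding x_def p_def by (rule nearest_cls[OF A gs g0]) (simp add: g_nearest)
  have near_yq: "nearest dC (ulim A) y q"
    unfolding y_def q_def by (rule nearest_cls[OF A ht h0]) (simp add: h_nearest)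
  have KA: "seq_class \<omega> \<P> A \<in> piece_classes"
    using piece_class[where A = A and \<xi> = p] A near_xp by (simp add: nearest_def)
  obtain j l where j: "geodesic_path C dC 0 l j" "j 0 = x" "j l = y"
    using geodesic_set_path[OF T.geodesic_set pC(3,4)] .
  note jD = geodesic_pathD[OF j(1)]
  have l: "l \<le> \<sigma> / 2" "0 \<le> l" using dxy jD(3)[of 0 l] jD(1) j by auto
  have "p = q"
  proof (rule ccontr)
    assume "p \<noteq> q"
    have "nearest dC (ulim A) (j 0) p" "nearest dC (ulim A) (j l) q" using near_xp near_yq j by simp_all
    from T.geodesic_passes_gates[OF KA j(1) this \<open>p \<noteq> q\<close>]
    have *: "j \<sigma> = p" "j (l - \<tau>) = q" "\<sigma> \<le> l - \<tau>" using dxp dyq j by simp_all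
    \<comment> \<open>This disposes of strips much shorter than wide: then \<open>j\<close> is a
      single point, which would be both \<open>p\<close> and \<open>q\<close>.\<close>
    then have "\<sigma> = 0" "\<tau> = 0" "l = 0" using l \<sigma>0 \<tau>0 by linarith+
    then have "p = q" using *(1,2) by simp
    then show False using \<open>p \<noteq> q\<close> by simp
  qed
  then have \<kappa>0: "\<kappa> = 0" using dpq pC by simp
  then have \<sigma>1: "\<sigma> = 1" using \<sigma>\<kappa> by simp
  define G H where "G = limit_path g s1" and "H = limit_path h t1"
  have long_s1: "long s1 1" and long_t1: "long t1 \<tau>"
    using long_if_tendsto[OF \<sigma>] long_if_tendsto[OF \<tau>] \<sigma>1 by auto
  have Gg: "geodesic_path C dC 0 1 G" and Hg: "geodesic_path C dC 0 \<tau> H"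
    unfolding G_def H_def
    using limit_path_geodesic[OF gg g0 _ long_s1] limit_path_geodesic[OF hg h0 \<tau>0 long_t1] by auto
  note GD = geodesic_pathD[OF Gg] and HD = geodesic_pathD[OF Hg]
  have G0: "G 0 = p" and H0: "H 0 = p"
    using limit_path_0 \<open>p = q\<close> by (auto simp: G_def H_def p_def q_def)
  have G1: "G 1 = x"
    unfolding G_def x_def using \<sigma> \<sigma>1 by (intro limit_path_eq[OF gg g0 _ long_s1]) auto
  have H1: "H \<tau> = y"
    unfolding H_def y_def using \<tau> \<tau>0 by (intro limit_path_eq[OF hg h0 _ long_t1]) auto
  have sep: "s / 2 \<le> dC (G s) (H t)" if s: "s \<in> {0..1}" and t: "t \<in> {0..\<tau>}" for s t
    unfolding G_def H_def limit_path_def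
  proof (rule dist_ge)
    have idx_s: "((\<lambda>n. real (index s1 s n) / r1 n) \<longlongrightarrow> s) \<omega>"
      using s by (intro index_tendsto long_mono[OF long_s1]) auto
    have idx_t: "((\<lambda>n. real (index t1 t n) / r1 n) \<longlongrightarrow> t) \<omega>"
      using t by (intro index_tendsto long_mono[OF long_t1]) auto
    show "(\<lambda>n. g n (index s1 s n)) \<in> seqs" by (rule path_point_seqs[OF gg g0 index_le idx_s])
    show "(\<lambda>n. h n (index t1 t n)) \<in> seqs" by (rule path_point_seqs[OF hg h0 index_le idx_t])
    show "\<forall>\<^sub>F n in \<omega>. real (index s1 s n) / 2 - 2 \<le> d (g n (index s1 s n)) (h n (index t1 t n))"
      by (intro always_eventually allI separated index_le)
    have "((\<lambda>n. real (index s1 s n) / r1 n / 2 - 2 / r1 n) \<longlongrightarrow> s / 2 - 0) \<omega>"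
      by (intro tendsto_intros idx_s const_over_scale) simp
    then show "((\<lambda>n. (real (index s1 s n) / 2 - 2) / r1 n) \<longlongrightarrow> s / 2) \<omega>"
      by (simp add: diff_divide_distrib mult.commute)
  qed
  have disj: "s = 0" if "s \<in> {0..1}" "t \<in> {0..\<tau>}" "G s = H t" for s t
  proof -
    have "H t \<in> C" using HD(2)[of t] that(2) by simp
    then show ?thesis using sep[OF that(1,2)] that(1,3) by simp
  qed
  have apex: "G 0 \<notin> j ` {0..l}"
  proof
    assume "G 0 \<in> j ` {0..l}"
    then obtain u where u: "u \<in> {0..l}" "p = j u" using G0 by auto
    have "dC x p = u" using jD(3)[of 0 u] u j by simp
    then show False using u l dxp \<sigma>1 by simp
  qed
  obtain k \<sigma>' \<tau>' where k: "k \<in> piece_classes" "\<sigma>' \<in> {0<..1}" "\<tau>' \<in> {0<..\<tau>}"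
    "G ` {0..\<sigma>'} \<subseteq> ultralimit \<omega> M d (\<lambda>n. g n 0) r1 k" "H ` {0..\<tau>'} \<subseteq> ultralimit \<omega> M d (\<lambda>n. g n 0) r1 k"
    "G \<sigma>' \<in> j ` {0..l}" "H \<tau>' \<in> j ` {0..l}"
  proof (rule T.tripod_in_piece[OF Gg Hg _ _ j(1)])
    show "G 0 = H 0" "j 0 = G 1" "j l = H \<tau>" using G0 H0 G1 H1 j by auto
    show "s = 0" if "s \<in> {0..1}" "t \<in> {0..\<tau>}" "G s = H t" for s t using disj that .
    show "G 0 \<notin> j ` {0..l}" by (fact apex)
  qed (rule that)
  \<comment> \<open>Both cuts lie on \<open>j\<close>, which has length at most 1/2 and starts at
    \<open>x\<close>, at distance 1 from \<open>p\<close>. So neither cut is closer to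
    \<open>p\<close> than 1/2.\<close>
  have "1/2 \<le> \<sigma>'"
  proof -
    obtain u where u: "u \<in> {0..l}" "G \<sigma>' = j u" using k(6) by blast
    have "1 - \<sigma>' = dC (G 1) (G \<sigma>')" using GD(3)[of 1 \<sigma>'] k(2) by simp
    also have "\<dots> = u" using jD(3)[of 0 u] u j G1 by simp
    finally show ?thesis using u l \<sigma>1 by simp
  qed
  have "1/2 \<le> \<tau>'"
  proof -
    obtain u where u: "u \<in> {0..l}" "H \<tau>' = j u" using k(7) by blast
    have HC: "H \<tau>' \<in> C" using HD(2)[of \<tau>'] k(3) by simp
    have "1 = dC x p" using dxp \<sigma>1 by simp
    also have "\<dots> \<le> dC x (H \<tau>') + dC (H \<tau>') p" using T.triangle[OF pC(3) HC pC(1)] .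
    also have "dC x (H \<tau>') = u" using jD(3)[of 0 u] u j by simp
    also have "dC (H \<tau>') p = \<tau>'" using HD(3)[of \<tau>' 0] k(3) H0 by simp
    finally show ?thesis using u l \<sigma>1 by simp
  qed
  obtain A' where A': "\<And>n. A' n \<in> \<P>" "k = seq_class \<omega> \<P> A'" by (rule piece_class_repr[OF k(1)]) (rule that)
  show ?thesis
  proof (intro exI[of _ A'] conjI[OF _ conjI] allI impI)
    show "A' n \<in> \<P>" for n by (rule A'(1))
    show "((\<lambda>n. width n / r1 n) \<longlongrightarrow> 0) \<omega>" using \<kappa> \<kappa>0 by simp
    fix i assume "\<forall>n. 4 * i n \<le> s1 n"
    then have i: "4 * i n \<le> s1 n" for n by blast
    obtain s where s: "((\<lambda>n. real (i n) / r1 n) \<longlongrightarrow> s) \<omega>"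
    proof (rule tendsto_fraction[of "\<lambda>n. real (i n)" "1/4" r1])
      show "real (i n) \<le> 1/4 * r1 n" for n using i[of n] s1_le[of n] by linarith
    qed (use r1_nonneg in auto)
    have s0: "0 \<le> s" using tendsto_lowerbound[OF s _ neq_bot, of 0] r1_nonneg by auto
    have "s \<le> 1/4"
    proof (rule tendsto_upperbound[OF s _ neq_bot])
      show "\<forall>\<^sub>F n in \<omega>. real (i n) / r1 n \<le> 1/4"
        using scale_pos
      proof eventually_elim
        case (elim n)
        then show ?case using i[of n] s1_le[of n] by (simp add: divide_simps)
      qed
    qed
    then have s': "s \<in> {0..\<sigma>'}" "s \<in> {0..\<tau>'}" using s0 \<open>1/2 \<le> \<sigma>'\<close> \<open>1/2 \<le> \<tau>'\<close> by auto
    have ile: "i n \<le> s1 n" "i n \<le> t1 n" for n using quarter_le[OF i] by auto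
    have "G s = cls (\<lambda>n. g n (i n))"
      unfolding G_def using s0 s' k(2) s ile
      by (intro limit_path_eq[OF gg g0 _ long_mono[OF long_s1]]) auto
    moreover have "H s = cls (\<lambda>n. h n (i n))"
      unfolding H_def using s0 s' k(3) s ile
      by (intro limit_path_eq[OF hg h0 _ long_mono[OF long_t1]]) auto
    moreover have "G s \<in> ulim A'" "H s \<in> ulim A'" using k(4,5) s' A'(2) by auto
    ultimately have in_cls: "cls (\<lambda>n. g n (i n)) \<in> ulim A'" "cls (\<lambda>n. h n (i n)) \<in> ulim A'"
      by simp_all
    show "((\<lambda>n. d (g n (i n)) (proj (A' n) (g n (i n))) / r1 n) \<longlongrightarrow> 0) \<omega> \<and>
       ((\<lambda>n. d (h n (i n)) (proj (A' n) (h n (i n))) / r1 n) \<longlongrightarrow> 0) \<omega>"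
      by (intro conjI proj_dist_tendsto_0[OF A'(1) path_point_seqs[OF gg g0 ile(1) s] g_vertex[OF ile(1)] in_cls(1)]
        proj_dist_tendsto_0[OF A'(1) path_point_seqs[OF hg h0 ile(2) s] h_vertex[OF ile(2)] in_cls(2)])
  qed
qed

lemma no_strips: False
proof -
  obtain A' where A': "\<And>n. A' n \<in> \<P>" and width0: "((\<lambda>n. width n / r1 n) \<longlongrightarrow> 0) \<omega>"
    and gap0: "\<And>i. (\<And>n. 4 * i n \<le> s1 n) \<Longrightarrow>
       ((\<lambda>n. d (g n (i n)) (proj (A' n) (g n (i n))) / r1 n) \<longlongrightarrow> 0) \<omega> \<and>
       ((\<lambda>n. d (h n (i n)) (proj (A' n) (h n (i n))) / r1 n) \<longlongrightarrow> 0) \<omega>"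
    using second_piece by (elim exE conjE) blast
  define \<phi> where "\<phi> n i = d (g n i) (proj (A' n) (g n i)) + d (h n i) (proj (A' n) (h n i))" for n i
  \<comment> \<open>The last time, up to a quarter of \<open>s1\<close>, at which the paths are not
    yet close to \<open>A' n\<close>: the joint gap \<phi> is at least a tenth of the elapsed time.
    Time 0 always qualifies. The tenth is the one in \<open>ray_enters_piece\<close>.\<close>
  define s2 where "s2 n = Max {i. 4 * i \<le> s1 n \<and> real i \<le> 10 * \<phi> n i}" for n
  \<comment> \<open>This scale turns out to be negligible against \<open>r1\<close>. In its cone the
    paths become infinite rays, while the entrance time \<open>s2\<close> and the width stay
    bounded.\<close>
  define r2 where "r2 n = real (s2 n) + width n" for n
  define a where "a n = s1 n div 4" for n
  have fin: "finite {i. 4 * i \<le> s1 n \<and> real i \<le> 10 * \<phi> n i}" for n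
    by (rule finite_subset[of _ "{..s1 n}"]) auto
  have "0 \<in> {i. 4 * i \<le> s1 n \<and> real i \<le> 10 * \<phi> n i}" for n by (simp add: \<phi>_def)
  then have "s2 n \<in> {i. 4 * i \<le> s1 n \<and> real i \<le> 10 * \<phi> n i}" for n
    unfolding s2_def by (intro Max_in[OF fin]) blast
  then have s2: "4 * s2 n \<le> s1 n" "real (s2 n) \<le> 10 * \<phi> n (s2 n)" for n by auto
  have beyond: "10 * \<phi> n i < real i" if "s2 n < i" "4 * i \<le> s1 n" for n i
  proof (rule ccontr)
    assume "\<not> 10 * \<phi> n i < real i"
    then have "i \<le> s2 n" unfolding s2_def using that(2) by (intro Max_ge[OF fin]) auto
    then show False using that(1) by simp
  qed
  have r1_pos: "\<forall>\<^sub>F n in \<omega>. 0 < r1 n" using cone.scale_pos[OF outer_cone] .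
  have r2_ge: "real n \<le> r2 n" "width n \<le> r2 n" "real (s2 n) \<le> r2 n" for n
    using width_ge[of n] width_nonneg[of n] by (auto simp: r2_def)
  have "((\<lambda>n. 10 * (d (g n (s2 n)) (proj (A' n) (g n (s2 n))) / r1 n
      + d (h n (s2 n)) (proj (A' n) (h n (s2 n))) / r1 n)) \<longlongrightarrow> 10 * (0 + 0)) \<omega>"
    using gap0[OF s2(1)] by (intro tendsto_intros) auto
  then have \<phi>0: "((\<lambda>n. 10 * \<phi> n (s2 n) / r1 n) \<longlongrightarrow> 0) \<omega>"
    by (simp add: \<phi>_def add_divide_distrib)
  have s20: "((\<lambda>n. real (s2 n) / r1 n) \<longlongrightarrow> 0) \<omega>"
  proof (rule Lim_null_comparison[OF _ \<phi>0])
    show "\<forall>\<^sub>F n in \<omega>. norm (real (s2 n) / r1 n) \<le> 10 * \<phi> n (s2 n) / r1 n"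
      using r1_pos
    proof eventually_elim
      case (elim n)
      then show ?case using divide_right_mono[OF s2(2), of "r1 n" n] by simp
    qed
  qed
  have r20: "((\<lambda>n. r2 n / r1 n) \<longlongrightarrow> 0) \<omega>"
    using tendsto_add[OF s20 width0] by (simp add: r2_def add_divide_distrib)
  interpret graph_cone M d \<P> V \<omega> "\<lambda>n. g n 0" r2
    using ultra ultrafilter_filterlim_at_top[OF ultra, of r2] r2_ge(1) g_point by unfold_locales auto
  have a: "4 * a n \<le> s1 n" "a n \<le> s1 n" "a n \<le> t1 n" for n
    using quarter_le[of "a n" n] by (auto simp: a_def)
  \<comment> \<open>As \<open>s1 n \<le> 4 * a n + 4\<close> and \<open>width n \<le> r2 n\<close>,
    the summand 5 pays for the width and, once \<open>r2 n \<ge> 1\<close>, for the rounding in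
    \<open>a n\<close>.\<close>
  have far: "\<forall>\<^sub>F n in \<omega>. K * r2 n \<le> real (a n)" if K: "0 \<le> K" for K
  proof -
    have "\<forall>\<^sub>F n in \<omega>. r2 n / r1 n < 1 / (4 * K + 5)" using order_tendstoD(2)[OF r20] K by simp
    moreover have "\<forall>\<^sub>F n in \<omega>. 1 \<le> r2 n" using scale by (simp add: filterlim_at_top)
    ultimately show ?thesis
      using r1_pos
    proof eventually_elim
      case (elim n)
      have "(4 * K + 5) * r2 n < r1 n" using elim K by (simp add: field_simps)
      then have "4 * (K * r2 n) + 5 * r2 n < real (s1 n) + width n" by (simp add: r1_def algebra_simps)
      moreover have "real (s1 n) \<le> 4 * real (a n) + 4" unfolding a_def by linarith
      ultimately show ?case using r2_ge(2)[of n] elim(2) by linarith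
    qed
  qed
  have long: "long a l" for l
    unfolding long_def
  proof (intro allI impI)
    fix s
    have "\<forall>\<^sub>F n in \<omega>. \<bar>s\<bar> * r2 n \<le> real (a n)" by (rule far) simp
    then show "\<forall>\<^sub>F n in \<omega>. s * r2 n \<le> real (a n)"
      using scale_pos
    proof eventually_elim
      case (elim n)
      have "s * r2 n \<le> \<bar>s\<bar> * r2 n" using elim(2) by (intro mult_right_mono) auto
      then show ?case using elim(1) by simp
    qed
  qed
  have g0: "(\<lambda>n. g n 0) \<in> seqs" by (rule base_seqs)
  have h0: "(\<lambda>n. h n 0) \<in> seqs"
  proof (rule seqsI[OF _ g0])
    show "h n 0 \<in> M" for n using h_point by simp
    show "\<forall>\<^sub>F n in \<omega>. d (h n 0) (g n 0) \<le> 1 * r2 n"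
      using r2_ge(2) by (intro always_eventually allI) (simp add: width_def commute)
  qed
  note gg = g_geodesic_M[OF a(2)] and hg = h_geodesic_M[OF a(3)]
  define G H where "G = limit_path g a" and "H = limit_path h a"
  have Gg: "geodesic_path C dC 0 l G" and Hg: "geodesic_path C dC 0 l H" if "0 \<le> l" for l
    unfolding G_def H_def using limit_path_geodesic[OF gg g0 that long] limit_path_geodesic[OF hg h0 that long] by auto
  have idx: "((\<lambda>n. real (index a s n) / r2 n) \<longlongrightarrow> s) \<omega>" if "0 \<le> s" for s
    by (rule index_tendsto[OF that long])
  have G_seq: "(\<lambda>n. g n (index a s n)) \<in> seqs" and H_seq: "(\<lambda>n. h n (index a s n)) \<in> seqs" if "0 \<le> s" for s
    using path_point_seqs[OF gg g0 index_le idx[OF that]] path_point_seqs[OF hg h0 index_le idx[OF that]] by auto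
  have index_s1: "index a s n \<le> s1 n" and index_t1: "index a s n \<le> t1 n" for s n
    using index_le[of a s n] a(2,3)[of n] by linarith+
  have G_V: "g n (index a s n) \<in> V" and H_V: "h n (index a s n) \<in> V" for s n
    using g_vertex[OF index_s1] h_vertex[OF index_t1] by auto
  define p q where "p = cls (\<lambda>n. g n 0)" and "q = cls (\<lambda>n. h n 0)"
  have G0: "G 0 = p" and H0: "H 0 = q" by (auto simp: G_def H_def p_def q_def limit_path_0)
  have GC: "G s \<in> C" and HC: "H s \<in> C" if "0 \<le> s" for s
    using geodesic_pathD(2)[OF Gg[OF that]] geodesic_pathD(2)[OF Hg[OF that]] that by auto
  have Gd: "dC (G s) (G t) = \<bar>s - t\<bar>" if "0 \<le> s" "0 \<le> t" for s t
    using geodesic_pathD(3)[OF Gg[of "max s t"], of s t] that by auto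
  have near_A_G: "nearest dC (ulim A) (G s) p" if "0 \<le> s" for s
    unfolding G_def limit_path_def p_def
    by (rule nearest_cls[OF A G_seq[OF that] g0]) (simp add: g_nearest index_s1)
  have near_A_H: "nearest dC (ulim A) (H s) q" if "0 \<le> s" for s
    unfolding H_def limit_path_def q_def
    by (rule nearest_cls[OF A H_seq[OF that] h0]) (simp add: h_nearest index_t1)
  have sep: "s / 2 \<le> dC (G s) (H t)" if s: "0 \<le> s" and t: "0 \<le> t" for s t
    unfolding G_def H_def limit_path_def
  proof (rule dist_ge[OF G_seq[OF s] H_seq[OF t]])
    show "\<forall>\<^sub>F n in \<omega>. real (index a s n) / 2 - 2 \<le> d (g n (index a s n)) (h n (index a t n))"
      by (intro always_eventually allI separated index_s1 index_t1)
    have "((\<lambda>n. real (index a s n) / r2 n / 2 - 2 / r2 n) \<longlongrightarrow> s / 2 - 0) \<omega>"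
      by (intro tendsto_intros idx[OF s] const_over_scale) simp
    then show "((\<lambda>n. (real (index a s n) / 2 - 2) / r2 n) \<longlongrightarrow> s / 2) \<omega>"
      by (simp add: diff_divide_distrib mult.commute)
  qed
  have late: "\<forall>\<^sub>F n in \<omega>. 10 * \<phi> n (index a s n) \<le> real (index a s n)" if "1 < s" for s
  proof -
    have "\<forall>\<^sub>F n in \<omega>. 1 < real (index a s n) / r2 n" using order_tendstoD(1)[OF idx] that by simp
    then show ?thesis
      using scale_pos
    proof eventually_elim
      case (elim n)
      then have "s2 n < index a s n" using r2_ge(3)[of n] by (simp add: divide_simps split: if_splits)
      moreover have "4 * index a s n \<le> s1 n" using index_le[of a s n] a(1)[of n] by linarith
      ultimately show ?case using beyond by (simp add: less_imp_le)
    qed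
  qed
  have close_A': "nearest dC (ulim A') (cls f) (cls (\<lambda>n. proj (A' n) (f n))) \<and>
      dC (cls f) (cls (\<lambda>n. proj (A' n) (f n))) \<le> s / 10"
    if s: "1 < s" and f: "f \<in> seqs" "\<And>n. f n \<in> V"
      and le: "\<forall>\<^sub>F n in \<omega>. 10 * d (f n) (proj (A' n) (f n)) \<le> real (index a s n)" for f s
  proof -
    have s0: "0 \<le> s" using s by simp
    have pm: "proj (A' n) (f n) \<in> M" for n using proj_in_space A' f(2) by blast
    have ps: "(\<lambda>n. proj (A' n) (f n)) \<in> seqs"
    proof (rule seqsI[OF pm f(1)])
      have "\<forall>\<^sub>F n in \<omega>. real (index a s n) / r2 n < s + 1" using order_tendstoD(2)[OF idx[OF s0]] by simp
      then show "\<forall>\<^sub>F n in \<omega>. d (proj (A' n) (f n)) (f n) \<le> (s + 1) * r2 n"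
        using le scale_pos
      proof eventually_elim
        case (elim n)
        then have "real (index a s n) < (s + 1) * r2 n" by (simp add: divide_simps)
        then show ?case using elim(2) nonneg[of "f n" "proj (A' n) (f n)"] by (simp add: commute)
      qed
    qed
    have "cls (\<lambda>n. proj (A' n) (f n)) \<in> ulim A'"
      using proj_in A' f(2) by (intro cls_in_ulim[OF A' ps]) simp
    then have "nearest dC (ulim A') (cls f) (cls (\<lambda>n. proj (A' n) (f n)))"
      by (intro nearest_cls_proj[OF A' f]) blast
    moreover have "dC (cls f) (cls (\<lambda>n. proj (A' n) (f n))) \<le> s / 10"
    proof (rule dist_le[OF f(1) ps])
      show "\<forall>\<^sub>F n in \<omega>. d (f n) (proj (A' n) (f n)) \<le> real (index a s n) / 10"
        using le by eventually_elim simp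
      show "((\<lambda>n. real (index a s n) / 10 / r2 n) \<longlongrightarrow> s / 10) \<omega>"
        using tendsto_divide[OF idx[OF s0] tendsto_const[of 10]] by (simp add: field_simps)
    qed
    ultimately show ?thesis by blast
  qed
  have near_G: "\<exists>z. nearest dC (ulim A') (G s) z \<and> dC (G s) z \<le> s / 10"
    and near_H: "\<exists>z. nearest dC (ulim A') (H s) z \<and> dC (H s) z \<le> s / 10" if s: "1 < s" for s
  proof -
    have split: "10 * d (g n i) (proj (A' n) (g n i)) \<le> 10 * \<phi> n i"
      "10 * d (h n i) (proj (A' n) (h n i)) \<le> 10 * \<phi> n i" for n i by (auto simp: \<phi>_def)
    have s0: "0 \<le> s" using s by simp
    have "\<forall>\<^sub>F n in \<omega>. 10 * d (g n (index a s n)) (proj (A' n) (g n (index a s n))) \<le> real (index a s n)"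
      by (rule eventually_mono[OF late[OF s]], erule order_trans[OF split(1)])
    from close_A'[OF s G_seq[OF s0] G_V this]
    show "\<exists>z. nearest dC (ulim A') (G s) z \<and> dC (G s) z \<le> s / 10"
      unfolding G_def limit_path_def by blast
    have "\<forall>\<^sub>F n in \<omega>. 10 * d (h n (index a s n)) (proj (A' n) (h n (index a s n))) \<le> real (index a s n)"
      by (rule eventually_mono[OF late[OF s]], erule order_trans[OF split(2)])
    from close_A'[OF s H_seq[OF s0] H_V this]
    show "\<exists>z. nearest dC (ulim A') (H s) z \<and> dC (H s) z \<le> s / 10"
      unfolding H_def limit_path_def by blast
  qed
  have ne: "ulim A' \<noteq> {}" using near_G[of 2] by (auto simp: nearest_def)
  have KA: "seq_class \<omega> \<P> A \<in> piece_classes"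
    using piece_class[where A = A and \<xi> = p] A near_A_G[of 0] by (simp add: nearest_def)
  have KA': "seq_class \<omega> \<P> A' \<in> piece_classes"
    using piece_class[where A = A'] A' ne by blast
  obtain e where e: "nearest dC (ulim A') (G 0) e"
    using nearest_cls_proj[OF A' g0 _ ne] g_vertex G0 unfolding p_def by auto
  obtain e' where e': "nearest dC (ulim A') (H 0) e'"
    using nearest_cls_proj[OF A' h0 _ ne] h_vertex H0 unfolding q_def by auto
  have G_ray: "G (dC (G 0) e) = e" "\<And>u. dC (G 0) e \<le> u \<Longrightarrow> G u \<in> ulim A'"
    using T.ray_enters_piece[OF KA' Gg near_G e] by auto
  have H_ray: "H (dC (H 0) z) = z" "\<And>u. dC (H 0) z \<le> u \<Longrightarrow> H u \<in> ulim A'"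
    if "nearest dC (ulim A') (H 0) z" for z
    using T.ray_enters_piece[OF KA' Hg near_H that] by auto
  show False
  proof (cases "p = q")
    case True
    define \<delta> where "\<delta> = dC (G 0) e"
    have eH: "nearest dC (ulim A') (H 0) e" using e G0 H0 True by simp
    have "G \<delta> = H \<delta>" using G_ray(1) H_ray(1)[OF eH] G0 H0 True by (simp add: \<delta>_def)
    moreover have \<delta>0: "0 \<le> \<delta>" by (simp add: \<delta>_def)
    \<comment> \<open>Both rays reach the common gate \<open>e\<close> at time \<delta>, but
      \<open>sep\<close> keeps them \<open>\<delta> / 2\<close> apart at that time. So the common
      foot already lies in the limit of \<open>A'\<close>.\<close>
    ultimately have \<delta>: "\<delta> = 0" using sep[of \<delta> \<delta>] HC[of \<delta>] by simp
    have in_A': "G 1 \<in> ulim A'" "H 1 \<in> ulim A'"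
      using G_ray(2)[of 1] H_ray(2)[OF eH, of 1] \<delta> G0 H0 True by (auto simp: \<delta>_def)
    have w0: "((\<lambda>n. width n / r2 n) \<longlongrightarrow> 0) \<omega>"
    proof -
      have "((\<lambda>n. width n / r2 n) \<longlongrightarrow> dC p q) \<omega>"
        using dist_tendsto[OF g0 h0] by (simp add: width_def p_def q_def)
      then show ?thesis using True GC[of 0] G0 by simp
    qed
    have "((\<lambda>n. 1 - width n / r2 n) \<longlongrightarrow> 1 - 0) \<omega>" by (intro tendsto_intros w0)
    then have lim1: "((\<lambda>n. 1 - width n / r2 n) \<longlongrightarrow> 1) \<omega>" by simp
    have s2_lim: "((\<lambda>n. real (s2 n) / r2 n) \<longlongrightarrow> 1) \<omega>"
    proof (rule Lim_transform_eventually[OF lim1])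
      show "\<forall>\<^sub>F n in \<omega>. 1 - width n / r2 n = real (s2 n) / r2 n"
        using scale_pos by eventually_elim (simp add: r2_def field_simps)
    qed
    have s2a: "s2 n \<le> a n" for n using s2(1)[of n] unfolding a_def by linarith
    have gs2: "(\<lambda>n. g n (s2 n)) \<in> seqs" and hs2: "(\<lambda>n. h n (s2 n)) \<in> seqs"
      using path_point_seqs[OF gg g0 s2a s2_lim] path_point_seqs[OF hg h0 s2a s2_lim] by auto
    have "G 1 = cls (\<lambda>n. g n (s2 n))" "H 1 = cls (\<lambda>n. h n (s2 n))"
      unfolding G_def H_def
      using limit_path_eq[OF gg g0 _ long s2a s2_lim] limit_path_eq[OF hg h0 _ long s2a s2_lim] by auto
    then have in_cls: "cls (\<lambda>n. g n (s2 n)) \<in> ulim A'" "cls (\<lambda>n. h n (s2 n)) \<in> ulim A'" using in_A' by auto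
    have s2_le: "s2 n \<le> s1 n" "s2 n \<le> t1 n" for n using quarter_le[OF s2(1)] by auto
    have "((\<lambda>n. 10 * (d (g n (s2 n)) (proj (A' n) (g n (s2 n))) / r2 n
        + d (h n (s2 n)) (proj (A' n) (h n (s2 n))) / r2 n)) \<longlongrightarrow> 10 * (0 + 0)) \<omega>"
      by (intro tendsto_intros proj_dist_tendsto_0[OF A' gs2 g_vertex[OF s2_le(1)] in_cls(1)]
        proj_dist_tendsto_0[OF A' hs2 h_vertex[OF s2_le(2)] in_cls(2)])
    then have "((\<lambda>n. 10 * \<phi> n (s2 n) / r2 n) \<longlongrightarrow> 0) \<omega>"
      by (simp add: \<phi>_def add_divide_distrib)
    \<comment> \<open>The width being negligible, \<open>s2\<close> makes up the whole scale. At
      time \<open>s2\<close> the gap is at least a tenth of \<open>s2\<close>, yet it vanishes in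
      the cone.\<close>
    then have "(1::real) \<le> 0"
    proof (rule tendsto_le[OF neq_bot _ s2_lim])
      show "\<forall>\<^sub>F n in \<omega>. real (s2 n) / r2 n \<le> 10 * \<phi> n (s2 n) / r2 n"
        using scale_pos by eventually_elim (use s2(2) in \<open>simp add: divide_right_mono\<close>)
    qed
    then show False by simp
  next
    case False
    \<comment> \<open>Beyond both entrances, and positive so that \<open>G s\<close> is not
      \<open>p\<close>. A geodesic inside the limit of \<open>A'\<close> from \<open>G s\<close> to
      \<open>H s\<close> passes the gates \<open>p\<close> and \<open>q\<close>, so the pieces of
      \<open>A\<close> and \<open>A'\<close> share two points and agree. Then \<open>G s\<close>
      would lie in the piece in which \<open>p\<close> is nearest to it.\<close>
    define s where "s = 1 + dC (G 0) e + dC (H 0) e'"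
    have s: "1 \<le> s" "0 \<le> s" "dC (G 0) e \<le> s" "dC (H 0) e' \<le> s"
      using T.nonneg[of "G 0" e] T.nonneg[of "H 0" e'] by (auto simp: s_def simp del: T.nonneg)
    have inA': "G s \<in> ulim A'" "H s \<in> ulim A'" using G_ray(2) H_ray(2)[OF e'] s by auto
    obtain f l where f: "geodesic_path (ulim A') dC 0 l f" "f 0 = G s" "f l = H s"
      using geodesic_set_path[OF T.piece_geodesic[OF KA'] inA'] .
    have fC: "geodesic_path C dC 0 l f"
      using f(1) T.piece_subset[OF KA'] by (auto simp: geodesic_path_def)
    have "nearest dC (ulim A) (f 0) p" "nearest dC (ulim A) (f l) q"
      using near_A_G[OF s(2)] near_A_H[OF s(2)] f by auto
    from T.geodesic_passes_gates[OF KA fC this False]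
    have *: "f (dC (f 0) p) = p" "f (l - dC (f l) q) = q" "dC (f 0) p \<le> l - dC (f l) q" by auto
    have "f t \<in> ulim A'" if "0 \<le> t" "t \<le> l" for t using geodesic_pathD(2)[OF f(1)] that by blast
    then have "p \<in> ulim A'" "q \<in> ulim A'"
      using * T.nonneg[of "f 0" p] T.nonneg[of "f l" q] by (metis diff_ge_0_iff_ge diff_le_eq le_add_same_cancel1 order_trans)+
    moreover have "p \<in> ulim A" "q \<in> ulim A" using near_A_G[of 0] near_A_H[of 0] by (auto simp: nearest_def)
    ultimately have "seq_class \<omega> \<P> A = seq_class \<omega> \<P> A'"
      using T.piece_eqI[OF KA KA'] False by blast
    then have "G s \<in> ulim A" using inA' by simp
    then have "dC (G s) p \<le> dC (G s) (G s)" using near_A_G[OF s(2)] by (simp add: nearest_def)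
    then show False using Gd[of s 0] s G0 GC[of s] by simp
  qed
qed

end


section \<open>From failures of contraction to strips\<close>

context rel_hyp_graph
begin

text \<open>Geodesics from the projections to \<open>x\<close> and \<open>y\<close> are orthogonal
  to \<open>A\<close> by the triangle inequality. The first one is stopped as soon as it comes
  within half of its elapsed time of the other; by \<open>close\<close> this happens at
  \<open>x\<close> at the latest. Minimality of the stopping time is what gives the
  separation.\<close>

lemma strip_exists:
  assumes A: "A \<in> \<P>" and xy: "x \<in> V" "y \<in> V" and p: "nearest d A x p" and q: "nearest d A y q"
    and close: "2 * d x y \<le> d x p"
  shows "\<exists>g h s t. discrete_geodesic V d g s \<and> discrete_geodesic V d h t \<and> g 0 = p \<and> h 0 = q \<and>
    (\<forall>i z. i \<le> s \<and> z \<in> A \<longrightarrow> real i \<le> d (g i) z) \<and> (\<forall>i z. i \<le> t \<and> z \<in> A \<longrightarrow> real i \<le> d (h i) z) \<and>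
    2 * d (g s) (h t) \<le> real s \<and> (\<forall>i j. i \<le> s \<and> j \<le> t \<longrightarrow> real i / 2 - 2 \<le> d (g i) (h j))"
proof -
  have orthogonal: "\<exists>g a. discrete_geodesic V d g a \<and> g 0 = p \<and> g a = x \<and> real a = d x p \<and>
      (\<forall>i z. i \<le> a \<and> z \<in> A \<longrightarrow> real i \<le> d (g i) z)"
    if x: "x \<in> V" and p: "nearest d A x p" for x p
  proof -
    have "p \<in> V" using p peripheral_vertices[OF A] by (auto simp: nearest_def)
    then obtain g a where g: "discrete_geodesic V d g a" "g 0 = p" "g a = x" using edge_path x by blast
    have gV: "g i \<in> M" if "i \<le> a" for i using g(1) that vertices by (auto simp: discrete_geodesic_def)
    have gd: "d (g i) (g j) = \<bar>real i - real j\<bar>" if "i \<le> a" "j \<le> a" for i j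
      using g(1) that by (auto simp: discrete_geodesic_def)
    have a: "real a = d x p" using gd[of a 0] g by simp
    have "real i \<le> d (g i) z" if "i \<le> a" "z \<in> A" for i z
    proof -
      have "z \<in> M" using that(2) peripheral_subset[OF A] by blast
      have "real a \<le> d x z" using p that(2) a by (simp add: nearest_def)
      also have "\<dots> \<le> d x (g i) + d (g i) z" using gV[of a] gV[of i] g that \<open>z \<in> M\<close> by (intro triangle) auto
      also have "d x (g i) = real a - real i" using gd[of a i] g that by simp
      finally show ?thesis by simp
    qed
    then show ?thesis using g a by blast
  qed
  obtain g a where g: "discrete_geodesic V d g a" "g 0 = p" "g a = x" "real a = d x p"
    "\<And>i z. i \<le> a \<Longrightarrow> z \<in> A \<Longrightarrow> real i \<le> d (g i) z"
    using orthogonal[OF xy(1) p] by blast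
  obtain h b where h: "discrete_geodesic V d h b" "h 0 = q" "h b = y" "real b = d y q"
    "\<And>i z. i \<le> b \<Longrightarrow> z \<in> A \<Longrightarrow> real i \<le> d (h i) z"
    using orthogonal[OF xy(2) q] by blast
  define bad where "bad s \<longleftrightarrow> s \<le> a \<and> (\<exists>t\<le>b. 2 * d (g s) (h t) \<le> real s)" for s
  have "bad a" unfolding bad_def using close g(3,4) h(3) by auto
  define s where "s = (LEAST s. bad s)"
  have "bad s" unfolding s_def by (rule LeastI) fact
  then obtain t where t: "s \<le> a" "t \<le> b" "2 * d (g s) (h t) \<le> real s" by (auto simp: bad_def)
  have gV: "g i \<in> V" if "i \<le> a" for i using g(1) that by (auto simp: discrete_geodesic_def)
  have hV: "h i \<in> V" if "i \<le> b" for i using h(1) that by (auto simp: discrete_geodesic_def)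
  have good: "real i \<le> 2 * d (g i) (h j)" if "i < s" "j \<le> b" for i j
  proof -
    have "\<not> bad i" using that(1) not_less_Least unfolding s_def by blast
    then have "\<not> 2 * d (g i) (h j) \<le> real i" using that t by (auto simp: bad_def)
    then show ?thesis by simp
  qed
  have sep: "real i / 2 - 2 \<le> d (g i) (h j)" if "i \<le> s" "j \<le> t" for i j
  proof (cases "i < s")
    case True
    then show ?thesis using good[of i j] that t by simp
  next
    case False
    then have "i = s" using that by simp
    show ?thesis
    proof (cases "s = 0")
      case True
      then show ?thesis using \<open>i = s\<close> nonneg[of "g i" "h j"] by (simp del: nonneg)
    next
      case False
      \<comment> \<open>At the stopping time itself the separation is inherited from one step
        earlier; this loses 3/2, which the constant 2 covers.\<close>
      have "d (g (s - 1)) (h j) \<le> d (g (s - 1)) (g s) + d (g s) (h j)"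
        using gV[of "s - 1"] gV[of s] hV[of j] that t vertices by (intro triangle) auto
      moreover have "d (g (s - 1)) (g s) = 1" using g(1) t False by (auto simp: discrete_geodesic_def)
      moreover have "real (s - 1) \<le> 2 * d (g (s - 1)) (h j)" using good[of "s - 1" j] False that t by simp
      ultimately show ?thesis using \<open>i = s\<close> False by (simp add: of_nat_diff)
    qed
  qed
  have "discrete_geodesic V d g s" "discrete_geodesic V d h t"
    using discrete_geodesic_mono[OF g(1) order_refl t(1)] discrete_geodesic_mono[OF h(1) order_refl t(2)] .
  then show ?thesis using g h t sep by (intro exI[of _ g] exI[of _ h] exI[of _ s] exI[of _ t]) auto
qed

text \<open>The bound is uniform over all of \<open>\<P>\<close> because the peripheral set may vary
  along the sequence of counterexamples.\<close>

theorem projection_contracting: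
  "\<exists>B. \<forall>A\<in>\<P>. \<forall>x\<in>V. \<forall>y\<in>V. \<forall>p q. nearest d A x p \<and> nearest d A y q \<and> 2 * d x y \<le> d x p \<longrightarrow> d p q \<le> B"
proof (rule ccontr)
  assume neg: "\<not> ?thesis"
  define strip where "strip n A g h s t \<longleftrightarrow> A \<in> \<P> \<and> discrete_geodesic V d g s \<and> discrete_geodesic V d h t \<and>
    g 0 \<in> A \<and> h 0 \<in> A \<and>
    (\<forall>i z. i \<le> s \<and> z \<in> A \<longrightarrow> real i \<le> d (g i) z) \<and> (\<forall>i z. i \<le> t \<and> z \<in> A \<longrightarrow> real i \<le> d (h i) z) \<and>
    2 * d (g s) (h t) \<le> real s \<and> (\<forall>i j. i \<le> s \<and> j \<le> t \<longrightarrow> real i / 2 - 2 \<le> d (g i) (h j)) \<and>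
    real n \<le> d (g 0) (h 0)" for n :: nat and A g h s t
  have "\<exists>A g h s t. strip n A g h s t" for n
  proof -
    have "\<not> (\<forall>A\<in>\<P>. \<forall>x\<in>V. \<forall>y\<in>V. \<forall>p q. nearest d A x p \<and> nearest d A y q \<and> 2 * d x y \<le> d x p \<longrightarrow> d p q \<le> real n)"
      using neg by blast
    then obtain A x y p q where *: "A \<in> \<P>" "x \<in> V" "y \<in> V" "nearest d A x p" "nearest d A y q" "2 * d x y \<le> d x p"
      "\<not> d p q \<le> real n" by blast
    have pq: "p \<in> A" "q \<in> A" using *(4,5) by (auto simp: nearest_def)
    obtain g h s t where **: "discrete_geodesic V d g s \<and> discrete_geodesic V d h t \<and> g 0 = p \<and> h 0 = q \<and>
    (\<forall>i z. i \<le> s \<and> z \<in> A \<longrightarrow> real i \<le> d (g i) z) \<and> (\<forall>i z. i \<le> t \<and> z \<in> A \<longrightarrow> real i \<le> d (h i) z) \<and>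
    2 * d (g s) (h t) \<le> real s \<and> (\<forall>i j. i \<le> s \<and> j \<le> t \<longrightarrow> real i / 2 - 2 \<le> d (g i) (h j))"
      using strip_exists[OF *(1-6)] by blast
    have "strip n A g h s t" unfolding strip_def using *(1,7) ** pq by auto
    then show ?thesis by blast
  qed
  then obtain A g h s t where "\<And>n. strip n (A n) (g n) (h n) (s n) (t n)" by metis
  note * = this[unfolded strip_def]
  obtain \<omega> where ultra: "nonprincipal_ultrafilter \<omega>" using nonprincipal_ultrafilter_exists by blast
  interpret strips M d \<P> V A g h s t \<omega>
    by unfold_locales (use * ultra in blast)+
  show False by (rule no_strips)
qed

end


section \<open>Word metrics\<close>

abbreviation word_prod :: "('a, 'm) monoid_scheme \<Rightarrow> 'a list \<Rightarrow> 'a" where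
  "word_prod G w \<equiv> foldr (\<otimes>\<^bsub>G\<^esub>) w \<one>\<^bsub>G\<^esub>"

locale generated_group = group G for G :: "('a, 'm) monoid_scheme" (structure) +
  fixes Y :: "'a set"
  assumes gens: "Y \<subseteq> carrier G" and generates: "generate G Y = carrier G"
begin

abbreviation "len \<equiv> word_length G Y"
abbreviation "wd \<equiv> word_dist G Y"

lemma sym_gens_closed: "sym_gens G Y \<subseteq> carrier G"
  using gens by (auto simp: sym_gens_def)

lemma sym_gens_inv: "y \<in> sym_gens G Y \<Longrightarrow> inv y \<in> sym_gens G Y"
  using gens by (auto simp: sym_gens_def)

lemma word_prod_closed: "set w \<subseteq> sym_gens G Y \<Longrightarrow> word_prod G w \<in> carrier G"
  using sym_gens_closed by (induction w) auto

lemma word_prod_append: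
  "\<lbrakk>set v \<subseteq> sym_gens G Y; set w \<subseteq> sym_gens G Y\<rbrakk> \<Longrightarrow> word_prod G (v @ w) = word_prod G v \<otimes> word_prod G w"
proof (induction v)
  case Nil
  then show ?case using word_prod_closed[of w] by simp
next
  case (Cons y v)
  then show ?case
    using word_prod_closed[of w] word_prod_closed[of v] word_prod_closed[of "v @ w"] sym_gens_closed
    by (simp add: m_assoc subset_iff)
qed

lemma word_prod_inv:
  "set w \<subseteq> sym_gens G Y \<Longrightarrow> word_prod G (map (m_inv G) (rev w)) = inv (word_prod G w)"
proof (induction w)
  case (Cons y w)
  have "set (map (m_inv G) (rev w)) \<subseteq> sym_gens G Y" "set [inv y] \<subseteq> sym_gens G Y"
    using Cons.prems sym_gens_inv by auto
  from word_prod_append[OF this]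
  have "word_prod G (map (m_inv G) (rev w) @ [inv y]) = inv (word_prod G w) \<otimes> word_prod G [inv y]"
    using Cons by (simp del: foldr_append)
  then show ?case
    using Cons.prems sym_gens_closed word_prod_closed[of w]
    by (simp add: inv_mult_group subset_iff del: foldr_append)
qed simp

lemma word_exists:
  assumes "g \<in> carrier G"
  shows "\<exists>w. set w \<subseteq> sym_gens G Y \<and> word_prod G w = g"
proof -
  have "g \<in> generate G Y" using assms generates by simp
  then show ?thesis
  proof induction
    case one
    then show ?case by (intro exI[of _ "[]"]) simp
  next
    case (incl h)
    then show ?case using gens by (intro exI[of _ "[h]"]) (auto simp: sym_gens_def)
  next
    case (inv h)
    then show ?case using gens by (intro exI[of _ "[inv h]"]) (auto simp: sym_gens_def)
  next
    case (eng g h)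
    then obtain v w where "set v \<subseteq> sym_gens G Y" "word_prod G v = g" "set w \<subseteq> sym_gens G Y" "word_prod G w = h"
      by blast
    then show ?case by (intro exI[of _ "v @ w"]) (simp add: word_prod_append del: foldr_append)
  qed
qed

lemma shortest_word:
  assumes "g \<in> carrier G"
  obtains w where "length w = len g" "set w \<subseteq> sym_gens G Y" "word_prod G w = g"
proof -
  have "\<exists>n. \<exists>w. length w = n \<and> set w \<subseteq> sym_gens G Y \<and> word_prod G w = g" using word_exists[OF assms] by blast
  from LeastI_ex[OF this] show ?thesis using that unfolding word_length_def by blast
qed

lemma len_le: "set w \<subseteq> sym_gens G Y \<Longrightarrow> len (word_prod G w) \<le> length w"
  unfolding word_length_def by (rule Least_le) blast

lemma len_one: "len \<one> = 0"
  using len_le[of "[]"] by simp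

lemma len_eq_0: "g \<in> carrier G \<Longrightarrow> len g = 0 \<Longrightarrow> g = \<one>"
  by (metis shortest_word length_0_conv foldr.simps(1) id_apply)

lemma len_gen: "y \<in> sym_gens G Y \<Longrightarrow> len y \<le> 1"
  using len_le[of "[y]"] sym_gens_closed by auto

lemma len_mult:
  assumes "g \<in> carrier G" "h \<in> carrier G"
  shows "len (g \<otimes> h) \<le> len g + len h"
proof -
  obtain v where v: "length v = len g" "set v \<subseteq> sym_gens G Y" "word_prod G v = g" using shortest_word[OF assms(1)] .
  obtain w where w: "length w = len h" "set w \<subseteq> sym_gens G Y" "word_prod G w = h" using shortest_word[OF assms(2)] .
  show ?thesis using len_le[of "v @ w"] v w by (simp add: word_prod_append del: foldr_append)
qed

lemma len_inv_le: "g \<in> carrier G \<Longrightarrow> len (inv g) \<le> len g"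
proof -
  assume "g \<in> carrier G"
  then obtain v where v: "length v = len g" "set v \<subseteq> sym_gens G Y" "word_prod G v = g" using shortest_word by blast
  have "set (map (m_inv G) (rev v)) \<subseteq> sym_gens G Y" using v sym_gens_inv by auto
  from len_le[OF this] show ?thesis using v word_prod_inv[OF v(2)] by simp
qed

lemma len_inv: "g \<in> carrier G \<Longrightarrow> len (inv g) = len g"
  using len_inv_le[of g] len_inv_le[of "inv g"] by simp

lemma wd_nonneg: "0 \<le> wd g h"
  by (simp add: word_dist_def)

lemma wd_refl: "g \<in> carrier G \<Longrightarrow> wd g g = 0"
  by (simp add: word_dist_def len_one)

lemma wd_commute: "\<lbrakk>g \<in> carrier G; h \<in> carrier G\<rbrakk> \<Longrightarrow> wd g h = wd h g"
  using len_inv[of "inv g \<otimes> h"] by (simp add: word_dist_def inv_mult_group)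

lemma wd_triangle:
  assumes "g \<in> carrier G" "h \<in> carrier G" "k \<in> carrier G"
  shows "wd g k \<le> wd g h + wd h k"
proof -
  have "h \<otimes> (inv h \<otimes> k) = k" using assms by (simp add: m_assoc[symmetric])
  then have "inv g \<otimes> h \<otimes> (inv h \<otimes> k) = inv g \<otimes> k" using assms by (simp add: m_assoc)
  then show ?thesis using len_mult[of "inv g \<otimes> h" "inv h \<otimes> k"] assms by (simp add: word_dist_def flip: of_nat_add)
qed

lemma wd_mult_left:
  assumes "g \<in> carrier G" "h \<in> carrier G" "k \<in> carrier G"
  shows "wd (k \<otimes> g) (k \<otimes> h) = wd g h"
proof -
  have "inv k \<otimes> (k \<otimes> h) = h" using assms by (simp add: m_assoc[symmetric])
  then have "inv (k \<otimes> g) \<otimes> (k \<otimes> h) = inv g \<otimes> h" using assms by (simp add: inv_mult_group m_assoc)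
  then show ?thesis using assms by (simp add: word_dist_def)
qed

lemma wd_pos: "\<lbrakk>g \<in> carrier G; h \<in> carrier G; g \<noteq> h\<rbrakk> \<Longrightarrow> 1 \<le> wd g h"
  using len_eq_0[of "inv g \<otimes> h"] by (cases "len (inv g \<otimes> h)") (auto simp: word_dist_def dest: inv_solve_left'[THEN iffD1, rotated -1])

text \<open>The path consists of the prefixes of a shortest word. Subwords bound every distance from
  above, and since the bounds on three consecutive segments add up to the total distance, each is an
  equality.\<close>

lemma discrete_geodesic_exists:
  assumes gh: "g \<in> carrier G" "h \<in> carrier G"
  shows "\<exists>f k. discrete_geodesic (carrier G) wd f k \<and> f 0 = g \<and> f k = h"
proof -
  obtain w where w: "length w = len (inv g \<otimes> h)" "set w \<subseteq> sym_gens G Y" "word_prod G w = inv g \<otimes> h"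
    using shortest_word[of "inv g \<otimes> h"] gh by auto
  define k where "k = length w"
  define f where "f i = g \<otimes> word_prod G (take i w)" for i
  have sub: "set (take i w) \<subseteq> sym_gens G Y" "set (drop i w) \<subseteq> sym_gens G Y"
    if "set w \<subseteq> sym_gens G Y" for i w using that set_take_subset set_drop_subset by fast+
  have fc: "f i \<in> carrier G" for i unfolding f_def using gh word_prod_closed[OF sub(1)[OF w(2)]] by simp
  have f0: "f 0 = g" and fk: "f k = h"
    using gh w(3) by (auto simp: f_def k_def m_assoc[symmetric])
  have up: "wd (f i) (f j) \<le> real j - real i" if "i \<le> j" "j \<le> k" for i j
  proof -
    define u where "u = drop i (take j w)"
    have u: "set u \<subseteq> sym_gens G Y" unfolding u_def by (intro sub w(2))
    have "take j w = take i w @ u" unfolding u_def using that by (metis append_take_drop_id min.absorb1 take_take)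
    then have "word_prod G (take j w) = word_prod G (take i w) \<otimes> word_prod G u"
      using word_prod_append[OF sub(1)[OF w(2)] u] by metis
    then have "f j = f i \<otimes> word_prod G u"
      unfolding f_def using gh word_prod_closed[OF sub(1)[OF w(2)]] word_prod_closed[OF u] by (simp add: m_assoc)
    then have "inv (f i) \<otimes> f j = word_prod G u"
      using fc[of i] word_prod_closed[OF u] by (simp add: m_assoc[symmetric])
    then show ?thesis using len_le[OF u] that by (simp add: word_dist_def u_def k_def)
  qed
  have dist: "wd (f i) (f j) = real j - real i" if "i \<le> j" "j \<le> k" for i j
  proof (rule antisym[OF up[OF that]])
    have "real k = wd (f 0) (f k)" using w(1) f0 fk by (simp add: word_dist_def k_def)
    also have "\<dots> \<le> wd (f 0) (f i) + (wd (f i) (f j) + wd (f j) (f k))"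
      using wd_triangle[OF fc fc fc, of 0 k i] wd_triangle[OF fc fc fc, of i k j] by simp
    also have "\<dots> \<le> real i + (wd (f i) (f j) + (real k - real j))"
      using up[of 0 i] up[of j k] that by simp
    finally show "real j - real i \<le> wd (f i) (f j)" by simp
  qed
  have "wd (f i) (f j) = \<bar>real i - real j\<bar>" if "i \<le> k" "j \<le> k" for i j
  proof (cases "i \<le> j")
    case True
    then show ?thesis using dist that by simp
  next
    case False
    then show ?thesis using dist[of j i] that wd_commute[OF fc fc, of i j] by simp
  qed
  then have "discrete_geodesic (carrier G) wd f k" using fc by (simp add: discrete_geodesic_def)
  then show ?thesis using f0 fk by blast
qed

lemma vertex_in_cayley_graph: "g \<in> carrier G \<Longrightarrow> vertex g \<in> cayley_graph G Y"
  by (auto simp: cayley_graph_def cayley_cells_def vertex_def supp_def)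

lemma cayley_dist_vertex:
  assumes gh: "g \<in> carrier G" "h \<in> carrier G"
  shows "cayley_dist G Y (vertex g) (vertex h) = wd g h"
proof -
  have supp: "supp (vertex k) = {k}" for k :: 'a by (auto simp: supp_def vertex_def)
  show ?thesis
  proof (cases "\<exists>\<sigma>\<in>cayley_cells G Y. {g} \<union> {h} \<subseteq> \<sigma>")
    case True
    then obtain \<sigma> where \<sigma>: "\<sigma> \<in> cayley_cells G Y" "g \<in> \<sigma>" "h \<in> \<sigma>" by auto
    have eq: "cayley_dist G Y (vertex g) (vertex h) = (\<Sum>x\<in>{g} \<union> {h}. \<bar>vertex g x - vertex h x\<bar>) / 2"
      using True gh by (simp only: cayley_dist_def supp vertex_in_cayley_graph if_True simp_thms)
    show ?thesis
    proof (cases "g = h")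
      case True
      then show ?thesis using eq gh by (simp add: wd_refl)
    next
      case False
      then have "inv g \<otimes> h \<in> sym_gens G Y \<or> inv h \<otimes> g \<in> sym_gens G Y"
        using \<sigma> by (auto simp: cayley_cells_def)
      then have "inv g \<otimes> h \<in> sym_gens G Y"
        using sym_gens_inv[of "inv h \<otimes> g"] gh by (auto simp: inv_mult_group)
      then have "wd g h \<le> 1" using len_gen by (simp add: word_dist_def)
      then have "wd g h = 1" using wd_pos[OF gh False] by simp
      then show ?thesis using eq False by (simp add: vertex_def)
    qed
  next
    case False
    have "{(1 - vertex g u) + wd u v + (1 - vertex h v) | u v. u \<in> {g} \<and> v \<in> {h}} = {wd g h}"
      by (auto simp: vertex_def)
    then show ?thesis
      using False gh by (simp only: cayley_dist_def supp vertex_in_cayley_graph if_True if_False simp_thms Min_singleton)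
  qed
qed

end


section \<open>Projections to hyperbolically embedded subgroups\<close>

text \<open>Cuts the path into pieces of length \<open>J\<close>, each costing \<beta>; the summand
  1 is the incomplete piece. Used along a \<open>Y\<close>-geodesic and along a
  quasi-geodesic.\<close>

lemma chain_bound:
  fixes e :: "nat \<Rightarrow> nat \<Rightarrow> real" and J :: nat
  assumes step: "\<And>a b. \<lbrakk>a \<le> b; b \<le> n; b \<le> a + J\<rbrakk> \<Longrightarrow> e a b \<le> \<beta>"
    and triangle: "\<And>a b c. \<lbrakk>a \<le> b; b \<le> c; c \<le> n\<rbrakk> \<Longrightarrow> e a c \<le> e a b + e b c"
    and J: "1 \<le> J" and \<beta>: "0 \<le> \<beta>"
  shows "e 0 n \<le> \<beta> * (n / J + 1)"
proof -
  have "e 0 m \<le> \<beta> * (m / J + 1)" if "m \<le> n" for m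
    using that
  proof (induction m rule: less_induct)
    case (less m)
    show ?case
    proof (cases "m \<le> J")
      case True
      have "\<beta> * 1 \<le> \<beta> * (m / J + 1)" using \<beta> by (intro mult_left_mono) auto
      then show ?thesis using step[of 0 m] True less.prems by simp
    next
      case False
      have eq: "real m / J = real (m - J) / J + 1" using False J by (simp add: field_simps)
      have "e 0 (m - J) \<le> \<beta> * (m / J)"
        unfolding eq using less.IH[of "m - J"] less.prems J False by simp
      moreover have "e (m - J) m \<le> \<beta>" using step[of "m - J" m] less.prems False by simp
      moreover have "e 0 m \<le> e 0 (m - J) + e (m - J) m" using triangle[of 0 "m - J" m] less.prems by simp
      ultimately have "e 0 m \<le> \<beta> * (m / J) + \<beta>" by linarith
      then show ?thesis by (simp add: distrib_left)
    qed
  qed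
  then show ?thesis by simp
qed

lemma finite_if_unique:
  assumes "\<And>x y. \<lbrakk>x \<in> T; y \<in> T\<rbrakk> \<Longrightarrow> x = y"
  shows "finite T"
proof (cases "T = {}")
  case False
  then obtain x where "x \<in> T" by blast
  then have "T \<subseteq> {x}" using assms by blast
  then show ?thesis using finite_subset by blast
qed simp

section \<open>Comparison of the two word metrics\<close>

locale hyp_embedded = group G for G :: "('a, 'm) monoid_scheme" (structure) +
  fixes S Y :: "'a set" and I :: "'i set" and H :: "'i \<Rightarrow> 'a set"
  assumes finite_S: "finite S" and S_subset: "S \<subseteq> carrier G" and S_generates: "generate G S = carrier G"
    and finite_I: "finite I" and subgroups: "\<And>i. i \<in> I \<Longrightarrow> subgroup (H i) G"
    and embedded: "hyperbolically_embedded_wrt G Y I H"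
begin

sublocale S: generated_group G S
  using S_subset S_generates by unfold_locales

sublocale Y: generated_group G Y
  using embedded by unfold_locales (auto simp: hyperbolically_embedded_wrt_def)

abbreviation "cosets \<equiv> (\<Union>i\<in>I. lcosets (H i))"

lemma H_subset: "i \<in> I \<Longrightarrow> H i \<subseteq> carrier G"
  using subgroups subgroup.subset by blast

lemma one_in_H: "i \<in> I \<Longrightarrow> \<one> \<in> H i"
  using subgroups subgroup.one_closed by blast

lemma coset_mem_iff: "\<lbrakk>i \<in> I; x \<in> carrier G; a \<in> carrier G\<rbrakk> \<Longrightarrow> a \<in> inv x <# H i \<longleftrightarrow> x \<otimes> a \<in> H i"
proof
  assume i: "i \<in> I" and x: "x \<in> carrier G" and a: "a \<in> carrier G"
  {
    assume "a \<in> inv x <# H i"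
    then obtain h where "h \<in> H i" "a = inv x \<otimes> h" by (auto simp: l_coset_def)
    then show "x \<otimes> a \<in> H i" using H_subset[OF i] x by (auto simp: m_assoc[symmetric])
  next
    assume "x \<otimes> a \<in> H i"
    moreover have "a = inv x \<otimes> (x \<otimes> a)" using x a by (simp add: m_assoc[symmetric])
    ultimately show "a \<in> inv x <# H i" by (auto simp: l_coset_def)
  }
qed

lemma coset_subset: "A \<in> cosets \<Longrightarrow> A \<subseteq> carrier G"
  using H_subset by (auto simp: LCOSETS_def l_coset_def)

lemma coset_nonempty: "A \<in> cosets \<Longrightarrow> A \<noteq> {}"
  using one_in_H by (auto simp: LCOSETS_def l_coset_def)

lemma H_coset: "i \<in> I \<Longrightarrow> H i \<in> cosets"
proof -
  assume i: "i \<in> I"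
  have "\<one> <# H i = H i" using H_subset[OF i] by (force simp: l_coset_def)
  then show ?thesis using i by (auto simp: LCOSETS_def intro!: bexI[of _ i] bexI[of _ "\<one>"])
qed

sublocale Gamma: rel_hyp_graph "cayley_graph G Y" "cayley_dist G Y"
  "\<Union>i\<in>I. (\<lambda>A. vertex ` A) ` (lcosets (H i))" "vertex ` carrier G"
proof unfold_locales
  show "relatively_hyperbolic_space (cayley_graph G Y) (cayley_dist G Y)
      (\<Union>i\<in>I. (\<lambda>A. vertex ` A) ` (lcosets (H i)))"
    using embedded by (simp add: hyperbolically_embedded_wrt_def)
  show "vertex ` carrier G \<subseteq> cayley_graph G Y" using Y.vertex_in_cayley_graph by blast
  show "A \<subseteq> vertex ` carrier G" if "A \<in> (\<Union>i\<in>I. (\<lambda>A. vertex ` A) ` (lcosets (H i)))" for A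
    using that coset_subset by blast
  show "A \<noteq> {}" if "A \<in> (\<Union>i\<in>I. (\<lambda>A. vertex ` A) ` (lcosets (H i)))" for A
    using that coset_nonempty by blast
  show "cayley_dist G Y u v \<in> \<nat>" if "u \<in> vertex ` carrier G" "v \<in> vertex ` carrier G" for u v
    using that by (auto simp: Y.cayley_dist_vertex word_dist_def)
  show "\<exists>g k. discrete_geodesic (vertex ` carrier G) (cayley_dist G Y) g k \<and> g 0 = u \<and> g k = v"
    if "u \<in> vertex ` carrier G" "v \<in> vertex ` carrier G" for u v
  proof -
    obtain x y where xy: "x \<in> carrier G" "u = vertex x" "y \<in> carrier G" "v = vertex y" using \<open>u \<in> _\<close> \<open>v \<in> _\<close> by blast
    obtain f k where f: "discrete_geodesic (carrier G) Y.wd f k" "f 0 = x" "f k = y"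
      using Y.discrete_geodesic_exists xy by blast
    have "discrete_geodesic (vertex ` carrier G) (cayley_dist G Y) (\<lambda>i. vertex (f i)) k"
      using f(1) by (auto simp: discrete_geodesic_def Y.cayley_dist_vertex)
    then show ?thesis using f xy by blast
  qed
qed

lemma vertex_coset: "A \<in> cosets \<Longrightarrow> vertex ` A \<in> (\<Union>i\<in>I. (\<lambda>A. vertex ` A) ` (lcosets (H i)))"
  by blast

lemma vertex_inj: "inj (vertex :: 'a \<Rightarrow> _)"
proof (rule injI)
  fix x y :: 'a assume "vertex x = vertex y"
  then have "vertex x x = vertex y x" by simp
  then show "x = y" by (simp add: vertex_def split: if_splits)
qed

lemma coset_contraction:
  obtains B where "\<And>A x y p q. \<lbrakk>A \<in> cosets; x \<in> carrier G; y \<in> carrier G; nearest Y.wd A x p; nearest Y.wd A y q;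
    2 * Y.wd x y \<le> Y.wd x p\<rbrakk> \<Longrightarrow> Y.wd p q \<le> B"
proof -
  obtain B where B: "\<And>A x y p q. \<lbrakk>A \<in> (\<Union>i\<in>I. (\<lambda>A. vertex ` A) ` (lcosets (H i)));
      x \<in> vertex ` carrier G; y \<in> vertex ` carrier G;
      nearest (cayley_dist G Y) A x p; nearest (cayley_dist G Y) A y q; 2 * cayley_dist G Y x y \<le> cayley_dist G Y x p\<rbrakk>
      \<Longrightarrow> cayley_dist G Y p q \<le> B"
    using Gamma.projection_contracting by blast
  show ?thesis
  proof (rule that[of B])
    fix A x y p q
    assume *: "A \<in> cosets" "x \<in> carrier G" "y \<in> carrier G" "nearest Y.wd A x p" "nearest Y.wd A y q"
      "2 * Y.wd x y \<le> Y.wd x p"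
    have A: "a \<in> carrier G" if "a \<in> A" for a using that coset_subset[OF *(1)] by blast
    have near: "nearest (cayley_dist G Y) (vertex ` A) (vertex z) (vertex s) \<and> s \<in> carrier G"
      if "nearest Y.wd A z s" "z \<in> carrier G" for z s
      using that A by (auto simp: nearest_def Y.cayley_dist_vertex)
    have c: "p \<in> carrier G" "q \<in> carrier G" using near[OF *(4,2)] near[OF *(5,3)] by auto
    have "cayley_dist G Y (vertex p) (vertex q) \<le> B"
    proof (rule B[OF vertex_coset[OF *(1)]])
      show "2 * cayley_dist G Y (vertex x) (vertex y) \<le> cayley_dist G Y (vertex x) (vertex p)"
        using * c by (simp add: Y.cayley_dist_vertex)
    qed (use * near in auto)
    then show "Y.wd p q \<le> B" using c by (simp add: Y.cayley_dist_vertex)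
  qed
qed

lemma coset_intersection:
  obtains \<Delta> where "\<And>A A' u v. \<lbrakk>A \<in> cosets; A' \<in> cosets; u \<in> carrier G; v \<in> carrier G;
    \<exists>a\<in>A. Y.wd u a \<le> R; \<exists>a\<in>A. Y.wd v a \<le> R; \<exists>a\<in>A'. Y.wd u a \<le> R; \<exists>a\<in>A'. Y.wd v a \<le> R; A \<noteq> A'\<rbrakk>
    \<Longrightarrow> Y.wd u v \<le> \<Delta>"
proof -
  let ?P = "\<Union>i\<in>I. (\<lambda>A. vertex ` A) ` (lcosets (H i))"
  obtain \<Delta> where \<Delta>: "\<forall>A\<in>?P. \<forall>A'\<in>?P. \<forall>u\<in>cayley_graph G Y. \<forall>v\<in>cayley_graph G Y. \<forall>a\<in>A. \<forall>b\<in>A. \<forall>a'\<in>A'. \<forall>b'\<in>A'.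
     A \<noteq> A' \<and> cayley_dist G Y u a \<le> R \<and> cayley_dist G Y v b \<le> R \<and> cayley_dist G Y u a' \<le> R \<and>
     cayley_dist G Y v b' \<le> R \<longrightarrow> cayley_dist G Y u v \<le> \<Delta>"
    using Gamma.coarse_intersection_bounded[of R] ..
  show ?thesis
  proof (rule that[of \<Delta>])
    fix A A' u v
    assume *: "A \<in> cosets" "A' \<in> cosets" "u \<in> carrier G" "v \<in> carrier G" "A \<noteq> A'"
      "\<exists>a\<in>A. Y.wd u a \<le> R" "\<exists>a\<in>A. Y.wd v a \<le> R" "\<exists>a\<in>A'. Y.wd u a \<le> R" "\<exists>a\<in>A'. Y.wd v a \<le> R"
    then obtain a b a' b' where ab: "a \<in> A" "Y.wd u a \<le> R" "b \<in> A" "Y.wd v b \<le> R"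
      "a' \<in> A'" "Y.wd u a' \<le> R" "b' \<in> A'" "Y.wd v b' \<le> R" by (elim bexE)
    then have c: "a \<in> carrier G" "b \<in> carrier G" "a' \<in> carrier G" "b' \<in> carrier G"
      using coset_subset[OF *(1)] coset_subset[OF *(2)] by auto
    have ne: "vertex ` A \<noteq> vertex ` A'" using *(5) vertex_inj by (simp add: inj_image_eq_iff)
    note \<Delta>[THEN bspec, OF vertex_coset[OF *(1)], THEN bspec, OF vertex_coset[OF *(2)],
        THEN bspec, OF Y.vertex_in_cayley_graph[OF *(3)], THEN bspec, OF Y.vertex_in_cayley_graph[OF *(4)],
        THEN bspec, OF imageI[OF ab(1)], THEN bspec, OF imageI[OF ab(3)],
        THEN bspec, OF imageI[OF ab(5)], THEN bspec, OF imageI[OF ab(7)]]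
    then show "Y.wd u v \<le> \<Delta>" using ne ab c *(3,4) by (simp add: Y.cayley_dist_vertex)
  qed
qed

text \<open>The passage from \<open>Y\<close>-distances back to \<open>S\<close>-distances. Left
  translation moves \<open>g\<close> to \<one> inside the subgroup, so a finite ball around \<one>
  in each of the finitely many \<open>H i\<close> decides.\<close>

lemma proper_on_H:
  obtains \<rho> where "0 \<le> \<rho>" "\<And>i g h. \<lbrakk>i \<in> I; g \<in> H i; h \<in> H i; Y.wd g h \<le> R\<rbrakk> \<Longrightarrow> S.wd g h \<le> \<rho>"
proof -
  have "finite {h \<in> H i. cayley_dist G Y (vertex \<one>) (vertex h) \<le> R}" if "i \<in> I" for i
    using embedded that one_in_H[OF that] by (simp add: hyperbolically_embedded_wrt_def)
  then have fin: "finite (\<Union>i\<in>I. {h \<in> H i. cayley_dist G Y (vertex \<one>) (vertex h) \<le> R})" (is "finite ?F")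
    using finite_I by blast
  define \<rho> where "\<rho> = Max (insert 0 (S.len ` ?F))"
  show ?thesis
  proof (rule that[of "real \<rho>"])
    fix i g h assume *: "i \<in> I" "g \<in> H i" "h \<in> H i" "Y.wd g h \<le> R"
    have c: "g \<in> carrier G" "h \<in> carrier G" using * H_subset by blast+
    have k: "inv g \<otimes> h \<in> H i"
      using subgroups[OF *(1)] * by (simp add: subgroup.m_closed subgroup.m_inv_closed)
    have "Y.wd \<one> (inv g \<otimes> h) = Y.wd g h" using c by (simp add: word_dist_def)
    then have "inv g \<otimes> h \<in> ?F" using * k c by (auto simp: Y.cayley_dist_vertex)
    then have "S.len (inv g \<otimes> h) \<le> \<rho>" unfolding \<rho>_def using fin by (intro Max_ge) auto
    then show "S.wd g h \<le> real \<rho>" by (simp add: word_dist_def)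
  qed simp
qed

text \<open>Each of the finitely many letters of \<open>S\<close> has some \<open>Y\<close>-length,
  so replacing letters costs a bounded factor.\<close>

lemma lipschitz:
  obtains \<Lambda> where "0 \<le> \<Lambda>" "\<And>x y. \<lbrakk>x \<in> carrier G; y \<in> carrier G\<rbrakk> \<Longrightarrow> Y.wd x y \<le> \<Lambda> * S.wd x y"
proof -
  define \<Lambda> where "\<Lambda> = Max (insert 0 (Y.len ` sym_gens G S))"
  have fin: "finite (sym_gens G S)" using finite_S by (simp add: sym_gens_def)
  have word: "Y.len (word_prod G w) \<le> \<Lambda> * length w" if "set w \<subseteq> sym_gens G S" for w
    using that
  proof (induction w)
    case Nil
    then show ?case by (simp add: Y.len_one)
  next
    case (Cons y w)
    have "Y.len (y \<otimes> word_prod G w) \<le> Y.len y + Y.len (word_prod G w)"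
      using Cons.prems S.sym_gens_closed S.word_prod_closed[of w] by (intro Y.len_mult) auto
    moreover have "Y.len y \<le> \<Lambda>" unfolding \<Lambda>_def using fin Cons.prems by (intro Max_ge) auto
    ultimately show ?case using Cons by simp
  qed
  show ?thesis
  proof (rule that[of "real \<Lambda>"])
    fix x y assume xy: "x \<in> carrier G" "y \<in> carrier G"
    then obtain w where w: "length w = S.len (inv x \<otimes> y)" "set w \<subseteq> sym_gens G S" "word_prod G w = inv x \<otimes> y"
      using S.shortest_word[of "inv x \<otimes> y"] by auto
    show "Y.wd x y \<le> real \<Lambda> * S.wd x y"
      using word[OF w(2)] w by (simp add: word_dist_def flip: of_nat_mult)
  qed simp
qed

lemma finite_ball: "finite {w \<in> carrier G. S.wd \<one> w \<le> L}"
proof -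
  have "finite (sym_gens G S)" using finite_S by (simp add: sym_gens_def)
  then have "finite (word_prod G ` {w. set w \<subseteq> sym_gens G S \<and> length w \<le> nat \<lfloor>L\<rfloor>})"
    by (intro finite_imageI finite_lists_length_le)
  moreover have "{w \<in> carrier G. S.wd \<one> w \<le> L} \<subseteq> word_prod G ` {w. set w \<subseteq> sym_gens G S \<and> length w \<le> nat \<lfloor>L\<rfloor>}"
  proof
    fix x assume "x \<in> {w \<in> carrier G. S.wd \<one> w \<le> L}"
    then have x: "x \<in> carrier G" "real (S.len x) \<le> L" by (auto simp: word_dist_def)
    obtain w where "length w = S.len x" "set w \<subseteq> sym_gens G S" "word_prod G w = x" using S.shortest_word[OF x(1)] .
    then show "x \<in> word_prod G ` {w. set w \<subseteq> sym_gens G S \<and> length w \<le> nat \<lfloor>L\<rfloor>}"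
      using x(2) by (intro image_eqI[of _ _ w]) (auto simp: le_nat_floor)
  qed
  ultimately show ?thesis using finite_subset by blast
qed

text \<open>Nearest for the metric of \<open>Y\<close>, where contraction is known; the displacement
  of projections is then measured with \<open>S\<close>.\<close>

definition proj :: "'i \<Rightarrow> 'a \<Rightarrow> 'a" where
  "proj i x = (SOME p. nearest Y.wd (H i) x p)"

lemma nearest_proj:
  assumes "i \<in> I" "x \<in> carrier G"
  shows "nearest Y.wd (H i) x (proj i x)"
proof -
  obtain p where "p \<in> H i" "\<And>h. h \<in> H i \<Longrightarrow> Y.len (inv x \<otimes> p) \<le> Y.len (inv x \<otimes> h)"
    using ex_has_least_nat[of "\<lambda>h. h \<in> H i" "\<one>" "\<lambda>h. Y.len (inv x \<otimes> h)"] one_in_H[OF assms(1)] by blast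
  then have "nearest Y.wd (H i) x p" by (simp add: nearest_def word_dist_def)
  then show ?thesis unfolding proj_def by (rule someI)
qed

lemma proj_in: "\<lbrakk>i \<in> I; x \<in> carrier G\<rbrakk> \<Longrightarrow> proj i x \<in> H i"
  and proj_le: "\<lbrakk>i \<in> I; x \<in> carrier G; h \<in> H i\<rbrakk> \<Longrightarrow> Y.wd x (proj i x) \<le> Y.wd x h"
  using nearest_proj by (auto simp: nearest_def)

lemma proj_closed: "\<lbrakk>i \<in> I; x \<in> carrier G\<rbrakk> \<Longrightarrow> proj i x \<in> carrier G"
  using proj_in H_subset by blast

text \<open>Away from a window of bounded length, a \<open>Y\<close>-geodesic from \<open>x\<close> to \<open>y\<close> stays at distance more than
  \<open>2 * J\<close> from the subgroup, so by contraction its projection moves only by a constant during \<open>J\<close> steps;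
  properness turns this into a constant for the metric of \<open>S\<close> that does not depend on \<open>J\<close>. Translating
  \<open>x\<close> to \<open>\<one>\<close>, the windows are bounded for all but finitely many cosets, hence whenever \<open>x\<close> is far
  enough from the subgroup.\<close>

lemma projection_sublinear:
  assumes \<eta>: "0 < \<eta>"
  obtains K where "0 \<le> K" "\<And>L. \<exists>r. \<forall>i\<in>I. \<forall>x\<in>carrier G. \<forall>y\<in>carrier G.
    S.wd x y \<le> L \<and> (\<forall>h\<in>H i. r \<le> S.wd x h) \<longrightarrow> S.wd (proj i x) (proj i y) \<le> \<eta> * L + K"
proof -
  obtain B where B: "\<And>A x y p q. \<lbrakk>A \<in> cosets; x \<in> carrier G; y \<in> carrier G; nearest Y.wd A x p; nearest Y.wd A y q;
    2 * Y.wd x y \<le> Y.wd x p\<rbrakk> \<Longrightarrow> Y.wd p q \<le> B"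
    using coset_contraction by blast
  obtain \<beta> where \<beta>: "0 \<le> \<beta>" "\<And>i g h. \<lbrakk>i \<in> I; g \<in> H i; h \<in> H i; Y.wd g h \<le> B\<rbrakk> \<Longrightarrow> S.wd g h \<le> \<beta>"
    using proper_on_H[of B] by blast
  obtain \<Lambda> where \<Lambda>: "0 \<le> \<Lambda>" "\<And>x y. \<lbrakk>x \<in> carrier G; y \<in> carrier G\<rbrakk> \<Longrightarrow> Y.wd x y \<le> \<Lambda> * S.wd x y"
    using lipschitz by blast
  \<comment> \<open>Chosen after \<beta>: jumps of length \<open>J\<close> still cost only \<beta>,
    so the rate \<open>\<beta> * \<Lambda> / J\<close> becomes as small as wanted.\<close>
  define J where "J = nat \<lceil>\<beta> * \<Lambda> / \<eta>\<rceil> + 1"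
  have J: "1 \<le> J" by (simp add: J_def)
  have "\<beta> * \<Lambda> / \<eta> \<le> real J" unfolding J_def by linarith
  then have J_rate: "\<beta> * \<Lambda> / J \<le> \<eta>" using \<eta> J by (simp add: field_simps)
  \<comment> \<open>Contraction admits jumps of at most half the distance to the coset.\<close>
  define R where "R = 2 * real J"
  obtain \<Delta> where \<Delta>: "\<And>A A' u v. \<lbrakk>A \<in> cosets; A' \<in> cosets; u \<in> carrier G; v \<in> carrier G;
    \<exists>a\<in>A. Y.wd u a \<le> R; \<exists>a\<in>A. Y.wd v a \<le> R; \<exists>a\<in>A'. Y.wd u a \<le> R; \<exists>a\<in>A'. Y.wd v a \<le> R; A \<noteq> A'\<rbrakk>
    \<Longrightarrow> Y.wd u v \<le> \<Delta>"
    using coset_intersection[of R] by blast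
  \<comment> \<open>\<open>2 * R + \<Delta>\<close> is the \<open>Y\<close>-distance between the
    projections of the two ends of a window: down, across and down.\<close>
  obtain E where E: "0 \<le> E" "\<And>i g h. \<lbrakk>i \<in> I; g \<in> H i; h \<in> H i; Y.wd g h \<le> 2 * R + \<Delta>\<rbrakk> \<Longrightarrow> S.wd g h \<le> E"
    using proper_on_H[of "2 * R + \<Delta>"] by blast
  show ?thesis
  \<comment> \<open>Neither \<beta> nor \<open>E\<close> depends on \<open>L\<close>; only the
    radius \<open>r\<close> does. This order allows \<open>L\<close> to be chosen after the additive
    constant.\<close>
  proof (rule that[of "2 * \<beta> + E"])
    show "0 \<le> 2 * \<beta> + E" using \<beta> E by simp
    fix L
    have "\<forall>w\<in>carrier G. \<exists>f k. discrete_geodesic (carrier G) Y.wd f k \<and> f 0 = \<one> \<and> f k = w"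
      using Y.discrete_geodesic_exists by blast
    then obtain f k where f: "\<And>w. w \<in> carrier G \<Longrightarrow>
        discrete_geodesic (carrier G) Y.wd (f w) (k w) \<and> f w 0 = \<one> \<and> f w (k w) = w"
      by metis
    define crossed where "crossed w m l = {A \<in> cosets. (\<exists>a\<in>A. Y.wd (f w m) a \<le> R) \<and> (\<exists>a\<in>A. Y.wd (f w l) a \<le> R)}" for w m l
    define pairs where "pairs w = {(m, l). m \<le> k w \<and> l \<le> k w \<and> \<Delta> < \<bar>real m - real l\<bar>}" for w
    define W where "W = {w \<in> carrier G. S.wd \<one> w \<le> L}"
    \<comment> \<open>The cosets that a chosen geodesic with \<open>w\<close> in \<open>W\<close>
      follows for long, staying within \<open>R\<close> at two times more than \<Delta> apart. For
      each pair of times there is at most one.\<close>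
    define F where "F = (\<Union>w\<in>W. \<Union>(m, l)\<in>pairs w. crossed w m l)"
    have "finite (crossed w m l)" if "w \<in> W" "(m, l) \<in> pairs w" for w m l
    proof (rule finite_if_unique, rule ccontr)
      fix A A' assume A: "A \<in> crossed w m l" "A' \<in> crossed w m l" "A \<noteq> A'"
      have fw: "discrete_geodesic (carrier G) Y.wd (f w) (k w)" using f that(1) by (simp add: W_def)
      then have "Y.wd (f w m) (f w l) \<le> \<Delta>"
        using A that(2) by (intro \<Delta>[of A A']) (auto simp: crossed_def discrete_geodesic_def pairs_def)
      then show False using fw that(2) by (auto simp: discrete_geodesic_def pairs_def)
    qed
    moreover have "finite (pairs w)" for w
      by (rule finite_subset[of _ "{..k w} \<times> {..k w}"]) (auto simp: pairs_def)
    moreover have "finite W" unfolding W_def by (rule finite_ball)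
    ultimately have finF: "finite F" unfolding F_def by (intro finite_UN_I) auto
    define pt where "pt A = (SOME a. a \<in> A)" for A :: "'a set"
    \<comment> \<open>Each coset in \<open>F\<close> has a point of \<open>S\<close>-length below
      \<open>r\<close>. If \<open>H i\<close> is at distance at least \<open>r\<close> from
      \<open>x\<close>, the translate \<open>inv x <# H i\<close> has no such point and is not in
      \<open>F\<close>.\<close>
    define r where "r = Max (insert 0 ((\<lambda>A. S.len (pt A)) ` F)) + 1"
    have r: "S.len (pt A) < r" if "A \<in> F" for A
    proof -
      have "S.len (pt A) \<le> Max (insert 0 ((\<lambda>A. S.len (pt A)) ` F))" using finF that by (intro Max_ge) auto
      then show ?thesis by (simp add: r_def)
    qed
    show "\<exists>r. \<forall>i\<in>I. \<forall>x\<in>carrier G. \<forall>y\<in>carrier G.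
      S.wd x y \<le> L \<and> (\<forall>h\<in>H i. r \<le> S.wd x h) \<longrightarrow> S.wd (proj i x) (proj i y) \<le> \<eta> * L + (2 * \<beta> + E)"
    proof (intro exI[of _ "real r"] ballI impI)
      fix i x y assume i: "i \<in> I" and x: "x \<in> carrier G" and y: "y \<in> carrier G"
        and *: "S.wd x y \<le> L \<and> (\<forall>h\<in>H i. real r \<le> S.wd x h)"
      define w where "w = inv x \<otimes> y"
      define A where "A = inv x <# H i"
      have wW: "w \<in> W" using x y * by (simp add: W_def w_def word_dist_def)
      have wG: "w \<in> carrier G" using x y by (simp add: w_def)
      have A: "A \<in> cosets" using i x by (auto simp: A_def LCOSETS_def)
      have memA: "a \<in> A \<longleftrightarrow> x \<otimes> a \<in> H i" if "a \<in> carrier G" for a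
        unfolding A_def by (rule coset_mem_iff[OF i x that])
      have "A \<notin> F"
      proof
        assume "A \<in> F"
        have pA: "pt A \<in> A" unfolding pt_def using coset_nonempty[OF A] by (meson all_not_in_conv someI)
        then have pG: "pt A \<in> carrier G" using coset_subset[OF A] by blast
        then have "x \<otimes> pt A \<in> H i" using memA pA by simp
        then have "real r \<le> S.wd x (x \<otimes> pt A)" using * by blast
        also have "\<dots> = S.len (pt A)" using x pG by (simp add: word_dist_def m_assoc[symmetric])
        finally show False using r[OF \<open>A \<in> F\<close>] by simp
      qed
      define n where "n = k w"
      define z where "z j = x \<otimes> f w j" for j
      have fw: "discrete_geodesic (carrier G) Y.wd (f w) n" "f w 0 = \<one>" "f w n = w"
        using f[OF wG] by (auto simp: n_def)
      have fG: "f w j \<in> carrier G" if "j \<le> n" for j using fw(1) that by (simp add: discrete_geodesic_def)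
      have zG: "z j \<in> carrier G" if "j \<le> n" for j using fG[OF that] x by (simp add: z_def)
      have zd: "Y.wd (z m) (z l) = \<bar>real m - real l\<bar>" if "m \<le> n" "l \<le> n" for m l
        using fw(1) that fG x by (simp add: z_def Y.wd_mult_left discrete_geodesic_def)
      have z0: "z 0 = x" and zn: "z n = y" using x y fw by (auto simp: z_def w_def m_assoc[symmetric])
      define Z where "Z = {j. j \<le> n \<and> (\<exists>h\<in>H i. Y.wd (z j) h \<le> R)}"
      have nearA: "\<exists>a\<in>A. Y.wd (f w j) a \<le> R" if jZ: "j \<in> Z" for j
      proof -
        obtain h where h: "h \<in> H i" "Y.wd (z j) h \<le> R" and j: "j \<le> n" using jZ by (auto simp: Z_def)
        have hG: "h \<in> carrier G" using h H_subset[OF i] by blast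
        have xh: "x \<otimes> (inv x \<otimes> h) = h" using x hG by (simp add: m_assoc[symmetric])
        then have "inv x \<otimes> h \<in> A" using memA[of "inv x \<otimes> h"] x hG h by simp
        moreover have "Y.wd (f w j) (inv x \<otimes> h) = Y.wd (z j) h"
          using Y.wd_mult_left[OF fG[OF j] _ x, of "inv x \<otimes> h"] xh x hG by (simp add: z_def)
        ultimately show ?thesis using h by metis
      qed
      \<comment> \<open>Two near visits more than \<Delta> apart would put the translated coset
        \<open>A\<close> into \<open>F\<close>.\<close>
      have window: "\<bar>real m - real l\<bar> \<le> \<Delta>" if "m \<in> Z" "l \<in> Z" for m l
      proof (rule ccontr)
        assume "\<not> \<bar>real m - real l\<bar> \<le> \<Delta>"
        then have "(m, l) \<in> pairs w" using that by (auto simp: pairs_def Z_def n_def)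
        moreover have "A \<in> crossed w m l" using A nearA that by (simp add: crossed_def)
        ultimately show False using \<open>A \<notin> F\<close> wW by (auto simp: F_def)
      qed
      define P where "P j = proj i (z j)" for j
      have PH: "P j \<in> H i" and PG: "P j \<in> carrier G" if "j \<le> n" for j
        using proj_in[OF i zG[OF that]] proj_closed[OF i zG[OF that]] by (auto simp: P_def)
      have jump: "S.wd (P m) (P l) \<le> \<beta>" if ml: "m \<le> n" "l \<le> n" and near: "\<bar>real m - real l\<bar> \<le> J" and out: "m \<notin> Z" for m l
      proof (rule \<beta>(2)[OF i PH PH])
        have "R < Y.wd (z m) (P m)" using out ml PH[of m] by (auto simp: Z_def not_le)
        then have "2 * Y.wd (z m) (z l) \<le> Y.wd (z m) (P m)" using zd[OF ml] near by (simp add: R_def)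
        then show "Y.wd (P m) (P l) \<le> B"
          using nearest_proj[OF i zG] ml unfolding P_def by (intro B[OF H_coset[OF i] zG zG]) auto
      qed (use ml in auto)
      have jump': "S.wd (P m) (P l) \<le> \<beta>"
        if ml: "m \<le> l" "l \<le> n" "l \<le> m + J" and out: "m \<notin> Z \<or> l \<notin> Z \<or> m = l" for m l
      proof -
        consider "m \<notin> Z" | "l \<notin> Z" | "m = l" using out by blast
        then show ?thesis
        proof cases
          case 1
          then show ?thesis using jump[of m l] ml by auto
        next
          case 2
          then show ?thesis using jump[of l m] ml S.wd_commute[OF PG PG, of m l] by auto
        next
          case 3
          then show ?thesis using S.wd_refl[OF PG, of l] ml \<beta> by simp
        qed
      qed
      \<comment> \<open>With \<open>Z\<close> missing one of the half-open intervals, every jump of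
        positive length has an end outside \<open>Z\<close>, from which contraction applies.\<close>
      have chain: "S.wd (P m) (P l) \<le> \<beta> * ((real l - real m) / J + 1)"
        if ml: "m \<le> l" "l \<le> n" and out: "Z \<inter> {m..<l} = {} \<or> Z \<inter> {m<..l} = {}" for m l
      proof -
        have "S.wd (P (m + 0)) (P (m + (l - m))) \<le> \<beta> * (real (l - m) / J + 1)"
        proof (rule chain_bound[where e = "\<lambda>a b. S.wd (P (m + a)) (P (m + b))"])
          fix a b assume ab: "a \<le> b" "b \<le> l - m" "b \<le> a + J"
          have "m + a \<notin> Z \<or> m + b \<notin> Z \<or> m + a = m + b"
          proof (cases "a = b")
            case False
            then have "m + a \<in> {m..<l}" "m + b \<in> {m<..l}" using ab ml by auto
            then show ?thesis using out by blast
          qed simp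
          then show "S.wd (P (m + a)) (P (m + b)) \<le> \<beta>" using ab ml by (intro jump') auto
        next
          fix a b c assume "a \<le> b" "b \<le> c" "c \<le> l - m"
          then show "S.wd (P (m + a)) (P (m + c)) \<le> S.wd (P (m + a)) (P (m + b)) + S.wd (P (m + b)) (P (m + c))"
            using ml by (intro S.wd_triangle PG) auto
        qed (use J \<beta> in auto)
        then show ?thesis using ml by simp
      qed
      \<comment> \<open>Split at the first and the last near visit: the outer parts move the
        projection at the small rate, the window between them costs \<open>E\<close>.\<close>
      have total: "S.wd (P 0) (P n) \<le> \<beta> * (n / J + 2) + E"
      proof (cases "Z = {}")
        case True
        then have "S.wd (P 0) (P n) \<le> \<beta> * (n / J + 1)" using chain[of 0 n] by simp
        also have "\<dots> \<le> \<beta> * (n / J + 2)" using \<beta> by (intro mult_left_mono) auto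
        finally show ?thesis using E by simp
      next
        case False
        have finZ: "finite Z" by (rule finite_subset[of _ "{..n}"]) (auto simp: Z_def)
        define m l where "m = Min Z" and "l = Max Z"
        have mlZ: "m \<in> Z" "l \<in> Z" unfolding m_def l_def using finZ False by auto
        have ml: "m \<le> l" "l \<le> n" using finZ mlZ by (auto simp: m_def l_def Z_def)
        have out: "Z \<inter> {0..<m} = {}" "Z \<inter> {l<..n} = {}"
          using finZ by (auto simp: m_def l_def not_less[symmetric] dest: Min_le Max_ge)
        have "S.wd (P 0) (P m) \<le> \<beta> * (m / J + 1)" using chain[of 0 m] ml out by simp
        moreover have "S.wd (P l) (P n) \<le> \<beta> * ((real n - real l) / J + 1)" using chain[of l n] ml out by simp
        moreover have "S.wd (P m) (P l) \<le> E"
        proof (rule E(2)[OF i PH PH])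
          have foot: "Y.wd (z j) (P j) \<le> R" if "j \<in> Z" for j
            using that proj_le[OF i zG, of j] unfolding P_def Z_def by (auto intro: order_trans)
          have "Y.wd (P m) (P l) \<le> Y.wd (P m) (z m) + (Y.wd (z m) (z l) + Y.wd (z l) (P l))"
            using Y.wd_triangle[of "P m" "z m" "P l"] Y.wd_triangle[of "z m" "z l" "P l"] PG[of m] PG[of l] zG[of m] zG[of l] ml by auto
          also have "Y.wd (P m) (z m) = Y.wd (z m) (P m)" using PG[of m] zG[of m] ml by (intro Y.wd_commute) auto
          finally show "Y.wd (P m) (P l) \<le> 2 * R + \<Delta>"
            using foot[OF mlZ(1)] foot[OF mlZ(2)] window[OF mlZ] zd[of m l] ml by simp
        qed (use ml in auto)
        moreover have "S.wd (P 0) (P n) \<le> S.wd (P 0) (P m) + (S.wd (P m) (P l) + S.wd (P l) (P n))"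
          using S.wd_triangle[of "P 0" "P m" "P n"] S.wd_triangle[of "P m" "P l" "P n"] PG[of 0] PG[of m] PG[of l] PG[of n] ml by auto
        ultimately have "S.wd (P 0) (P n) \<le> \<beta> * (m / J + 1) + (E + \<beta> * ((real n - real l) / J + 1))" by linarith
        also have "\<dots> = \<beta> * ((m + (real n - real l)) / J + 2) + E"
          by (simp add: algebra_simps add_divide_distrib diff_divide_distrib)
        also have "\<dots> \<le> \<beta> * (n / J + 2) + E"
          using \<beta>(1) ml by (intro add_right_mono mult_left_mono divide_right_mono) auto
        finally show ?thesis .
      qed
      have L0: "0 \<le> L" using * S.wd_nonneg[of x y] by simp
      have "real n = Y.wd x y" using zd[of 0 n] z0 zn by simp
      also have "\<dots> \<le> \<Lambda> * L" using \<Lambda>(2)[OF x y] mult_left_mono[OF conjunct1[OF *] \<Lambda>(1)] by simp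
      finally have "\<beta> * (n / J) \<le> \<beta> * (\<Lambda> * L / J)" using \<beta>(1) by (intro mult_left_mono divide_right_mono) auto
      also have "\<dots> = \<beta> * \<Lambda> / J * L" by simp
      also have "\<dots> \<le> \<eta> * L" by (rule mult_right_mono[OF J_rate L0])
      finally show "S.wd (proj i x) (proj i y) \<le> \<eta> * L + (2 * \<beta> + E)"
        using total z0 zn by (simp add: P_def distrib_left)
    qed
  qed
qed

text \<open>During an excursion away from \<open>H i\<close> the projection advances by at most
  \<beta> per \<tau> units of time, a rate of at most \<open>1 / (4 * \<mu>)\<close>, while the ends
  of the excursion must separate at rate \<open>1 / \<mu>\<close>. Both ends are near their
  projections, so the excursion is short.\<close>

lemma quasi_geodesics_near_subgroup:
  assumes \<mu>: "1 \<le> \<mu>" and c: "0 \<le> c"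
  shows "\<exists>C. \<forall>i\<in>I. \<forall>a b \<gamma>. quasi_geodesic (carrier G) S.wd \<mu> c a b \<gamma> \<and> \<gamma> a \<in> H i \<and> \<gamma> b \<in> H i
      \<longrightarrow> \<gamma> ` {a..b} \<subseteq> closed_nbhd (carrier G) S.wd C (H i)"
proof -
  \<comment> \<open>Makes \<open>\<eta> * \<mu>\<close>, the part of the rate
    \<open>\<beta> / \<tau>\<close> that is independent of \<tau>, equal to
    \<open>1 / (8 * \<mu>)\<close>.\<close>
  define \<eta> where "\<eta> = 1 / (8 * \<mu>\<^sup>2)"
  have \<eta>: "0 < \<eta>" using \<mu> by (simp add: \<eta>_def)
  obtain K where K: "0 \<le> K" "\<And>L. \<exists>r. \<forall>i\<in>I. \<forall>x\<in>carrier G. \<forall>y\<in>carrier G.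
    S.wd x y \<le> L \<and> (\<forall>h\<in>H i. r \<le> S.wd x h) \<longrightarrow> S.wd (proj i x) (proj i y) \<le> \<eta> * L + K"
    using projection_sublinear[OF \<eta>] by blast
  \<comment> \<open>Long enough that the additive part \<open>(\<eta> * c + K) / \<tau>\<close> also
    contributes at most \<open>1 / (8 * \<mu>)\<close>.\<close>
  define \<tau> where "\<tau> = nat \<lceil>8 * \<mu> * (\<eta> * c + K)\<rceil> + 1"
  have \<tau>: "1 \<le> \<tau>" by (simp add: \<tau>_def)
  define L where "L = \<mu> * \<tau> + c"
  obtain r where r: "\<And>i x y. \<lbrakk>i \<in> I; x \<in> carrier G; y \<in> carrier G; S.wd x y \<le> L; \<And>h. h \<in> H i \<Longrightarrow> r \<le> S.wd x h\<rbrakk>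
    \<Longrightarrow> S.wd (proj i x) (proj i y) \<le> \<eta> * L + K"
    using K(2)[of L] by blast
  define \<beta> where "\<beta> = \<eta> * L + K"
  have \<beta>: "0 \<le> \<beta>" using \<eta> \<mu> c K by (simp add: \<beta>_def L_def)
  have "8 * \<mu> * (\<eta> * c + K) \<le> real \<tau>" unfolding \<tau>_def by linarith
  then have "(\<eta> * c + K) / \<tau> \<le> 1 / (8 * \<mu>)" using \<mu> \<tau> by (simp add: field_simps)
  moreover have "\<beta> / \<tau> = \<eta> * \<mu> + (\<eta> * c + K) / \<tau>" using \<tau> by (simp add: \<beta>_def L_def field_simps)
  moreover have "\<eta> * \<mu> = 1 / (8 * \<mu>)" using \<mu> by (simp add: \<eta>_def power2_eq_square)
  ultimately have rate: "\<beta> / \<tau> \<le> 1 / (4 * \<mu>)" by simp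
  define r0 where "r0 = max r 0"
  \<comment> \<open>The radius \<open>r0\<close> enlarged by what a quasi-geodesic can move in one
    unit of time.\<close>
  define r' where "r' = r0 + \<mu> + c"
  obtain \<Lambda> where \<Lambda>: "0 \<le> \<Lambda>" "\<And>x y. \<lbrakk>x \<in> carrier G; y \<in> carrier G\<rbrakk> \<Longrightarrow> Y.wd x y \<le> \<Lambda> * S.wd x y"
    using lipschitz by blast
  obtain \<rho> where \<rho>: "0 \<le> \<rho>" "\<And>i g h. \<lbrakk>i \<in> I; g \<in> H i; h \<in> H i; Y.wd g h \<le> 2 * (\<Lambda> * r')\<rbrakk> \<Longrightarrow> S.wd g h \<le> \<rho>"
    using proper_on_H[of "2 * (\<Lambda> * r')"] by blast
  define E where "E = r' + \<rho>"
  \<comment> \<open>The projection is nearest only for \<open>Y\<close>. Its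
    \<open>S\<close>-distance is controlled through \<open>h\<close>: both points lie in
    \<open>H i\<close> and are \<open>Y\<close>-close, so properness applies.\<close>
  have foot: "S.wd x (proj i x) \<le> E" if i: "i \<in> I" and x: "x \<in> carrier G" and h: "h \<in> H i" "S.wd x h \<le> r'" for i x h
  proof -
    have hG: "h \<in> carrier G" using h H_subset[OF i] by blast
    note pG = proj_closed[OF i x]
    have xh: "Y.wd x h \<le> \<Lambda> * r'" using \<Lambda>(2)[OF x hG] mult_left_mono[OF h(2) \<Lambda>(1)] by simp
    have "Y.wd h (proj i x) \<le> Y.wd h x + Y.wd x (proj i x)" using hG x pG by (rule Y.wd_triangle)
    also have "Y.wd h x = Y.wd x h" using hG x by (rule Y.wd_commute)
    finally have "Y.wd h (proj i x) \<le> 2 * (\<Lambda> * r')" using xh proj_le[OF i x h(1)] by simp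
    then have "S.wd h (proj i x) \<le> \<rho>" using \<rho>(2)[OF i h(1) proj_in[OF i x]] by simp
    then show ?thesis using S.wd_triangle[OF x hG pG] h(2) by (simp add: E_def)
  qed
  \<comment> \<open>Rounds up \<open>4 / 3 * \<mu> * (2 * E + \<beta> + c)\<close>, the bound on the
    duration of an excursion obtained below.\<close>
  define N where "N = 2 * \<mu> * (2 * E + \<beta> + c)"
  define C where "C = \<mu> * N + c + r'"
  have E0: "0 \<le> E" using \<rho> \<mu> c by (simp add: E_def r'_def r0_def)
  have N0: "0 \<le> N" using \<mu> \<beta> c E0 by (simp add: N_def)
  have C: "r0 \<le> C" using N0 \<mu> c by (simp add: C_def r'_def)
  show ?thesis
  proof (intro exI[of _ C] ballI allI impI subsetI)
    fix i a b \<gamma> g assume i: "i \<in> I"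
      and *: "quasi_geodesic (carrier G) S.wd \<mu> c a b \<gamma> \<and> \<gamma> a \<in> H i \<and> \<gamma> b \<in> H i" and g: "g \<in> \<gamma> ` {a..b}"
    obtain s where s: "s \<in> {a..b}" "g = \<gamma> s" using g by blast
    have ab: "a \<le> b" and \<gamma>G: "\<And>t. t \<in> {a..b} \<Longrightarrow> \<gamma> t \<in> carrier G"
      and lower: "\<And>s t. s \<in> {a..b} \<Longrightarrow> t \<in> {a..b} \<Longrightarrow> \<bar>s - t\<bar> / \<mu> - c \<le> S.wd (\<gamma> s) (\<gamma> t)"
      and upper: "\<And>s t. s \<in> {a..b} \<Longrightarrow> t \<in> {a..b} \<Longrightarrow> S.wd (\<gamma> s) (\<gamma> t) \<le> \<mu> * \<bar>s - t\<bar> + c"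
      using * unfolding quasi_geodesic_def by (blast | fast)+
    define close where "close t \<longleftrightarrow> (\<exists>h\<in>H i. S.wd (\<gamma> t) h \<le> r0)" for t
    have ends: "close a" "close b"
      using * \<gamma>G[of a] \<gamma>G[of b] ab S.wd_refl unfolding close_def r0_def by (metis atLeastAtMost_iff max.cobounded2 order_refl)+
    have "\<exists>h\<in>H i. S.wd g h \<le> C"
    proof (cases "close s")
      case True
      then show ?thesis using C s by (auto simp: close_def intro: order_trans)
    next
      case False
      \<comment> \<open>Clamping to the domain guarantees a hit, since both ends of the path are
        close.\<close>
      define m where "m = (LEAST k. close (max a (s - real k)))"
      define l where "l = (LEAST k. close (min b (s + real k)))"
      have "close (max a (s - real (nat \<lceil>s - a\<rceil>)))"
      proof -
        have "max a (s - real (nat \<lceil>s - a\<rceil>)) = a" by (simp add: max_def) linarith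
        then show ?thesis using ends by simp
      qed
      then have m: "close (max a (s - real m))" unfolding m_def by (rule LeastI)
      have "close (min b (s + real (nat \<lceil>b - s\<rceil>)))"
      proof -
        have "min b (s + real (nat \<lceil>b - s\<rceil>)) = b" by (simp add: min_def) linarith
        then show ?thesis using ends by simp
      qed
      then have l: "close (min b (s + real l))" unfolding l_def by (rule LeastI)
      have left: "\<not> close (s - real k) \<and> a < s - real k" if "k < m" for k
      proof -
        have nc: "\<not> close (max a (s - real k))" using not_less_Least[OF that[unfolded m_def]] .
        then have "a < s - real k" using ends by (cases "a < s - real k") (auto simp: max_def split: if_splits)
        then show ?thesis using nc by simp
      qed
      have right: "\<not> close (s + real k) \<and> s + real k < b" if "k < l" for k
      proof -
        have nc: "\<not> close (min b (s + real k))" using not_less_Least[OF that[unfolded l_def]] .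
        then have "s + real k < b" using ends by (cases "s + real k < b") (auto simp: min_def split: if_splits)
        then show ?thesis using nc by simp
      qed
      have m0: "0 < m" and l0: "0 < l" using m l False s by (auto intro!: gr0I)
      \<comment> \<open>One step before the hits: all times from \<open>u\<close> to
        \<open>v\<close> in unit steps are far from \<open>H i\<close>, while \<open>u\<close> and
        \<open>v\<close> are within one unit of a close time.\<close>
      define u v where "u = s - real (m - 1)" and "v = s + real (l - 1)"
      define n where "n = (m - 1) + (l - 1)"
      have uv: "v = u + real n" by (simp add: u_def v_def n_def)
      have far: "\<not> close (u + real j) \<and> u + real j \<in> {a..b}" if "j \<le> n" for j
      proof (cases "j \<le> m - 1")
        case True
        then have eq: "u + real j = s - real (m - 1 - j)" by (simp add: u_def)
        show ?thesis unfolding eq using left[of "m - 1 - j"] m0 s by simp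
      next
        case False
        then have eq: "u + real j = s + real (j - (m - 1))" by (simp add: u_def)
        have "j - (m - 1) < l" using that False l0 unfolding n_def by linarith
        from right[OF this] show ?thesis unfolding eq using s by simp
      qed
      have u: "u \<in> {a..b}" and v: "v \<in> {a..b}" using far[of 0] far[of n] uv by auto
      have near_end: "\<exists>h\<in>H i. S.wd (\<gamma> t) h \<le> r'" if "t \<in> {a..b}" "t' \<in> {a..b}" "\<bar>t - t'\<bar> \<le> 1" and t': "close t'" for t t'
      proof -
        obtain h where h: "h \<in> H i" "S.wd (\<gamma> t') h \<le> r0" using t' by (auto simp: close_def)
        have "S.wd (\<gamma> t) h \<le> S.wd (\<gamma> t) (\<gamma> t') + S.wd (\<gamma> t') h"
          using \<gamma>G that h H_subset[OF i] by (intro S.wd_triangle) auto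
        also have "S.wd (\<gamma> t) (\<gamma> t') \<le> \<mu> * 1 + c"
          using upper[OF that(1,2)] mult_left_mono[OF that(3) order_trans[OF zero_le_one \<mu>]] by linarith
        finally have "S.wd (\<gamma> t) h \<le> r'" using h(2) by (simp add: r'_def)
        then show ?thesis using h(1) by blast
      qed
      have hu: "\<exists>h\<in>H i. S.wd (\<gamma> u) h \<le> r'"
        by (rule near_end[OF u _ _ m]) (use s m0 u in \<open>auto simp: u_def\<close>)
      have hv: "\<exists>h\<in>H i. S.wd (\<gamma> v) h \<le> r'"
        by (rule near_end[OF v _ _ l]) (use s l0 v in \<open>auto simp: v_def\<close>)
      define x where "x j = \<gamma> (u + real j)" for j
      have xG: "x j \<in> carrier G" if "j \<le> n" for j using far[OF that] \<gamma>G by (simp add: x_def)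
      have "S.wd (proj i (x 0)) (proj i (x n)) \<le> \<beta> * (n / \<tau> + 1)"
      proof (rule chain_bound[where e = "\<lambda>a b. S.wd (proj i (x a)) (proj i (x b))"])
        fix j k assume jk: "j \<le> k" "k \<le> n" "k \<le> j + \<tau>"
        then have j: "j \<le> n" by simp
        show "S.wd (proj i (x j)) (proj i (x k)) \<le> \<beta>"
          unfolding \<beta>_def
        proof (rule r[OF i xG[OF j] xG[OF jk(2)]])
          have "S.wd (x j) (x k) \<le> \<mu> * \<bar>(u + real j) - (u + real k)\<bar> + c"
            unfolding x_def using far[OF j] far[OF jk(2)] by (intro upper) auto
          also have "\<dots> \<le> \<mu> * \<tau> + c" using jk \<mu> by (intro add_right_mono mult_left_mono) auto
          finally show "S.wd (x j) (x k) \<le> L" by (simp add: L_def)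
          show "r \<le> S.wd (x j) h" if "h \<in> H i" for h
            using far[OF j] that by (force simp: close_def x_def r0_def)
        qed
      next
        fix j k q assume "j \<le> k" "k \<le> q" "q \<le> n"
        then show "S.wd (proj i (x j)) (proj i (x q)) \<le>
            S.wd (proj i (x j)) (proj i (x k)) + S.wd (proj i (x k)) (proj i (x q))"
          using i xG by (intro S.wd_triangle proj_closed) auto
      qed (use \<tau> \<beta> in auto)
      then have mid: "S.wd (proj i (\<gamma> u)) (proj i (\<gamma> v)) \<le> \<beta> * (n / \<tau> + 1)" by (simp add: x_def uv)
      have fu: "S.wd (\<gamma> u) (proj i (\<gamma> u)) \<le> E" using foot[OF i \<gamma>G[OF u]] hu by blast
      have fv: "S.wd (\<gamma> v) (proj i (\<gamma> v)) \<le> E" using foot[OF i \<gamma>G[OF v]] hv by blast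
      note pu = proj_closed[OF i \<gamma>G[OF u]] and pv = proj_closed[OF i \<gamma>G[OF v]]
      have "real n / \<mu> - c \<le> S.wd (\<gamma> u) (\<gamma> v)" using lower[OF u v] by (simp add: uv)
      also have "\<dots> \<le> S.wd (\<gamma> u) (proj i (\<gamma> u)) + (S.wd (proj i (\<gamma> u)) (proj i (\<gamma> v)) + S.wd (proj i (\<gamma> v)) (\<gamma> v))"
        using S.wd_triangle[OF \<gamma>G[OF u] pu \<gamma>G[OF v]] S.wd_triangle[OF pu pv \<gamma>G[OF v]] by simp
      also have "S.wd (proj i (\<gamma> v)) (\<gamma> v) = S.wd (\<gamma> v) (proj i (\<gamma> v))" using pv \<gamma>G[OF v] by (rule S.wd_commute)
      finally have "real n / \<mu> - c \<le> 2 * E + \<beta> * (n / \<tau> + 1)" using fu fv mid by simp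
      also have "\<beta> * (n / \<tau> + 1) = \<beta> / \<tau> * n + \<beta>" by (simp add: algebra_simps)
      also have "\<beta> / \<tau> * n \<le> 1 / (4 * \<mu>) * n" by (rule mult_right_mono[OF rate]) simp
      finally have "real n / \<mu> - real n / (4 * \<mu>) \<le> 2 * E + \<beta> + c" by simp
      then have "3 * real n \<le> 4 * \<mu> * (2 * E + \<beta> + c)" using \<mu> by (simp add: field_simps)
      then have nN: "real n \<le> N" unfolding N_def using \<mu> E0 \<beta> c by (simp add: field_simps)
      obtain h where h: "h \<in> H i" "S.wd (\<gamma> u) h \<le> r'" using hu by blast
      have "S.wd g h \<le> S.wd g (\<gamma> u) + S.wd (\<gamma> u) h"
        using \<gamma>G[OF s(1)] \<gamma>G[OF u] h H_subset[OF i] s(2) by (intro S.wd_triangle) auto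
      also have "S.wd g (\<gamma> u) \<le> \<mu> * \<bar>s - u\<bar> + c" using upper[OF s(1) u] s(2) by simp
      also have "\<mu> * \<bar>s - u\<bar> \<le> \<mu> * N" using nN \<mu> by (intro mult_left_mono) (auto simp: u_def n_def)
      finally have "S.wd g h \<le> C" using h(2) by (simp add: C_def)
      then show ?thesis using h(1) by blast
    qed
    then show "g \<in> closed_nbhd (carrier G) S.wd C (H i)" using s \<gamma>G by (auto simp: closed_nbhd_def)
  qed
qed

end

theorem theorem2:
  fixes G :: "('a, 'm) monoid_scheme" and S :: "'a set"
    and I :: "'i set" and H :: "'i \<Rightarrow> 'a set"
  assumes "group G"
    and "finite S" and "S \<subseteq> carrier G" and "generate G S = carrier G"
    and "finite I"
    and "\<And>i. i \<in> I \<Longrightarrow> subgroup (H i) G"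
    and "\<And>i. i \<in> I \<Longrightarrow> \<exists>F. finite F \<and> F \<subseteq> H i \<and> generate G F = H i"
    and "hyperbolically_embedded G I H"
  shows "\<forall>\<mu> c. \<exists>C. \<forall>i\<in>I. \<forall>a b \<gamma>.
    quasi_geodesic (carrier G) (word_dist G S) \<mu> c a b \<gamma> \<and> \<gamma> a \<in> H i \<and> \<gamma> b \<in> H i
      \<longrightarrow> \<gamma> ` {a..b} \<subseteq> closed_nbhd (carrier G) (word_dist G S) C (H i)"
proof (intro allI)
  fix \<mu> c :: real
  obtain Y where Y: "hyperbolically_embedded_wrt G Y I H"
    using assms(8) by (auto simp: hyperbolically_embedded_def)
  interpret hyp_embedded G S Y I H
    using assms(1-6) Y by (simp add: hyp_embedded_def hyp_embedded_axioms_def)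
  show "\<exists>C. \<forall>i\<in>I. \<forall>a b \<gamma>.
    quasi_geodesic (carrier G) (word_dist G S) \<mu> c a b \<gamma> \<and> \<gamma> a \<in> H i \<and> \<gamma> b \<in> H i
      \<longrightarrow> \<gamma> ` {a..b} \<subseteq> closed_nbhd (carrier G) (word_dist G S) C (H i)"
  proof (cases "0 < \<mu>")
    case True
    \<comment> \<open>For positive \<mu>, enlarging both constants relaxes both inequalities; this
      reaches the range \<open>1 \<le> \<mu>\<close>, \<open>0 \<le> c\<close>.\<close>
    have weaken: "quasi_geodesic (carrier G) (word_dist G S) (max 1 \<mu>) (max 0 c) a b \<gamma>"
      if "quasi_geodesic (carrier G) (word_dist G S) \<mu> c a b \<gamma>" for a b \<gamma>
      unfolding quasi_geodesic_def
    proof (intro conjI ballI)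
      fix s t assume st: "s \<in> {a..b}" "t \<in> {a..b}"
      have "\<bar>s - t\<bar> / max 1 \<mu> \<le> \<bar>s - t\<bar> / \<mu>" using True by (intro divide_left_mono) auto
      then show "\<bar>s - t\<bar> / max 1 \<mu> - max 0 c \<le> word_dist G S (\<gamma> s) (\<gamma> t)"
        using that st unfolding quasi_geodesic_def by fastforce
      have "\<mu> * \<bar>s - t\<bar> \<le> max 1 \<mu> * \<bar>s - t\<bar>" by (intro mult_right_mono) auto
      then show "word_dist G S (\<gamma> s) (\<gamma> t) \<le> max 1 \<mu> * \<bar>s - t\<bar> + max 0 c"
        using that st unfolding quasi_geodesic_def by fastforce
    qed (use that in \<open>auto simp: quasi_geodesic_def\<close>)
    obtain C where C: "\<forall>i\<in>I. \<forall>a b \<gamma>.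
      quasi_geodesic (carrier G) S.wd (max 1 \<mu>) (max 0 c) a b \<gamma> \<and> \<gamma> a \<in> H i \<and> \<gamma> b \<in> H i
        \<longrightarrow> \<gamma> ` {a..b} \<subseteq> closed_nbhd (carrier G) S.wd C (H i)"
      using quasi_geodesics_near_subgroup[of "max 1 \<mu>" "max 0 c"] by auto
    show ?thesis
    proof (intro exI[of _ C] ballI allI impI)
      fix i a b \<gamma>
      assume "i \<in> I" "quasi_geodesic (carrier G) S.wd \<mu> c a b \<gamma> \<and> \<gamma> a \<in> H i \<and> \<gamma> b \<in> H i"
      then show "\<gamma> ` {a..b} \<subseteq> closed_nbhd (carrier G) S.wd C (H i)"
        using C[rule_format, OF _ conjI[OF weaken]] by blast
    qed
  next
    \<comment> \<open>For nonpositive \<open>\<mu>\<close> the upper bound alone confines the path to a ball of radius \<open>c\<close>.\<close>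
    case False
    show ?thesis
    proof (intro exI[of _ c] ballI allI impI subsetI)
      fix i a b \<gamma> g
      assume *: "quasi_geodesic (carrier G) (word_dist G S) \<mu> c a b \<gamma> \<and> \<gamma> a \<in> H i \<and> \<gamma> b \<in> H i"
        and g: "g \<in> \<gamma> ` {a..b}"
      obtain s where s: "s \<in> {a..b}" "g = \<gamma> s" using g by blast
      have "word_dist G S (\<gamma> s) (\<gamma> a) \<le> \<mu> * \<bar>s - a\<bar> + c"
      proof -
        have "a \<in> {a..b}" using s by simp
        then show ?thesis using * s(1) unfolding quasi_geodesic_def by blast
      qed
      also have "\<mu> * \<bar>s - a\<bar> \<le> 0" using False by (simp add: mult_nonpos_nonneg)
      finally show "g \<in> closed_nbhd (carrier G) (word_dist G S) c (H i)"
        using * s by (auto simp: closed_nbhd_def quasi_geodesic_def)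
    qed
  qed
qed

end
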